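(* (i) Let $\mathbf W=\{\dots\to W_3\to W_2\to W_1\}$ be an inverse sequence of fibrations that splits as a product of inverse sequences $\mathbf P=\{P_i\}$ and $\mathbf Q=\{Q_i\}$, where every bonding map $P_{i+1}\to P_i$ of $\mathbf P$ is nullhomotopic and every bonding map $Q_{i+1}\to Q_i$ of $\mathbf Q$ is a homotopy equivalence. Then the inverse limit space $W_\infty=\lim_i W_i$ is homotopy equivalent to $Q_1$. In particular, if $Q_1$ has the homotopy type of a CW complex, so has $W_\infty$. (ii) Let $\mathbf Z=\{\dots\to Z_3\to Z_2\to Z_1\}$ be an inverse sequence of fibrations between spaces having the homotopy type of a CW complex, with inverse limit $Z_\infty$. If $Z_\infty$ also has the homotopy type of a CW complex then, for any $\zeta=\{\zeta_i\}\in Z_\infty$, a subsequence of the induced inverse sequence of loop spaces $\Omega(\mathbf Z,\zeta)=\{\dots\to\Omega(Z_3,\zeta_3)\to\Omega(Z_2,\zeta_2)\to\Omega(Z_1,\zeta_1)\}$ splits as the product of an inverse sequence of nullhomotopic maps and the constant identity sequence $\{\dots=\Omega(Z_\infty,\zeta)=\Omega(Z_\infty,\zeta)\}$.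
   Context: All spaces are Hausdorff. A fibration is a Hurewicz fibration (a not necessarily surjective map with the homotopy lifting property for all spaces). Bonding maps of $\Omega(\mathbf Z,\zeta)$ are those induced by the bonding maps of $\mathbf Z$. For inverse sequences $\mathbf P=\{P_i\}$, $\mathbf Q=\{Q_i\}$, the product $\mathbf P\times\mathbf Q$ is the inverse sequence of the spaces $P_i\times Q_i$ with product bonding maps. An inverse sequence $\mathbf W$ splits as a product of $\mathbf P$ and $\mathbf Q$ if there exist homotopy equivalences $f_i\colon P_i\times Q_i\to W_i$ for all $i$ that commute up to homotopy with the bonding maps of $\mathbf P\times\mathbf Q$ and of $\mathbf W$. *)

theory Defs
  imports "HOL-Analysis.Analysis"
begin

section \<open>Homotopy equivalences and nullhomotopic maps\<close>

definition homotopy_equivalence_map :: "'a topology \<Rightarrow> 'b topology \<Rightarrow> ('a \<Rightarrow> 'b) \<Rightarrow> bool" where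
  "homotopy_equivalence_map X Y f \<longleftrightarrow>
     continuous_map X Y f \<and>
     (\<exists>g. continuous_map Y X g \<and>
          homotopic_with (\<lambda>_. True) X X (g \<circ> f) id \<and>
          homotopic_with (\<lambda>_. True) Y Y (f \<circ> g) id)"

text \<open>The constant must be a point of the target, so the map between empty spaces is not
  nullhomotopic.\<close>

definition nullhomotopic_map :: "'a topology \<Rightarrow> 'b topology \<Rightarrow> ('a \<Rightarrow> 'b) \<Rightarrow> bool" where
  "nullhomotopic_map X Y f \<longleftrightarrow>
     (\<exists>c \<in> topspace Y. homotopic_with (\<lambda>_. True) X Y f (\<lambda>_. c))"


section \<open>Function spaces and loop spaces\<close>

text \<open>Continuous maps are represented by functions that are undefined outside of the source,
  so that distinct points of the function space are distinct maps.\<close>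

definition compact_open_topology :: "'a topology \<Rightarrow> 'b topology \<Rightarrow> ('a \<Rightarrow> 'b) topology" where
  "compact_open_topology X Y =
     subtopology
       (topology_generated_by {{f. f ` K \<subseteq> U} | K U. compactin X K \<and> openin Y U})
       {f \<in> extensional (topspace X). continuous_map X Y f}"

definition loop_space :: "'a topology \<Rightarrow> 'a \<Rightarrow> (real \<Rightarrow> 'a) topology" where
  "loop_space X x =
     subtopology (compact_open_topology (top_of_set {0..1}) X) {\<gamma>. \<gamma> 0 = x \<and> \<gamma> 1 = x}"

definition loop_map :: "('a \<Rightarrow> 'b) \<Rightarrow> (real \<Rightarrow> 'a) \<Rightarrow> real \<Rightarrow> 'b" where
  "loop_map f \<gamma> = restrict (f \<circ> \<gamma>) {0..1}"


section \<open>Hurewicz fibrations\<close>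

definition homotopy_lifting_property ::
    "'c topology \<Rightarrow> 'e topology \<Rightarrow> 'b topology \<Rightarrow> ('e \<Rightarrow> 'b) \<Rightarrow> bool" where
  "homotopy_lifting_property X E B p \<longleftrightarrow>
     (\<forall>h f. continuous_map (prod_topology (top_of_set {0..1::real}) X) B h \<and>
            continuous_map X E f \<and> (\<forall>x \<in> topspace X. p (f x) = h (0, x)) \<longrightarrow>
       (\<exists>H. continuous_map (prod_topology (top_of_set {0..1::real}) X) E H \<and>
            (\<forall>x \<in> topspace X. H (0, x) = f x) \<and>
            (\<forall>t \<in> {0..1}. \<forall>x \<in> topspace X. p (H (t, x)) = h (t, x))))"

text \<open>The lifting property is required for all Hausdorff spaces. A definition can only
  quantify over the topologies on one type; the type used here carries the mapping path space
  of \<open>p\<close>, the universal test space, and \<open>Hurewicz_fibration_imp_HLP\<close> below shows that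
  spaces over every other type are then covered as well.\<close>

definition Hurewicz_fibration :: "'e topology \<Rightarrow> 'b topology \<Rightarrow> ('e \<Rightarrow> 'b) \<Rightarrow> bool" where
  "Hurewicz_fibration E B p \<longleftrightarrow>
     continuous_map E B p \<and>
     (\<forall>X :: ('e \<times> (real \<Rightarrow> 'b)) topology.
        Hausdorff_space X \<longrightarrow> homotopy_lifting_property X E B p)"

lemma topspace_compact_open_topology:
  "topspace (compact_open_topology X Y) = {f \<in> extensional (topspace X). continuous_map X Y f}"
proof -
  have "f \<in> \<Union> {{f. f ` K \<subseteq> U} | K U. compactin X K \<and> openin Y U}" for f :: "'a \<Rightarrow> 'b"
    by (rule UnionI[of "{f. f ` {} \<subseteq> {}}"]) blast+
  then show ?thesis
    unfolding compact_open_topology_def topspace_subtopology topology_generated_by_topspace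
    by blast
qed

lemma openin_compact_open_subbasic:
  assumes "compactin X K" "openin Y U"
  shows "openin (compact_open_topology X Y)
           {f \<in> topspace (compact_open_topology X Y). f ` K \<subseteq> U}"
proof -
  have "openin (topology_generated_by {{f. f ` K \<subseteq> U} | K U. compactin X K \<and> openin Y U})
          {f. f ` K \<subseteq> U}"
    using assms by (intro topology_generated_by_Basis) blast
  moreover have "{f \<in> topspace (compact_open_topology X Y). f ` K \<subseteq> U} =
      {f. f ` K \<subseteq> U} \<inter> {f \<in> extensional (topspace X). continuous_map X Y f}"
    unfolding topspace_compact_open_topology by blast
  ultimately show ?thesis
    unfolding compact_open_topology_def openin_subtopology by blast
qed

lemma Hausdorff_compact_open_topology:
  assumes "Hausdorff_space Y"
  shows "Hausdorff_space (compact_open_topology X Y)"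
  unfolding Hausdorff_space_def
proof clarify
  fix f g
  assume f: "f \<in> topspace (compact_open_topology X Y)"
    and g: "g \<in> topspace (compact_open_topology X Y)" and "f \<noteq> g"
  then obtain x where x: "x \<in> topspace X" "f x \<noteq> g x"
    by (auto simp: topspace_compact_open_topology intro: extensionalityI)
  have "f x \<in> topspace Y" "g x \<in> topspace Y"
    using f g x by (auto simp: topspace_compact_open_topology continuous_map_def)
  then obtain U V where UV: "openin Y U" "openin Y V" "f x \<in> U" "g x \<in> V" "disjnt U V"
    using assms x unfolding Hausdorff_space_def by blast
  have K: "compactin X {x}"
    using x by simp
  show "\<exists>U V. openin (compact_open_topology X Y) U \<and> openin (compact_open_topology X Y) V \<and>
              f \<in> U \<and> g \<in> V \<and> disjnt U V"
    using openin_compact_open_subbasic[OF K UV(1)] openin_compact_open_subbasic[OF K UV(2)]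
      UV f g by (intro exI conjI) (assumption | force simp: disjnt_iff)+
qed

lemma continuous_map_eval_interval:
  "continuous_map (prod_topology (top_of_set {0..1::real})
                     (compact_open_topology (top_of_set {0..1}) Y)) Y (\<lambda>(t, \<gamma>). \<gamma> t)"
  (is "continuous_map (prod_topology ?I ?M) Y ?e")
proof -
  have "\<exists>T. openin (prod_topology ?I ?M) T \<and> z \<in> T \<and> (\<forall>y\<in>T. ?e y \<in> U)"
    if z: "z \<in> topspace (prod_topology ?I ?M)" and U: "openin Y U" and zU: "?e z \<in> U" for z U
  proof -
    obtain t \<gamma> where zt: "z = (t, \<gamma>)" "t \<in> {0..1}" "\<gamma> \<in> topspace ?M"
      using z by auto
    have \<gamma>: "continuous_map ?I Y \<gamma>"
      using zt by (simp add: topspace_compact_open_topology)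
    have "openin ?I {s \<in> topspace ?I. \<gamma> s \<in> U}"
      using \<gamma> U by (rule openin_continuous_map_preimage)
    then obtain e where e: "e > 0" "cball t e \<inter> {0..1} \<subseteq> {s \<in> {0..1}. \<gamma> s \<in> U}"
      using zt zU by (force simp: openin_contains_cball)
    define K where "K = cball t e \<inter> {0..1}"
    have K: "compactin ?I K"
      by (auto simp: K_def compactin_subtopology compact_Int)
    have J: "openin ?I (ball t e \<inter> {0..1})"
      by (auto simp: openin_open)
    let ?T = "(ball t e \<inter> {0..1}) \<times> {\<delta> \<in> topspace ?M. \<delta> ` K \<subseteq> U}"
    have "openin (prod_topology ?I ?M) ?T"
      using J openin_compact_open_subbasic[OF K U] by (simp add: openin_prod_Times_iff)
    moreover have "z \<in> ?T"
      using zt e by (auto simp: K_def)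
    moreover have "\<forall>y\<in>?T. ?e y \<in> U"
      by (auto simp: K_def image_subset_iff)
    ultimately show ?thesis
      by blast
  qed
  moreover have "?e \<in> topspace (prod_topology ?I ?M) \<rightarrow> topspace Y"
    by (auto simp: topspace_compact_open_topology continuous_map_def)
  ultimately show ?thesis
    by (subst continuous_map_eq_topcontinuous_at)
      (fastforce simp: topcontinuous_at_def)
qed

lemma continuous_map_curry:
  assumes g: "continuous_map (prod_topology Y X) Z g"
  shows "continuous_map X (compact_open_topology Y Z) (\<lambda>x. restrict (\<lambda>t. g (t, x)) (topspace Y))"
    (is "continuous_map X _ ?c")
proof -
  have slice: "continuous_map Y Z (\<lambda>t. g (t, x))" if "x \<in> topspace X" for x
  proof -
    have "continuous_map Y (prod_topology Y X) (\<lambda>t. (t, x))"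
      using that by (simp add: continuous_map_pairwise o_def)
    from continuous_map_compose[OF this g] show ?thesis
      by (simp add: o_def)
  qed
  have "continuous_map X
          (topology_generated_by {{f. f ` K \<subseteq> U} | K U. compactin Y K \<and> openin Z U}) ?c"
  proof (rule continuous_on_generated_topo)
    fix S assume "S \<in> {{f. f ` K \<subseteq> U} | K U. compactin Y K \<and> openin Z U}"
    then obtain K U where S: "S = {f. f ` K \<subseteq> U}" and K: "compactin Y K" and U: "openin Z U"
      by blast
    have KY: "K \<subseteq> topspace Y"
      using K by (rule compactin_subset_topspace)
    let ?W = "{z \<in> topspace (prod_topology Y X). g z \<in> U}"
    have W: "openin (prod_topology Y X) ?W"
      using g U by (rule openin_continuous_map_preimage)
    show "openin X (?c -` S \<inter> topspace X)"
    proof (subst openin_subopen, clarify)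
      fix x assume x: "x \<in> topspace X" "?c x \<in> S"
      have "K \<times> {x} \<subseteq> ?W"
        using x KY by (auto simp: S)
      from tube_lemma_left[OF W K x(1) this] obtain A V where
        AV: "openin Y A" "openin X V" "K \<subseteq> A" "x \<in> V" "A \<times> V \<subseteq> ?W"
        by blast
      have "V \<subseteq> ?c -` S \<inter> topspace X"
        using AV KY openin_subset[OF AV(2)] by (auto simp: S)
      with AV show "\<exists>T. openin X T \<and> x \<in> T \<and> T \<subseteq> ?c -` S \<inter> topspace X"
        by blast
    qed
  next
    have "f \<in> \<Union> {{f. f ` K \<subseteq> U} | K U. compactin Y K \<and> openin Z U}" for f :: "'a \<Rightarrow> 'c"
      by (rule UnionI[of "{f. f ` {} \<subseteq> {}}"]) blast+
    then show "?c ` topspace X \<subseteq> \<Union> {{f. f ` K \<subseteq> U} | K U. compactin Y K \<and> openin Z U}"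
      by blast
  qed
  moreover have "continuous_map Y Z (?c x)" if "x \<in> topspace X" for x
    using slice[OF that] by (rule continuous_map_eq) simp
  ultimately show ?thesis
    unfolding compact_open_topology_def by (auto simp: continuous_map_in_subtopology)
qed

theorem Hurewicz_fibration_imp_HLP:
  fixes E :: "'e topology" and B :: "'b topology" and X :: "'c topology"
  assumes fib: "Hurewicz_fibration E B p" and E: "Hausdorff_space E" and B: "Hausdorff_space B"
  shows "homotopy_lifting_property X E B p"
  unfolding homotopy_lifting_property_def
proof (intro allI impI, elim conjE)
  let ?I = "top_of_set {0..1::real}"
  let ?M = "compact_open_topology ?I B"
  define N where "N = subtopology (prod_topology E ?M) {(e, \<gamma>). p e = \<gamma> 0}"
  fix h f
  assume h: "continuous_map (prod_topology ?I X) B h" and f: "continuous_map X E f"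
    and hf: "\<forall>x \<in> topspace X. p (f x) = h (0, x)"
  have "Hausdorff_space N"
    unfolding N_def
    by (intro Hausdorff_space_subtopology)
      (simp add: Hausdorff_space_prod_topology E Hausdorff_compact_open_topology[OF B])
  then have lift: "homotopy_lifting_property N E B p"
    using fib by (simp add: Hurewicz_fibration_def)
  have sndN: "continuous_map N ?M snd" and fstN: "continuous_map N E fst"
    unfolding N_def
    by (simp_all add: continuous_map_from_subtopology continuous_map_fst continuous_map_snd)
  let ?ev = "(\<lambda>(t, \<gamma>). \<gamma> t) \<circ> (\<lambda>z. (fst z, snd (snd z)))"
  have "continuous_map (prod_topology ?I N) (prod_topology ?I ?M) (\<lambda>z. (fst z, snd (snd z)))"
    using continuous_map_compose[OF continuous_map_snd[of ?I N] sndN]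
    by (intro continuous_map_pairedI) (simp_all add: continuous_map_fst o_def)
  from continuous_map_compose[OF this continuous_map_eval_interval]
  have ev: "continuous_map (prod_topology ?I N) B ?ev" .
  moreover have "\<forall>z \<in> topspace N. p (fst z) = ?ev (0, z)"
    by (auto simp: N_def)
  ultimately obtain H where H: "continuous_map (prod_topology ?I N) E H"
    "\<And>z. z \<in> topspace N \<Longrightarrow> H (0, z) = fst z"
    "\<And>t z. t \<in> {0..1} \<Longrightarrow> z \<in> topspace N \<Longrightarrow> p (H (t, z)) = ?ev (t, z)"
    using lift fstN unfolding homotopy_lifting_property_def by blast
  define c where "c = (\<lambda>x. (f x, restrict (\<lambda>t. h (t, x)) {0..1}))"
  have "continuous_map X (prod_topology E ?M) c"
    using continuous_map_curry[OF h] f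
    by (simp add: c_def continuous_map_pairedI)
  then have c: "continuous_map X N c"
    unfolding N_def using hf
    by (auto simp: continuous_map_in_subtopology c_def)
  then have cN: "c x \<in> topspace N" if "x \<in> topspace X" for x
    using that by (auto simp: continuous_map_def)
  have "continuous_map (prod_topology ?I X) (prod_topology ?I N) (\<lambda>z. (fst z, c (snd z)))"
    using continuous_map_compose[OF continuous_map_snd[of ?I X] c]
    by (intro continuous_map_pairedI) (simp_all add: continuous_map_fst o_def)
  from continuous_map_compose[OF this H(1)]
  have "continuous_map (prod_topology ?I X) E (H \<circ> (\<lambda>z. (fst z, c (snd z))))" .
  moreover have "\<forall>x \<in> topspace X. (H \<circ> (\<lambda>z. (fst z, c (snd z)))) (0, x) = f x"
    using H(2) cN by (simp add: c_def)
  moreover have "\<forall>t \<in> {0..1}. \<forall>x \<in> topspace X. p ((H \<circ> (\<lambda>z. (fst z, c (snd z)))) (t, x)) = h (t, x)"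
    using H(3) cN by (simp add: c_def)
  ultimately show "\<exists>H. continuous_map (prod_topology ?I X) E H \<and>
            (\<forall>x \<in> topspace X. H (0, x) = f x) \<and>
            (\<forall>t \<in> {0..1}. \<forall>x \<in> topspace X. p (H (t, x)) = h (t, x))"
    by blast
qed


section \<open>CW complexes\<close>

definition cell_disc :: "nat \<Rightarrow> (nat \<Rightarrow> real) set" where
  "cell_disc n = {x \<in> topspace (Euclidean_space n). (\<Sum>i<n. (x i)\<^sup>2) \<le> 1}"

definition cell_interior :: "nat \<Rightarrow> (nat \<Rightarrow> real) set" where
  "cell_interior n = {x \<in> topspace (Euclidean_space n). (\<Sum>i<n. (x i)\<^sup>2) < 1}"

definition cell_boundary :: "nat \<Rightarrow> (nat \<Rightarrow> real) set" where
  "cell_boundary n = {x \<in> topspace (Euclidean_space n). (\<Sum>i<n. (x i)\<^sup>2) = 1}"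

text \<open>A cell is given by its dimension and characteristic map. The conditions are
  Whitehead's: the open cells partition the space, each boundary lies in finitely many cells of
  lower dimension (closure-finiteness), and the space has the weak topology determined by the
  closed cells.\<close>

definition CW_decomposition :: "'a topology \<Rightarrow> (nat \<times> ((nat \<Rightarrow> real) \<Rightarrow> 'a)) set \<Rightarrow> bool" where
  "CW_decomposition X \<C> \<longleftrightarrow>
     (\<forall>(n, \<Phi>) \<in> \<C>.
        continuous_map (subtopology (Euclidean_space n) (cell_disc n)) X \<Phi> \<and>
        homeomorphic_map (subtopology (Euclidean_space n) (cell_interior n))
          (subtopology X (\<Phi> ` cell_interior n)) \<Phi>) \<and>
     (\<Union>(n, \<Phi>) \<in> \<C>. \<Phi> ` cell_interior n) = topspace X \<and>
     pairwise (\<lambda>(m, \<Psi>) (n, \<Phi>). disjnt (\<Psi> ` cell_interior m) (\<Phi> ` cell_interior n)) \<C> \<and>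
     (\<forall>(n, \<Phi>) \<in> \<C>. \<exists>\<F> \<subseteq> \<C>. finite \<F> \<and> (\<forall>(m, \<Psi>) \<in> \<F>. m < n) \<and>
        \<Phi> ` cell_boundary n \<subseteq> (\<Union>(m, \<Psi>) \<in> \<F>. \<Psi> ` cell_interior m)) \<and>
     (\<forall>A \<subseteq> topspace X.
        closedin X A \<longleftrightarrow> (\<forall>(n, \<Phi>) \<in> \<C>. closedin X (A \<inter> \<Phi> ` cell_disc n)))"

definition CW_complex :: "'a topology \<Rightarrow> bool" where
  "CW_complex X \<longleftrightarrow> Hausdorff_space X \<and> (\<exists>\<C>. CW_decomposition X \<C>)"

text \<open>The first argument names the type on which the CW complex lives. As a hypothesis with a
  free type variable, this says that there is such a complex on some type; countably many
  complexes can always be placed on a common type.\<close>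

definition has_CW_homotopy_type :: "'c itself \<Rightarrow> 'a topology \<Rightarrow> bool" where
  "has_CW_homotopy_type _ X \<longleftrightarrow>
     (\<exists>K :: 'c topology. CW_complex K \<and> X homotopy_equivalent_space K)"


section \<open>Inverse sequences\<close>

text \<open>The sequence \<open>\<dots> \<rightarrow> X 2 \<rightarrow> X 1 \<rightarrow> X 0\<close> starts at index \<open>0\<close>, and \<open>f i\<close> maps
  \<open>X (Suc i)\<close> to \<open>X i\<close>.\<close>

definition inverse_sequence :: "(nat \<Rightarrow> 'a topology) \<Rightarrow> (nat \<Rightarrow> 'a \<Rightarrow> 'a) \<Rightarrow> bool" where
  "inverse_sequence X f \<longleftrightarrow>
     (\<forall>i. Hausdorff_space (X i) \<and> continuous_map (X (Suc i)) (X i) (f i))"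

definition inverse_sequence_of_fibrations ::
    "(nat \<Rightarrow> 'a topology) \<Rightarrow> (nat \<Rightarrow> 'a \<Rightarrow> 'a) \<Rightarrow> bool" where
  "inverse_sequence_of_fibrations X f \<longleftrightarrow>
     inverse_sequence X f \<and> (\<forall>i. Hurewicz_fibration (X (Suc i)) (X i) (f i))"

definition inverse_limit ::
    "(nat \<Rightarrow> 'a topology) \<Rightarrow> (nat \<Rightarrow> 'a \<Rightarrow> 'a) \<Rightarrow> (nat \<Rightarrow> 'a) topology" where
  "inverse_limit X f = subtopology (product_topology X UNIV) {x. \<forall>i. f i (x (Suc i)) = x i}"

text \<open>For \<open>m \<le> n\<close>, the composite \<open>f m \<circ> \<dots> \<circ> f (n - 1)\<close> from \<open>X n\<close> to \<open>X m\<close>.\<close>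

fun bonding :: "(nat \<Rightarrow> 'a \<Rightarrow> 'a) \<Rightarrow> nat \<Rightarrow> nat \<Rightarrow> 'a \<Rightarrow> 'a" where
  "bonding f m 0 = id"
| "bonding f m (Suc n) = (if m \<le> n then bonding f m n \<circ> f n else id)"

definition splits_as_product ::
    "(nat \<Rightarrow> 'w topology) \<Rightarrow> (nat \<Rightarrow> 'w \<Rightarrow> 'w) \<Rightarrow>
     (nat \<Rightarrow> 'p topology) \<Rightarrow> (nat \<Rightarrow> 'p \<Rightarrow> 'p) \<Rightarrow>
     (nat \<Rightarrow> 'q topology) \<Rightarrow> (nat \<Rightarrow> 'q \<Rightarrow> 'q) \<Rightarrow> bool" where
  "splits_as_product W w P p Q q \<longleftrightarrow>
     (\<exists>f. \<forall>i. homotopy_equivalence_map (prod_topology (P i) (Q i)) (W i) (f i) \<and>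
        homotopic_with (\<lambda>_. True) (prod_topology (P (Suc i)) (Q (Suc i))) (W i)
          (w i \<circ> f (Suc i)) (f i \<circ> map_prod (p i) (q i)))"

end

(*
  (i) After identifying all Q_i with Q = Q_1, every bonding map of W factors up to homotopy as
  W_(i+1) -> Q -> W_i. The maps Q -> W_i can be made strictly compatible by homotopy lifting and
  give Q -> lim W, which has the left inverse lim W -> W_1 -> Q. That it is also a right inverse
  holds coordinatewise; the factorisation through Q makes the homotopies involved a Mittag-Leffler
  system, so they can be chosen coherently and lifted to strictly compatible ones.

  (ii) A space of CW homotopy type is semilocally contractible, and the fibres F_i of Z_oo -> Z_i
  shrink to the base point; so the inclusion of F_m into Z_oo is nullhomotopic for some m. For
  i >= m the fibration Z_oo -> Z_i then gives Omega Z_i ~ F_i x Omega Z_oo, and by restricting one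
  nullhomotopy of F_m the bonding maps become the inclusions F_j -> F_i times the identity. Since
  CW complexes are locally contractible, Omega Z_i and hence its retract F_i are semilocally
  contractible, so the inclusion of F_j into F_i is nullhomotopic for large j.
*)
theory Submission
  imports Defs
begin

section \<open>Homotopies relative to the ends\<close>

text \<open>Part (i) needs homotopies between homotopies, chosen continuously over the limit. They
  are handled without path spaces, as families of paths over a parameter space, and are transported
  along moving end points by filling squares; that such a transport can be undone up to homotopy is
  the main tool. In part (ii) the obstacle is that local contractibility is not a homotopy
  invariant. It is therefore proved and used in an actual CW complex, loops included, and only the
  semilocal form, which survives homotopy retracts, is carried over to the limit, the loop spaces of
  the \<open>Z i\<close> and the fibres. For loops the full local form enters because the points of
  a subdivision have to be moved inside prescribed neighbourhoods. The contraction of a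
  neighbourhood in a CW complex is defined cell by cell; to prove it continuous, it is regarded as a
  map to a path space, which avoids a comparison of topologies on the product with the
  interval.\<close>

abbreviation I01 :: "real topology" where
  "I01 \<equiv> top_of_set {0..1}"

abbreviation cylinder :: "'a topology \<Rightarrow> (real \<times> 'a) topology" where
  "cylinder \<equiv> prod_topology I01"

lemma continuous_map_into_I01:
  assumes "continuous_map S euclideanreal f" "\<And>z. z \<in> topspace S \<Longrightarrow> 0 \<le> f z \<and> f z \<le> 1"
  shows "continuous_map S I01 f"
  using assms by (auto simp: continuous_map_in_subtopology)

lemma continuous_map_from_I01:
  "continuous_map S I01 f \<Longrightarrow> continuous_map S euclideanreal f"
  by (simp add: continuous_map_in_subtopology)

lemma continuous_map_on_I01:
  assumes "continuous_on {0..1} f" "continuous_map S I01 g"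
  shows "continuous_map S euclideanreal (\<lambda>z. f (g z))"
proof -
  have "continuous_map I01 euclideanreal f"
    using assms(1) by simp
  from continuous_map_compose[OF assms(2) this] show ?thesis
    by (simp add: o_def)
qed

lemma continuous_map_pair_compose:
  assumes "continuous_map (prod_topology A T) Y H" "continuous_map S A f" "continuous_map S T g"
  shows "continuous_map S Y (\<lambda>z. H (f z, g z))"
  using continuous_map_compose[OF continuous_map_pairedI[OF assms(2,3)] assms(1)]
  by (simp add: o_def)

lemma continuous_map_square_compose:
  assumes "continuous_map (prod_topology A (prod_topology B T)) Y H" "continuous_map S A f"
    "continuous_map S B g" "continuous_map S T k"
  shows "continuous_map S Y (\<lambda>z. H (f z, (g z, k z)))"
  by (intro continuous_map_pair_compose[OF assms(1)] continuous_map_pairedI assms)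

lemma continuous_map_fst_snd:
  "continuous_map (prod_topology A (prod_topology B C)) B (\<lambda>z. fst (snd z))"
  using continuous_map_compose[OF continuous_map_snd continuous_map_fst] by (simp add: o_def)

lemma continuous_map_snd_snd:
  "continuous_map (prod_topology A (prod_topology B C)) C (\<lambda>z. snd (snd z))"
  using continuous_map_compose[OF continuous_map_snd continuous_map_snd] by (simp add: o_def)

lemmas cm_coords = continuous_map_fst continuous_map_snd continuous_map_fst_snd continuous_map_snd_snd
  continuous_map_from_I01[OF continuous_map_fst] continuous_map_from_I01[OF continuous_map_fst_snd]

lemmas cm_sub_coords = cm_coords cm_coords[THEN continuous_map_from_subtopology]

lemma continuous_map_I01_cases:
  assumes r: "continuous_map S euclideanreal r"
    and "continuous_map (subtopology S {z \<in> topspace S. r z \<le> c}) Y f"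
    and "continuous_map (subtopology S {z \<in> topspace S. c \<le> r z}) Y g"
    and "\<And>z. z \<in> topspace S \<Longrightarrow> r z = c \<Longrightarrow> f z = g z"
  shows "continuous_map S Y (\<lambda>z. if r z \<le> c then f z else g z)"
  by (rule continuous_map_cases_le) (use assms in auto)


text \<open>Families of paths in \<open>Y\<close> over a parameter space \<open>T\<close> take the
  place of single paths, as every choice made below must be continuous in a parameter. In a homotopy
  \<open>G (s, (t, x))\<close> of such families, \<open>s\<close> is the time of the deformation and
  \<open>t\<close> runs along the path.\<close>

definition homotopic_rel_ends ::
    "'t topology \<Rightarrow> 'y topology \<Rightarrow> (real \<times> 't \<Rightarrow> 'y) \<Rightarrow> (real \<times> 't \<Rightarrow> 'y) \<Rightarrow> bool" where
  "homotopic_rel_ends T Y h k \<longleftrightarrow>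
     homotopic_with (\<lambda>g. \<forall>x \<in> topspace T. g (0, x) = h (0, x) \<and> g (1, x) = h (1, x))
       (cylinder T) Y h k"

lemma homotopic_rel_ends_alt:
  "homotopic_rel_ends T Y h k \<longleftrightarrow>
     (\<exists>G. continuous_map (cylinder (cylinder T)) Y G \<and>
        (\<forall>t\<in>{0..1}. \<forall>x \<in> topspace T. G (0, (t, x)) = h (t, x) \<and> G (1, (t, x)) = k (t, x)) \<and>
        (\<forall>s\<in>{0..1}. \<forall>x \<in> topspace T. G (s, (0, x)) = h (0, x) \<and> G (s, (1, x)) = h (1, x)))"
proof -
  have "homotopic_rel_ends T Y h k \<longleftrightarrow>
     (\<exists>G. continuous_map (cylinder (cylinder T)) Y G \<and>
        (\<forall>z \<in> topspace (cylinder T). G (0, z) = h z) \<and>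
        (\<forall>z \<in> topspace (cylinder T). G (1, z) = k z) \<and>
        (\<forall>s\<in>{0..1}. \<forall>x \<in> topspace T. G (s, (0, x)) = h (0, x) \<and> G (s, (1, x)) = h (1, x)))"
    unfolding homotopic_rel_ends_def by (rule homotopic_with) simp
  then show ?thesis
    by (simp add: ball_conj_distrib conj_assoc)
qed

lemma homotopic_rel_endsI:
  assumes "continuous_map (cylinder (cylinder T)) Y G"
    "\<And>t x. t \<in> {0..1} \<Longrightarrow> x \<in> topspace T \<Longrightarrow> G (0, (t, x)) = h (t, x)"
    "\<And>t x. t \<in> {0..1} \<Longrightarrow> x \<in> topspace T \<Longrightarrow> G (1, (t, x)) = k (t, x)"
    "\<And>s x. s \<in> {0..1} \<Longrightarrow> x \<in> topspace T \<Longrightarrow> G (s, (0, x)) = h (0, x)"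
    "\<And>s x. s \<in> {0..1} \<Longrightarrow> x \<in> topspace T \<Longrightarrow> G (s, (1, x)) = h (1, x)"
  shows "homotopic_rel_ends T Y h k"
  unfolding homotopic_rel_ends_alt using assms by blast

lemma homotopic_rel_ends_continuous:
  assumes "homotopic_rel_ends T Y h k"
  shows "continuous_map (cylinder T) Y h" "continuous_map (cylinder T) Y k"
  using assms homotopic_with_imp_continuous_maps unfolding homotopic_rel_ends_def by blast+

lemma homotopic_rel_ends_endpoints:
  assumes "homotopic_rel_ends T Y h k" "x \<in> topspace T"
  shows "k (0, x) = h (0, x)" "k (1, x) = h (1, x)"
  using homotopic_with_imp_property[OF assms(1)[unfolded homotopic_rel_ends_def]] assms(2) by blast+

lemma homotopic_rel_ends_sym:
  assumes "homotopic_rel_ends T Y h k"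
  shows "homotopic_rel_ends T Y k h"
  using homotopic_with_symD[OF assms[unfolded homotopic_rel_ends_def]]
  unfolding homotopic_rel_ends_def
  by (rule homotopic_with_mono) (use homotopic_rel_ends_endpoints[OF assms] in auto)

lemma homotopic_rel_ends_trans:
  assumes "homotopic_rel_ends T Y h k" "homotopic_rel_ends T Y k l"
  shows "homotopic_rel_ends T Y h l"
proof -
  have "homotopic_with (\<lambda>g. \<forall>x \<in> topspace T. g (0, x) = h (0, x) \<and> g (1, x) = h (1, x))
       (cylinder T) Y k l"
    using assms(2) unfolding homotopic_rel_ends_def
    by (rule homotopic_with_mono) (use homotopic_rel_ends_endpoints[OF assms(1)] in auto)
  then show ?thesis
    using assms(1) homotopic_with_trans unfolding homotopic_rel_ends_def by blast
qed

lemma homotopic_rel_ends_eq: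
  assumes "continuous_map (cylinder T) Y h"
    "\<And>t x. t \<in> {0..1} \<Longrightarrow> x \<in> topspace T \<Longrightarrow> k (t, x) = h (t, x)"
  shows "homotopic_rel_ends T Y h k"
  unfolding homotopic_rel_ends_def
  by (rule homotopic_with_equal) (use assms in auto)

lemma homotopic_rel_ends_compose:
  assumes "homotopic_rel_ends T Y h k" "continuous_map Y Z f"
  shows "homotopic_rel_ends T Z (f \<circ> h) (f \<circ> k)"
  unfolding homotopic_rel_ends_def
  by (rule homotopic_with_compose_continuous_map_left[OF assms(1)[unfolded homotopic_rel_ends_def] assms(2)])
    simp

text \<open>Any two paths with the same ends in the (convex) square are homotopic; this yields all the
  reparametrisations and cancellations needed below.\<close>

lemma homotopic_rel_ends_square_paths:
  assumes S: "continuous_map (cylinder (cylinder T)) Y S"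
    and cont: "continuous_on {0..1} a" "continuous_on {0..1} b" "continuous_on {0..1} a'" "continuous_on {0..1} b'"
    and rng: "a ` {0..1} \<subseteq> {0..1}" "b ` {0..1} \<subseteq> {0..1}" "a' ` {0..1} \<subseteq> {0..1}" "b' ` {0..1} \<subseteq> {0..1}"
    and ends: "a 0 = a' 0" "b 0 = b' 0" "a 1 = a' 1" "b 1 = b' 1"
    and h: "\<And>t x. t \<in> {0..1} \<Longrightarrow> x \<in> topspace T \<Longrightarrow> h (t, x) = S (a t, (b t, x))"
    and k: "\<And>t x. t \<in> {0..1} \<Longrightarrow> x \<in> topspace T \<Longrightarrow> k (t, x) = S (a' t, (b' t, x))"
  shows "homotopic_rel_ends T Y h k"
proof (rule homotopic_rel_endsI)
  let ?c = "\<lambda>(a :: real \<Rightarrow> real) (a' :: real \<Rightarrow> real) (z :: real \<times> real \<times> 'a).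
     (1 - fst z) * a (fst (snd z)) + fst z * a' (fst (snd z))"
  have *: "continuous_map (cylinder (cylinder T)) I01 (?c a a')"
    if "continuous_on {0..1} a" "continuous_on {0..1} a'" "a ` {0..1} \<subseteq> {0..1}" "a' ` {0..1} \<subseteq> {0..1}"
    for a a'
  proof (rule continuous_map_into_I01)
    show "continuous_map (cylinder (cylinder T)) euclideanreal (?c a a')"
      by (intro continuous_intros cm_coords continuous_map_on_I01 that) auto
  next
    fix z assume "z \<in> topspace (cylinder (cylinder T))"
    then have z: "fst z \<in> {0..1}" "fst (snd z) \<in> {0..1}"
      by auto
    then have "a (fst (snd z)) \<in> {0..1}" "a' (fst (snd z)) \<in> {0..1}"
      using that by blast+
    then have "?c a a' z \<in> {0..1}"
      using z convexD[of "{0..1::real}" "a (fst (snd z))" "a' (fst (snd z))" "1 - fst z" "fst z"]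
      by auto
    then show "0 \<le> ?c a a' z \<and> ?c a a' z \<le> 1"
      by simp
  qed
  show "continuous_map (cylinder (cylinder T)) Y
          (\<lambda>z. S (?c a a' z, (?c b b' z, snd (snd z))))"
    by (intro continuous_map_square_compose[OF S] * cm_coords cont rng)
qed (use h k ends in \<open>auto simp: algebra_simps\<close>)

text \<open>The case of a square that is constant in its first coordinate. As \<open>b\<close> and
  \<open>b'\<close> need not be monotone, it also cancels a path that is run forth and back.\<close>

lemma homotopic_rel_ends_reparam:
  assumes H: "continuous_map (cylinder T) Y H"
    and cont: "continuous_on {0..1} b" "continuous_on {0..1} b'"
    and rng: "b ` {0..1} \<subseteq> {0..1}" "b' ` {0..1} \<subseteq> {0..1}"
    and ends: "b 0 = b' 0" "b 1 = b' 1"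
    and h: "\<And>t x. t \<in> {0..1} \<Longrightarrow> x \<in> topspace T \<Longrightarrow> h (t, x) = H (b t, x)"
    and k: "\<And>t x. t \<in> {0..1} \<Longrightarrow> x \<in> topspace T \<Longrightarrow> k (t, x) = H (b' t, x)"
  shows "homotopic_rel_ends T Y h k"
proof (rule homotopic_rel_ends_square_paths[where a = "\<lambda>_. 0" and a' = "\<lambda>_. 0" and b = b and b' = b'])
  show "continuous_map (cylinder (cylinder T)) Y (H \<circ> snd)"
    by (rule continuous_map_compose[OF continuous_map_snd H])
qed (use assms in auto)

section \<open>Gluing, filling, comparing and lifting squares\<close>

lemma continuous_map_three_pieces:
  assumes f: "continuous_map (cylinder T) Y f" and g: "continuous_map (cylinder T) Y g"
    and k: "continuous_map (cylinder T) Y k"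
    and fg: "\<And>x. x \<in> topspace T \<Longrightarrow> f (1, x) = g (0, x)"
    and gk: "\<And>x. x \<in> topspace T \<Longrightarrow> g (1, x) = k (0, x)"
  shows "continuous_map (cylinder T) Y
    (\<lambda>z. if fst z \<le> 1/3 then f (3 * fst z, snd z)
         else if fst z \<le> 2/3 then g (3 * fst z - 1, snd z) else k (3 * fst z - 2, snd z))"
proof (rule continuous_map_I01_cases)
  show "continuous_map (cylinder T) euclideanreal fst"
    by (rule cm_coords)
  let ?A = "subtopology (cylinder T) {z \<in> topspace (cylinder T). fst z \<le> 1/3}"
  show "continuous_map ?A Y (\<lambda>z. f (3 * fst z, snd z))"
    by (rule continuous_map_pair_compose[OF f] continuous_map_into_I01 continuous_intros cm_sub_coords | force)+
  let ?B = "subtopology (cylinder T) {z \<in> topspace (cylinder T). 1/3 \<le> fst z}"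
  show "continuous_map ?B Y
     (\<lambda>z. if fst z \<le> 2/3 then g (3 * fst z - 1, snd z) else k (3 * fst z - 2, snd z))"
  proof (rule continuous_map_I01_cases)
    show "continuous_map ?B euclideanreal fst"
      by (rule cm_sub_coords)
    show "continuous_map (subtopology ?B {z \<in> topspace ?B. fst z \<le> 2/3}) Y (\<lambda>z. g (3 * fst z - 1, snd z))"
      unfolding subtopology_subtopology
      by (rule continuous_map_pair_compose[OF g] continuous_map_into_I01 continuous_intros cm_sub_coords | force)+
    show "continuous_map (subtopology ?B {z \<in> topspace ?B. 2/3 \<le> fst z}) Y (\<lambda>z. k (3 * fst z - 2, snd z))"
      unfolding subtopology_subtopology
      by (rule continuous_map_pair_compose[OF k] continuous_map_into_I01 continuous_intros cm_sub_coords | force)+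
  next
    fix z assume z: "z \<in> topspace ?B" and "fst z = 2/3"
    then obtain x where "z = (2/3, x)" "x \<in> topspace T"
      by (cases z) auto
    then show "g (3 * fst z - 1, snd z) = k (3 * fst z - 2, snd z)"
      using gk by simp
  qed
next
  fix z assume z: "z \<in> topspace (cylinder T)" and "fst z = 1/3"
  then obtain x where "z = (1/3, x)" "x \<in> topspace T"
    by (cases z) auto
  then show "f (3 * fst z, snd z)
         = (if fst z \<le> 2/3 then g (3 * fst z - 1, snd z) else k (3 * fst z - 2, snd z))"
    using fg by simp
qed

lemma continuous_map_two_pieces:
  assumes f: "continuous_map (cylinder T) Y f" and g: "continuous_map (cylinder T) Y g"
    and fg: "\<And>x. x \<in> topspace T \<Longrightarrow> f (1, x) = g (0, x)"
  shows "continuous_map (cylinder T) Y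
    (\<lambda>z. if fst z \<le> 1/2 then f (2 * fst z, snd z) else g (2 * fst z - 1, snd z))"
proof (rule continuous_map_I01_cases)
  show "continuous_map (cylinder T) euclideanreal fst"
    by (rule cm_coords)
  let ?A = "subtopology (cylinder T) {z \<in> topspace (cylinder T). fst z \<le> 1/2}"
  show "continuous_map ?A Y (\<lambda>z. f (2 * fst z, snd z))"
    by (rule continuous_map_pair_compose[OF f] continuous_map_into_I01 continuous_intros cm_sub_coords | force)+
  let ?B = "subtopology (cylinder T) {z \<in> topspace (cylinder T). 1/2 \<le> fst z}"
  show "continuous_map ?B Y (\<lambda>z. g (2 * fst z - 1, snd z))"
    by (rule continuous_map_pair_compose[OF g] continuous_map_into_I01 continuous_intros cm_sub_coords | force)+
next
  fix z assume z: "z \<in> topspace (cylinder T)" and "fst z = 1/2"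
  then obtain x where "z = (1/2, x)" "x \<in> topspace T"
    by (cases z) auto
  then show "f (2 * fst z, snd z) = g (2 * fst z - 1, snd z)"
    using fg by simp
qed

lemma continuous_map_reverse:
  assumes f: "continuous_map (cylinder T) Y f"
  shows "continuous_map (cylinder T) Y (\<lambda>z. f (1 - fst z, snd z))"
  by (rule continuous_map_pair_compose[OF f] continuous_map_into_I01 continuous_intros cm_sub_coords | force)+

text \<open>The three given sides form one path \<open>u\<close>: \<open>a\<close> reversed, then
  \<open>h\<close>, then \<open>b\<close>. Pulling \<open>u\<close> back along a map from the square
  to the interval fills the square, with all of \<open>u\<close> as the top side. This transports
  \<open>h\<close> along the tracks \<open>a\<close> and \<open>b\<close> of its ends.\<close>

lemma square_filling:
  assumes h: "continuous_map (cylinder T) Y h"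
    and a: "continuous_map (cylinder T) Y a" and b: "continuous_map (cylinder T) Y b"
    and ha: "\<And>x. x \<in> topspace T \<Longrightarrow> a (0, x) = h (0, x)"
    and hb: "\<And>x. x \<in> topspace T \<Longrightarrow> b (0, x) = h (1, x)"
  obtains G where "continuous_map (cylinder (cylinder T)) Y G"
    "\<And>t x. t \<in> {0..1} \<Longrightarrow> x \<in> topspace T \<Longrightarrow> G (0, (t, x)) = h (t, x)"
    "\<And>s x. s \<in> {0..1} \<Longrightarrow> x \<in> topspace T \<Longrightarrow> G (s, (0, x)) = a (s, x)"
    "\<And>s x. s \<in> {0..1} \<Longrightarrow> x \<in> topspace T \<Longrightarrow> G (s, (1, x)) = b (s, x)"
proof
  define u where "u = (\<lambda>z. if fst z \<le> 1/3 then (\<lambda>z. a (1 - fst z, snd z)) (3 * fst z, snd z)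
         else if fst z \<le> 2/3 then h (3 * fst z - 1, snd z) else b (3 * fst z - 2, snd z))"
  have u: "continuous_map (cylinder T) Y u"
    unfolding u_def by (intro continuous_map_three_pieces continuous_map_reverse h a b) (simp_all add: ha hb)
  \<comment> \<open>At \<open>s = 0\<close> this is the middle third, where \<open>u\<close> runs
    through \<open>h\<close>. It widens linearly to the whole interval at \<open>s = 1\<close>, and
    its ends sweep the outer thirds along \<open>a\<close> and \<open>b\<close>.\<close>
  let ?r = "\<lambda>z. (1 - fst z) * (1 + fst (snd z)) / 3 + fst z * fst (snd z)"
  let ?G = "\<lambda>z. u (?r z, snd (snd z))"
  have "continuous_map (cylinder (cylinder T)) I01 ?r"
  proof (rule continuous_map_into_I01)
    fix z assume "z \<in> topspace (cylinder (cylinder T))"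
    then have z: "0 \<le> fst z" "fst z \<le> 1" "0 \<le> fst (snd z)" "fst (snd z) \<le> 1"
      by auto
    have "(1 - fst z) * (1 + fst (snd z)) \<le> (1 - fst z) * 3" "fst z * fst (snd z) \<le> fst z * 1"
      using z by (intro mult_left_mono; simp)+
    moreover have "0 \<le> (1 - fst z) * (1 + fst (snd z))" "0 \<le> fst z * fst (snd z)"
      using z by simp_all
    ultimately show "0 \<le> ?r z \<and> ?r z \<le> 1"
      by simp
  qed (intro continuous_intros cm_coords, auto)
  then show "continuous_map (cylinder (cylinder T)) Y ?G"
    by (intro continuous_map_pair_compose[OF u] cm_coords)
  show "?G (0, (t, x)) = h (t, x)" if "t \<in> {0..1}" "x \<in> topspace T" for t x
  proof -
    have "h (0, x) = u (1/3, x)"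
      using that ha by (simp add: u_def)
    moreover have "u ((1+t)/3, x) = h (t, x)" if "0 < t"
      using that \<open>t \<in> {0..1}\<close> by (simp add: u_def field_simps)
    ultimately show ?thesis
      using that by (cases "t = 0") auto
  qed
  show "?G (s, (0, x)) = a (s, x)" if "s \<in> {0..1}" "x \<in> topspace T" for s x
    using that by (auto simp: u_def diff_divide_distrib)
  show "?G (s, (1, x)) = b (s, x)" if "s \<in> {0..1}" "x \<in> topspace T" for s x
  proof -
    have "?r (s, (1, x)) = (2 + s) / 3"
      by (simp add: field_simps)
    moreover have "u ((2 + s) / 3, x) = b (s, x)"
      using that hb[OF that(2)] by (cases "s = 0") (auto simp: u_def field_simps)
    ultimately show ?thesis
      by (simp only: fst_conv snd_conv)
  qed
qed

text \<open>By convexity of the square its bottom side can be replaced by the way around the other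
  three sides, traced by \<open>?\<alpha>\<close> (the height) and \<open>?\<beta>\<close> (the
  horizontal position).\<close>

lemma homotopic_rel_ends_detour:
  assumes H: "continuous_map (cylinder (cylinder T)) Y H"
  shows "homotopic_rel_ends T Y (\<lambda>z. H (0, z))
     (\<lambda>z. if fst z \<le> 1/3 then H (3 * fst z, (0, snd z))
           else if fst z \<le> 2/3 then H (1, (3 * fst z - 1, snd z)) else H (3 - 3 * fst z, (1, snd z)))"
proof (rule homotopic_rel_ends_square_paths[OF H])
  let ?\<alpha> = "\<lambda>t::real. min (min (3 * t) 1) (3 - 3 * t)" and ?\<beta> = "\<lambda>t::real. max 0 (min 1 (3 * t - 1))"
  show "continuous_on {0..1} (\<lambda>t::real. 0::real)" "continuous_on {0..1} (\<lambda>t::real. t)"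
    by (auto intro: continuous_intros)
  show "continuous_on {0..1} ?\<alpha>" "continuous_on {0..1} ?\<beta>"
    by (intro continuous_intros)+
  fix t x assume "t \<in> {0..1::real}" "x \<in> topspace T"
  consider "t \<le> 1/3" "?\<alpha> t = 3 * t" "?\<beta> t = 0" | "1/3 < t" "t \<le> 2/3" "?\<alpha> t = 1" "?\<beta> t = 3 * t - 1"
    | "2/3 < t" "?\<alpha> t = 3 - 3 * t" "?\<beta> t = 1"
    by linarith
  then show "(\<lambda>z. if fst z \<le> 1/3 then H (3 * fst z, (0, snd z))
           else if fst z \<le> 2/3 then H (1, (3 * fst z - 1, snd z)) else H (3 - 3 * fst z, (1, snd z))) (t, x)
      = H (?\<alpha> t, (?\<beta> t, x))"
    by cases simp_all
qed auto

text \<open>Go around both squares: the sides coincide, and only the tops have to be deformed into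
  each other. Hence transport of paths along given tracks of their ends is injective up to homotopy,
  which complements the existence in \<open>square_filling\<close>.\<close>

lemma square_bottom_unique:
  assumes G: "continuous_map (cylinder (cylinder T)) Y G"
    and G': "continuous_map (cylinder (cylinder T)) Y G'"
    and left: "\<And>s x. s \<in> {0..1} \<Longrightarrow> x \<in> topspace T \<Longrightarrow> G (s, (0, x)) = G' (s, (0, x))"
    and right: "\<And>s x. s \<in> {0..1} \<Longrightarrow> x \<in> topspace T \<Longrightarrow> G (s, (1, x)) = G' (s, (1, x))"
    and top: "homotopic_rel_ends T Y (\<lambda>z. G (1, z)) (\<lambda>z. G' (1, z))"
  shows "homotopic_rel_ends T Y (\<lambda>z. G (0, z)) (\<lambda>z. G' (0, z))"
proof -
  obtain \<Theta> where \<Theta>: "continuous_map (cylinder (cylinder T)) Y \<Theta>"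
    "\<And>t x. t\<in>{0..1} \<Longrightarrow> x \<in> topspace T \<Longrightarrow> \<Theta> (0, (t, x)) = G (1, (t, x))"
    "\<And>t x. t\<in>{0..1} \<Longrightarrow> x \<in> topspace T \<Longrightarrow> \<Theta> (1, (t, x)) = G' (1, (t, x))"
    "\<And>s x. s\<in>{0..1} \<Longrightarrow> x \<in> topspace T \<Longrightarrow> \<Theta> (s, (0, x)) = G (1, (0, x))"
    "\<And>s x. s\<in>{0..1} \<Longrightarrow> x \<in> topspace T \<Longrightarrow> \<Theta> (s, (1, x)) = G (1, (1, x))"
    using top unfolding homotopic_rel_ends_alt by fastforce
  let ?T = "cylinder T"
  have c1: "continuous_map (cylinder ?T) Y (\<lambda>z. G (fst z, (0, snd (snd z))))"
    by (intro continuous_map_square_compose[OF G] cm_coords) auto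
  have c2: "continuous_map (cylinder ?T) Y (\<lambda>z. \<Theta> (fst (snd z), (fst z, snd (snd z))))"
    by (intro continuous_map_square_compose[OF \<Theta>(1)] cm_coords)
  have c3: "continuous_map (cylinder ?T) Y (\<lambda>z. G (1 - fst z, (1, snd (snd z))))"
    by (rule continuous_map_square_compose[OF G] continuous_map_into_I01 continuous_intros cm_sub_coords | force)+
  note m = continuous_map_three_pieces[OF c1 c2 c3]
  \<comment> \<open>A path family over \<open>cylinder T\<close>, whose additional parameter runs
    through the deformation \<open>\<Theta>\<close> of the top while the sides stay fixed. In the
    middle third the path coordinate comes first, so the two interval coordinates of
    \<open>\<Theta>\<close> are exchanged.\<close>
  let ?M = "(\<lambda>z. if fst z \<le> 1/3 then (\<lambda>z. G (fst z, (0, snd (snd z)))) (3 * fst z, snd z)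
         else if fst z \<le> 2/3 then (\<lambda>z. \<Theta> (fst (snd z), (fst z, snd (snd z)))) (3 * fst z - 1, snd z)
         else (\<lambda>z. G (1 - fst z, (1, snd (snd z)))) (3 * fst z - 2, snd z))"
  have M: "continuous_map (cylinder ?T) Y ?M"
    by (rule m) (auto simp: \<Theta>)
  have "homotopic_rel_ends T Y (\<lambda>z. ?M (fst z, (0, snd z))) (\<lambda>z. ?M (fst z, (1, snd z)))"
  proof (rule homotopic_rel_endsI)
    show "continuous_map (cylinder ?T) Y (\<lambda>z. ?M (fst (snd z), (fst z, snd (snd z))))"
      by (intro continuous_map_square_compose[OF M] cm_coords)
  qed auto
  moreover have "homotopic_rel_ends T Y (\<lambda>z. G (0, z)) (\<lambda>z. ?M (fst z, (0, snd z)))"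
  proof (rule homotopic_rel_ends_trans[OF homotopic_rel_ends_detour[OF G] homotopic_rel_ends_eq])
    show "continuous_map ?T Y (\<lambda>z. if fst z \<le> 1/3 then G (3 * fst z, (0, snd z))
           else if fst z \<le> 2/3 then G (1, (3 * fst z - 1, snd z)) else G (3 - 3 * fst z, (1, snd z)))"
      by (rule homotopic_rel_ends_continuous(2)[OF homotopic_rel_ends_detour[OF G]])
  qed (auto simp: \<Theta>)
  moreover have "homotopic_rel_ends T Y (\<lambda>z. G' (0, z)) (\<lambda>z. ?M (fst z, (1, snd z)))"
  proof (rule homotopic_rel_ends_trans[OF homotopic_rel_ends_detour[OF G'] homotopic_rel_ends_eq])
    show "continuous_map ?T Y (\<lambda>z. if fst z \<le> 1/3 then G' (3 * fst z, (0, snd z))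
           else if fst z \<le> 2/3 then G' (1, (3 * fst z - 1, snd z)) else G' (3 - 3 * fst z, (1, snd z)))"
      by (rule homotopic_rel_ends_continuous(2)[OF homotopic_rel_ends_detour[OF G']])
  qed (auto simp: \<Theta> left right)
  ultimately show ?thesis
    using homotopic_rel_ends_trans homotopic_rel_ends_sym by meson
qed

lemma homotopy_lifting_propertyE:
  assumes "homotopy_lifting_property X E B p"
    and "continuous_map (cylinder X) B h" "continuous_map X E f"
    and "\<And>x. x \<in> topspace X \<Longrightarrow> p (f x) = h (0, x)"
  obtains H where "continuous_map (cylinder X) E H"
    "\<And>x. x \<in> topspace X \<Longrightarrow> H (0, x) = f x"
    "\<And>t x. t \<in> {0..1} \<Longrightarrow> x \<in> topspace X \<Longrightarrow> p (H (t, x)) = h (t, x)"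
proof -
  have "continuous_map (cylinder X) B h \<and> continuous_map X E f \<and> (\<forall>x \<in> topspace X. p (f x) = h (0, x))"
    using assms by simp
  with assms(1) have "\<exists>H. continuous_map (cylinder X) E H \<and>
      (\<forall>x \<in> topspace X. H (0, x) = f x) \<and>
      (\<forall>t \<in> {0..1}. \<forall>x \<in> topspace X. p (H (t, x)) = h (t, x))"
    unfolding homotopy_lifting_property_def by (elim allE impE) assumption
  then show thesis
    using that by (elim exE conjE) simp
qed

text \<open>The lifting property prescribes a lift only at time 0. Instead of a homeomorphism that
  straightens the bottom and the two sides into one edge, each point of the square is joined to
  these three edges by a segment on a line through \<open>(2, 1/2)\<close>, and the segments are
  lifted from their starts.\<close>

lemma HLP_square:
  assumes lift: "homotopy_lifting_property (cylinder (cylinder T)) E B p"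
    and G: "continuous_map (cylinder (cylinder T)) B G"
    and h: "continuous_map (cylinder T) E h"
    and a: "continuous_map (cylinder T) E a" and b: "continuous_map (cylinder T) E b"
    and ha: "\<And>x. x \<in> topspace T \<Longrightarrow> a (0, x) = h (0, x)"
    and hb: "\<And>x. x \<in> topspace T \<Longrightarrow> b (0, x) = h (1, x)"
    and ph: "\<And>t x. t \<in> {0..1} \<Longrightarrow> x \<in> topspace T \<Longrightarrow> p (h (t, x)) = G (0, (t, x))"
    and pa: "\<And>s x. s \<in> {0..1} \<Longrightarrow> x \<in> topspace T \<Longrightarrow> p (a (s, x)) = G (s, (0, x))"
    and pb: "\<And>s x. s \<in> {0..1} \<Longrightarrow> x \<in> topspace T \<Longrightarrow> p (b (s, x)) = G (s, (1, x))"
  obtains K where "continuous_map (cylinder (cylinder T)) E K"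
    "\<And>s t x. s \<in> {0..1} \<Longrightarrow> t \<in> {0..1} \<Longrightarrow> x \<in> topspace T \<Longrightarrow> p (K (s, (t, x))) = G (s, (t, x))"
    "\<And>t x. t \<in> {0..1} \<Longrightarrow> x \<in> topspace T \<Longrightarrow> K (0, (t, x)) = h (t, x)"
    "\<And>s x. s \<in> {0..1} \<Longrightarrow> x \<in> topspace T \<Longrightarrow> K (s, (0, x)) = a (s, x)"
    "\<And>s x. s \<in> {0..1} \<Longrightarrow> x \<in> topspace T \<Longrightarrow> K (s, (1, x)) = b (s, x)"
proof -
  let ?Q = "cylinder (cylinder T)"
  \<comment> \<open>\<open>l\<close> need not lie over \<open>G\<close>. It combines the three
    prescribed maps into a continuous one and is evaluated only on the three edges.\<close>
  obtain l where l: "continuous_map ?Q E l"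
    "\<And>t x. t \<in> {0..1} \<Longrightarrow> x \<in> topspace T \<Longrightarrow> l (0, (t, x)) = h (t, x)"
    "\<And>s x. s \<in> {0..1} \<Longrightarrow> x \<in> topspace T \<Longrightarrow> l (s, (0, x)) = a (s, x)"
    "\<And>s x. s \<in> {0..1} \<Longrightarrow> x \<in> topspace T \<Longrightarrow> l (s, (1, x)) = b (s, x)"
    using square_filling[OF h a b ha hb] by blast
  \<comment> \<open>\<open>m (s, t)\<close> is how far \<open>(s, t)\<close> has to be pushed away from the centre \<open>(2, 1/2)\<close> to
    reach the bottom or one of the sides.\<close>
  define m :: "real \<Rightarrow> real \<Rightarrow> real" where
    "m = (\<lambda>s t. min (s / (2 - s)) ((1/2) / max \<bar>t - 1/2\<bar> (1/4) - 1))"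
  \<comment> \<open>Position at time \<open>\<tau>\<close>: the point starts at its projection from
    \<open>(2, 1/2)\<close> to the three edges and is back at \<open>(s, t)\<close> from time
    \<open>m s t\<close> on.\<close>
  define \<sigma> where "\<sigma> = (\<lambda>\<tau> s t. s + (m s t - min \<tau> (m s t)) * (s - 2))"
  define \<theta> where "\<theta> = (\<lambda>\<tau> s t. t + (m s t - min \<tau> (m s t)) * (t - 1/2))"
  \<comment> \<open>The bound 1/4 avoids division by zero at \<open>t = 1/2\<close>. Where it takes
    effect, the second term of \<open>m\<close> equals 1, which is at least
    \<open>s / (2 - s)\<close>, so the minimum is still the time at which the bottom is
    reached.\<close>
  have max: "(1/4::real) \<le> max \<bar>t - 1/2\<bar> (1/4)" for t
    by simp
  have m01: "0 \<le> m s t" "m s t \<le> 1" if "s \<in> {0..1}" "t \<in> {0..1}" for s t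
  proof -
    have "0 \<le> s / (2 - s)" "s / (2 - s) \<le> 1"
      using that by auto
    moreover have "max \<bar>t - 1/2\<bar> (1/4) \<le> 1/2"
      using that by (auto simp: max_def abs_if)
    then have "0 \<le> (1/2) / max \<bar>t - 1/2\<bar> (1/4) - 1"
      using max[of t] by (simp add: le_divide_eq)
    ultimately show "0 \<le> m s t" "m s t \<le> 1"
      unfolding m_def min.bounded_iff min_le_iff_disj by blast+
  qed
  have \<sigma>01: "\<sigma> \<tau> s t \<in> {0..1}" and \<theta>01: "\<theta> \<tau> s t \<in> {0..1}"
    if st: "\<tau> \<in> {0..1}" "s \<in> {0..1}" "t \<in> {0..1}" for \<tau> s t
  proof -
    define d where "d = m s t - min \<tau> (m s t)"
    have d: "0 \<le> d" "d \<le> m s t"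
      using m01[OF st(2,3)] st by (auto simp: d_def)
    have "d \<le> s / (2 - s)" "d \<le> (1/2) / max \<bar>t - 1/2\<bar> (1/4) - 1"
      using d by (auto simp: m_def)
    then have "d * (2 - s) \<le> s" "(d + 1) * max \<bar>t - 1/2\<bar> (1/4) \<le> 1/2"
      using st max[of t] by (auto simp: le_divide_eq algebra_simps)
    moreover have "(d + 1) * \<bar>t - 1/2\<bar> \<le> (d + 1) * max \<bar>t - 1/2\<bar> (1/4)"
      using d by (intro mult_left_mono) auto
    moreover have "\<bar>(d + 1) * (t - 1/2)\<bar> = (d + 1) * \<bar>t - 1/2\<bar>"
      using d by (simp add: abs_mult)
    ultimately have *: "d * (2 - s) \<le> s" "\<bar>(d + 1) * (t - 1/2)\<bar> \<le> 1/2"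
      by linarith+
    have "0 \<le> d * (2 - s)"
      using d st by simp
    moreover have "\<sigma> \<tau> s t = s - d * (2 - s)" "\<theta> \<tau> s t = 1/2 + (d + 1) * (t - 1/2)"
      by (simp_all add: \<sigma>_def \<theta>_def d_def algebra_simps)
    ultimately show "\<sigma> \<tau> s t \<in> {0..1}" "\<theta> \<tau> s t \<in> {0..1}"
      using * st unfolding atLeastAtMost_iff abs_le_iff by linarith+
  qed
  have start: "\<sigma> 0 s t = 0 \<or> \<theta> 0 s t = 0 \<or> \<theta> 0 s t = 1" if st: "s \<in> {0..1}" "t \<in> {0..1}" for s t
  proof (cases "m s t = s / (2 - s)")
    case True
    then have "m s t * (2 - s) = s"
      using st by simp
    then have "\<sigma> 0 s t = 0"
      using m01[OF st] by (simp add: \<sigma>_def algebra_simps)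
    then show ?thesis ..
  next
    case False
    let ?x = "max \<bar>t - 1/2\<bar> (1/4)"
    define y where "y = (1/2) / ?x"
    have 1: "m s t = y - 1" "m s t < s / (2 - s)"
      using False by (auto simp: m_def min_def y_def)
    moreover have "s / (2 - s) \<le> 1"
      using st by simp
    ultimately have "y < 2"
      by linarith
    then have "?x \<noteq> 1/4"
      by (intro notI) (simp add: y_def)
    then have "?x = \<bar>t - 1/2\<bar>" "\<bar>t - 1/2\<bar> > 0"
      unfolding max_def by (auto split: if_splits)
    moreover have "m s t + 1 = (1/2) / ?x"
      using 1 by (simp add: y_def)
    ultimately have "(m s t + 1) * \<bar>t - 1/2\<bar> = 1/2"
      by simp
    then have "\<bar>(m s t + 1) * (t - 1/2)\<bar> = 1/2"
      using m01[OF st] by (simp add: abs_mult)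
    then have "(m s t + 1) * (t - 1/2) = 1/2 \<or> (m s t + 1) * (t - 1/2) = -(1/2)"
      unfolding abs_eq_iff' by blast
    moreover have "\<theta> 0 s t = 1/2 + (m s t + 1) * (t - 1/2)"
      using m01[OF st] by (simp add: \<theta>_def algebra_simps)
    ultimately show ?thesis
      by auto
  qed
  have end_: "\<sigma> (m s t) s t = s" "\<theta> (m s t) s t = t" for s t
    by (simp_all add: \<sigma>_def \<theta>_def)
  have m0: "m 0 t = 0" "m s 0 = 0" "m s 1 = 0" if "s \<in> {0..1}" "t \<in> {0..1}" for s t
    using that m01[of 0 t] m01[of s 0] m01[of s 1] by (auto simp: m_def)
  have cm: "continuous_map S euclideanreal (\<lambda>z. m (f z) (g z))"
    if fg: "continuous_map S I01 f" "continuous_map S I01 g" for f g and S :: "'z topology"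
    unfolding m_def
  proof (intro continuous_intros continuous_map_from_I01 fg)
    fix z assume "z \<in> topspace S"
    then have "f z \<in> {0..1}"
      using fg(1) by (auto simp: continuous_map_in_subtopology)
    then show "2 - f z \<noteq> 0"
      by simp
    show "max \<bar>g z - 1/2\<bar> (1/4) \<noteq> 0"
      using max[of "g z"] by simp
  qed auto
  have cr: "continuous_map S I01 (\<lambda>z. \<sigma> (e z) (f z) (g z))" "continuous_map S I01 (\<lambda>z. \<theta> (e z) (f z) (g z))"
    if fg: "continuous_map S I01 e" "continuous_map S I01 f" "continuous_map S I01 g"
    for e f g and S :: "'z topology"
  proof -
    have rng: "e z \<in> {0..1}" "f z \<in> {0..1}" "g z \<in> {0..1}" if "z \<in> topspace S" for z
      using fg that by (auto simp: continuous_map_in_subtopology)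
    show "continuous_map S I01 (\<lambda>z. \<sigma> (e z) (f z) (g z))"
    proof (rule continuous_map_into_I01)
      show "continuous_map S euclideanreal (\<lambda>z. \<sigma> (e z) (f z) (g z))"
        unfolding \<sigma>_def by (intro continuous_intros cm fg continuous_map_from_I01) auto
    qed (use \<sigma>01 rng in force)
    show "continuous_map S I01 (\<lambda>z. \<theta> (e z) (f z) (g z))"
    proof (rule continuous_map_into_I01)
      show "continuous_map S euclideanreal (\<lambda>z. \<theta> (e z) (f z) (g z))"
        unfolding \<theta>_def by (intro continuous_intros cm fg continuous_map_from_I01) auto
    qed (use \<theta>01 rng in force)
  qed
  define H where "H = (\<lambda>z. G (\<sigma> (fst z) (fst (snd z)) (fst (snd (snd z))),
      (\<theta> (fst z) (fst (snd z)) (fst (snd (snd z))), snd (snd (snd z)))))"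
  define f where "f = (\<lambda>z. l (\<sigma> 0 (fst z) (fst (snd z)), (\<theta> 0 (fst z) (fst (snd z)), snd (snd z))))"
  have c: "continuous_map (cylinder ?Q) I01 (\<lambda>z. fst (snd (snd z)))"
     "continuous_map (cylinder ?Q) T (\<lambda>z. snd (snd (snd z)))"
    using continuous_map_compose[OF continuous_map_snd[of I01 ?Q] continuous_map_fst_snd]
      continuous_map_compose[OF continuous_map_snd[of I01 ?Q] continuous_map_snd_snd] by (auto simp: o_def)
  have cH: "continuous_map (cylinder ?Q) B H"
    unfolding H_def by (intro continuous_map_square_compose[OF G] cr c cm_coords)
  have cf: "continuous_map ?Q E f"
    unfolding f_def by (intro continuous_map_square_compose[OF l(1)] cr cm_coords) auto
  have pf: "p (f z) = H (0, z)" if z: "z \<in> topspace ?Q" for z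
  proof -
    obtain s t x where [simp]: "z = (s, (t, x))" and st: "s \<in> {0..1}" "t \<in> {0..1}" "x \<in> topspace T"
      using z by auto
    show ?thesis
      using start[OF st(1,2)] \<sigma>01[of 0 s t] \<theta>01[of 0 s t] st by (auto simp: f_def H_def l ph pa pb)
  qed
  obtain L where L: "continuous_map (cylinder ?Q) E L"
    "\<And>z. z \<in> topspace ?Q \<Longrightarrow> L (0, z) = f z"
    "\<And>\<tau> z. \<tau> \<in> {0..1} \<Longrightarrow> z \<in> topspace ?Q \<Longrightarrow> p (L (\<tau>, z)) = H (\<tau>, z)"
    using homotopy_lifting_propertyE[OF lift cH cf pf] by blast
  show thesis
  proof
    \<comment> \<open>Reading the lifted segments at time \<open>m\<close> gives a lift of
      \<open>G\<close>. On the three edges \<open>m\<close> is 0, so the prescribed values survive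
      exactly.\<close>
    show "continuous_map ?Q E (\<lambda>z. L (m (fst z) (fst (snd z)), z))"
      using m01 by (intro continuous_map_pair_compose[OF L(1)] continuous_map_into_I01 cm cm_coords continuous_map_id[unfolded id_def]) auto
    show "p (L (m (fst (s, (t, x))) (fst (snd (s, (t, x)))), (s, (t, x)))) = G (s, (t, x))"
      if "s \<in> {0..1}" "t \<in> {0..1}" "x \<in> topspace T" for s t x
      using that m01[OF that(1,2)] by (simp add: L(3) H_def end_)
    show "L (m (fst (0, (t, x))) (fst (snd (0, (t, x)))), (0, (t, x))) = h (t, x)"
      if "t \<in> {0..1}" "x \<in> topspace T" for t x
      using that end_[of 0 t] by (simp add: L(2) f_def m0[of 0 t] l)
    show "L (m (fst (s, (0, x))) (fst (snd (s, (0, x)))), (s, (0, x))) = a (s, x)"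
      if "s \<in> {0..1}" "x \<in> topspace T" for s x
      using that end_[of s 0] by (simp add: L(2) f_def m0[of s 0] l)
    show "L (m (fst (s, (1, x))) (fst (snd (s, (1, x)))), (s, (1, x))) = b (s, x)"
      if "s \<in> {0..1}" "x \<in> topspace T" for s x
      using that end_[of s 1] by (simp add: L(2) f_def m0[of s 0] l)
  qed
qed

text \<open>In \<open>HLP_square\<close> the two sides can be prescribed as constant, so the
  deformation of the path upstairs keeps its ends fixed.\<close>

lemma HLP_rel_ends:
  assumes lift: "homotopy_lifting_property (cylinder (cylinder T)) E B p"
    and v: "continuous_map (cylinder T) E v"
    and hom: "homotopic_rel_ends T B (p \<circ> v) u"
  obtains v' where "homotopic_rel_ends T E v v'"
    "\<And>t x. t \<in> {0..1} \<Longrightarrow> x \<in> topspace T \<Longrightarrow> p (v' (t, x)) = u (t, x)"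
proof -
  obtain G where G: "continuous_map (cylinder (cylinder T)) B G"
     "\<And>t x. t\<in>{0..1} \<Longrightarrow> x \<in> topspace T \<Longrightarrow> G (0, (t, x)) = p (v (t, x)) \<and> G (1, (t, x)) = u (t, x)"
     "\<And>s x. s\<in>{0..1} \<Longrightarrow> x \<in> topspace T \<Longrightarrow> G (s, (0, x)) = p (v (0, x)) \<and> G (s, (1, x)) = p (v (1, x))"
    using hom unfolding homotopic_rel_ends_alt by auto
  have c: "continuous_map (cylinder T) E (\<lambda>z. v (0, snd z))"
    "continuous_map (cylinder T) E (\<lambda>z. v (1, snd z))"
    by (intro continuous_map_pair_compose[OF v] cm_coords; simp)+
  obtain K where K: "continuous_map (cylinder (cylinder T)) E K"
    "\<And>s t x. s \<in> {0..1} \<Longrightarrow> t \<in> {0..1} \<Longrightarrow> x \<in> topspace T \<Longrightarrow> p (K (s, (t, x))) = G (s, (t, x))"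
    "\<And>t x. t \<in> {0..1} \<Longrightarrow> x \<in> topspace T \<Longrightarrow> K (0, (t, x)) = v (t, x)"
    "\<And>s x. s \<in> {0..1} \<Longrightarrow> x \<in> topspace T \<Longrightarrow> K (s, (0, x)) = (\<lambda>z. v (0, snd z)) (s, x)"
    "\<And>s x. s \<in> {0..1} \<Longrightarrow> x \<in> topspace T \<Longrightarrow> K (s, (1, x)) = (\<lambda>z. v (1, snd z)) (s, x)"
    by (rule HLP_square[OF lift G(1) v c]) (use G in auto)
  show thesis
  proof
    show "homotopic_rel_ends T E v (\<lambda>z. K (1, z))"
      by (rule homotopic_rel_endsI[OF K(1)]) (use K in auto)
  qed (use K G in auto)
qed

section \<open>Inverse limits of towers of fibrations\<close>

abbreviation homotopic :: "'a topology \<Rightarrow> 'b topology \<Rightarrow> ('a \<Rightarrow> 'b) \<Rightarrow> ('a \<Rightarrow> 'b) \<Rightarrow> bool" where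
  "homotopic \<equiv> homotopic_with (\<lambda>_. True)"

lemma homotopic_comp_left:
  "homotopic X Y f g \<Longrightarrow> continuous_map Y Z h \<Longrightarrow> homotopic X Z (h \<circ> f) (h \<circ> g)"
  by (rule homotopic_with_compose_continuous_map_left) auto

lemma homotopic_comp_right:
  "homotopic Y Z f g \<Longrightarrow> continuous_map X Y h \<Longrightarrow> homotopic X Z (f \<circ> h) (g \<circ> h)"
  by (rule homotopic_with_compose_continuous_map_right) auto

lemma homotopic_comp_both:
  assumes "homotopic Y Z f g" "continuous_map X Y h" "continuous_map Z V k"
  shows "homotopic X V (k \<circ> f \<circ> h) (k \<circ> g \<circ> h)"
  by (rule homotopic_comp_right[OF homotopic_comp_left[OF assms(1,3)] assms(2)])

lemma homotopicI:
  assumes "continuous_map (cylinder X) Y H"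
    "\<And>x. x \<in> topspace X \<Longrightarrow> H (0, x) = f x" "\<And>x. x \<in> topspace X \<Longrightarrow> H (1, x) = g x"
  shows "homotopic X Y f g"
  using assms by (subst homotopic_with) auto

lemma homotopicE:
  assumes "homotopic X Y f g"
  obtains H where "continuous_map (cylinder X) Y H" "\<And>x. H (0, x) = f x" "\<And>x. H (1, x) = g x"
  using assms unfolding homotopic_with_def by auto

lemma homotopic_eq:
  assumes "continuous_map X Y f" "\<And>x. x \<in> topspace X \<Longrightarrow> f x = g x"
  shows "homotopic X Y f g"
  by (rule homotopic_with_equal) (use assms in auto)

lemma HLP_strictify:
  assumes lift: "homotopy_lifting_property X E B p" and f: "continuous_map X E f"
    and hom: "homotopic X B (p \<circ> f) g"
  obtains f' where "homotopic X E f f'" "\<And>x. x \<in> topspace X \<Longrightarrow> p (f' x) = g x"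
proof -
  obtain h where h: "continuous_map (cylinder X) B h" "\<And>x. h (0, x) = p (f x)" "\<And>x. h (1, x) = g x"
    using homotopicE[OF hom] by (metis comp_apply)
  have "p (f x) = h (0, x)" for x
    using h by simp
  then obtain H where H: "continuous_map (cylinder X) E H"
    "\<And>x. x \<in> topspace X \<Longrightarrow> H (0, x) = f x"
    "\<And>t x. t \<in> {0..1} \<Longrightarrow> x \<in> topspace X \<Longrightarrow> p (H (t, x)) = h (t, x)"
    using homotopy_lifting_propertyE[OF lift h(1) f] by blast
  show thesis
  proof
    show "homotopic X E f (\<lambda>x. H (1, x))"
      by (rule homotopicI[OF H(1)]) (simp_all add: H(2))
    show "p (H (1, x)) = g x" if "x \<in> topspace X" for x
      using H(3)[of 1 x] that h by simp
  qed
qed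

lemma topspace_inverse_limit:
  "topspace (inverse_limit X f) = {x. \<forall>i. x i \<in> topspace (X i) \<and> f i (x (Suc i)) = x i}"
  by (auto simp: inverse_limit_def PiE_def extensional_def)

lemma continuous_map_into_inverse_limit:
  assumes "\<And>i. continuous_map S (X i) (\<lambda>z. g z i)" "\<And>z i. z \<in> topspace S \<Longrightarrow> f i (g z (Suc i)) = g z i"
  shows "continuous_map S (inverse_limit X f) g"
  using assms by (auto simp: inverse_limit_def continuous_map_in_subtopology continuous_map_componentwise_UNIV)

lemma continuous_map_inverse_limit_coordinate:
  "continuous_map (inverse_limit X f) (X i) (\<lambda>x. x i)"
  unfolding inverse_limit_def
  by (intro continuous_map_from_subtopology continuous_map_product_projection) simp

lemma Hausdorff_space_inverse_limit:
  assumes "\<And>i. Hausdorff_space (X i)"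
  shows "Hausdorff_space (inverse_limit X f)"
  unfolding inverse_limit_def using assms
  by (intro Hausdorff_space_subtopology) (auto simp: Hausdorff_space_product_topology)

text \<open>The two maps of the limit into itself, the identity and the retraction onto \<open>Q\<close>, agree up to
  homotopy in every coordinate. Coherence of these homotopies is a Mittag-Leffler argument: each
  bonding map factors through the constant tower \<open>Q\<close>, so the images of the sets of homotopies
  stabilise after one step.\<close>

lemma inverse_limit_homotopy_equivalent:
  fixes Q :: "'q topology"
  assumes W: "inverse_sequence_of_fibrations W w"
    and a: "\<And>i. continuous_map (W i) Q (a i)" and s0: "\<And>i. continuous_map Q (W i) (s0 i)"
    and as0: "\<And>i. homotopic Q Q (a i \<circ> s0 i) id"
    and ws0: "\<And>i. homotopic (W (Suc i)) (W i) (w i) (s0 i \<circ> a (Suc i))"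
  shows "inverse_limit W w homotopy_equivalent_space Q"
proof -
  have w: "continuous_map (W (Suc i)) (W i) (w i)" for i
    using W by (simp add: inverse_sequence_of_fibrations_def inverse_sequence_def)
  have lift: "homotopy_lifting_property X (W (Suc i)) (W i) (w i)" for X :: "'x topology" and i
    using W by (intro Hurewicz_fibration_imp_HLP)
      (auto simp: inverse_sequence_of_fibrations_def inverse_sequence_def)
  \<comment> \<open>\<open>w i\<close> factors through \<open>a (Suc i)\<close>, which cancels
    \<open>s0 (Suc i)\<close>, so \<open>w i \<circ> s0 (Suc i)\<close> is homotopic to
    \<open>s0 i\<close> and to the section already chosen; lifting this homotopy makes the relation
    strict.\<close>
  have "\<exists>s. \<forall>i. homotopic Q (W i) (s0 i) (s i) \<and> (\<forall>x\<in>topspace Q. w i (s (Suc i) x) = s i x)"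
  proof (rule dependent_nat_choice)
    show "\<exists>x. homotopic Q (W 0) (s0 0) x"
      using s0 by (intro exI[of _ "s0 0"]) simp
    fix f i assume f: "homotopic Q (W i) (s0 i) f"
    have "homotopic Q (W i) (w i \<circ> s0 (Suc i)) (s0 i \<circ> a (Suc i) \<circ> s0 (Suc i))"
      by (rule homotopic_comp_right[OF ws0 s0])
    moreover have "homotopic Q (W i) (s0 i \<circ> a (Suc i) \<circ> s0 (Suc i)) (s0 i)"
      using homotopic_comp_left[OF as0[of "Suc i"] s0[of i]] by (simp add: o_assoc)
    ultimately have "homotopic Q (W i) (w i \<circ> s0 (Suc i)) f"
      using f homotopic_with_trans by blast
    then show "\<exists>y. homotopic Q (W (Suc i)) (s0 (Suc i)) y \<and> (\<forall>x\<in>topspace Q. w i (y x) = f x)"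
      using HLP_strictify[OF lift s0] by metis
  qed
  then obtain s where s0s: "\<And>i. homotopic Q (W i) (s0 i) (s i)"
    and wsS: "\<And>i x. x \<in> topspace Q \<Longrightarrow> w i (s (Suc i) x) = s i x"
    by blast
  have s: "continuous_map Q (W i) (s i)" for i
    using s0s homotopic_with_imp_continuous_maps by blast
  have as: "homotopic Q Q (a i \<circ> s i) id" for i
    using as0 homotopic_comp_left[OF s0s a] homotopic_with_trans homotopic_with_symD by metis
  have ws: "homotopic (W (Suc i)) (W i) (w i) (s i \<circ> a (Suc i))" for i
    using ws0 homotopic_comp_right[OF s0s a] homotopic_with_trans by metis
  have aw: "homotopic (W (Suc i)) Q (a i \<circ> w i) (a (Suc i))" for i
    using homotopic_comp_left[OF ws[of i] a[of i]] homotopic_comp_right[OF as[of i] a[of "Suc i"]] homotopic_with_trans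
    by (simp add: o_assoc) blast
  define T where "T = inverse_limit W w"
  have T: "x i \<in> topspace (W i)" "w i (x (Suc i)) = x i" if "x \<in> topspace T" for x i
    using that by (auto simp: T_def topspace_inverse_limit)
  have cT: "continuous_map T (W i) (\<lambda>x. x i)" for i
    unfolding T_def by (rule continuous_map_inverse_limit_coordinate)
  define r where "r = (\<lambda>x :: nat \<Rightarrow> 'a. a 0 (x 0))"
  have r: "continuous_map T Q r"
    using continuous_map_compose[OF cT a] by (simp add: r_def o_def)
  have rQ: "r x \<in> topspace Q" if "x \<in> topspace T" for x
    using continuous_map_image_subset_topspace[OF r] that by blast
  have cs: "continuous_map T (W i) (\<lambda>x. s i (r x))" for i
    using continuous_map_compose[OF r s] by (simp add: o_def)
  \<comment> \<open>The homotopies in coordinate \<open>i\<close> from the identity of the limit to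
    the map through \<open>Q\<close>. A compatible sequence of elements of these sets is the
    homotopy that is sought.\<close>
  define Hom where "Hom = (\<lambda>i v. continuous_map (cylinder T) (W i) v \<and>
      (\<forall>x \<in> topspace T. v (0, x) = x i \<and> v (1, x) = s i (r x)))"
  have cm: "continuous_map (cylinder T) Z (\<lambda>z. H (fst z, f (snd z)))"
    if "continuous_map (cylinder Y) Z H" "continuous_map T Y f"
    for H f and Y :: "'y topology" and Z :: "'z topology"
    using continuous_map_compose[OF continuous_map_snd that(2)]
    by (intro continuous_map_pair_compose[OF that(1)] cm_coords) (simp add: o_def)
  have cm2: "continuous_map (cylinder (cylinder T)) Z (\<lambda>z. H (fst z, f (snd z)))"
    if "continuous_map (cylinder Y) Z H" "continuous_map (cylinder T) Y f"
    for H f and Y :: "'y topology" and Z :: "'z topology"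
    using continuous_map_compose[OF continuous_map_snd that(2)]
    by (intro continuous_map_pair_compose[OF that(1)] cm_coords) (simp add: o_def)
  have cms: "continuous_map (cylinder T) Z (\<lambda>z. G (c, z))"
    if "continuous_map (cylinder (cylinder T)) Z G" "c \<in> {0..1}" for G c and Z :: "'z topology"
    using that(2) by (intro continuous_map_pair_compose[OF that(1)] continuous_map_id[unfolded id_def]) auto
  \<comment> \<open>Every path in \<open>Q\<close> with the right ends comes from
    \<open>Hom i\<close>: transport \<open>u\<close> along \<open>a i \<circ> B\<close> and then
    \<open>D\<close> to a path \<open>u'\<close> between values of \<open>a (Suc i)\<close>, map it
    by \<open>s i\<close>, and transport the result back along \<open>B\<close>, now in
    \<open>W i\<close>.\<close>
  have surj: "\<exists>v. Hom i v \<and> homotopic_rel_ends T Q (a i \<circ> v) u"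
    if u: "continuous_map (cylinder T) Q u"
      "\<And>x. x \<in> topspace T \<Longrightarrow> u (0, x) = a i (x i)" "\<And>x. x \<in> topspace T \<Longrightarrow> u (1, x) = a i (s i (r x))"
    for i u
  proof -
    obtain B where B: "continuous_map (cylinder (W (Suc i))) (W i) B"
      "\<And>x. B (0, x) = w i x" "\<And>x. B (1, x) = s i (a (Suc i) x)"
      using homotopicE[OF ws[of i]] by (metis comp_apply)
    obtain D where D: "continuous_map (cylinder Q) Q D"
      "\<And>x. D (0, x) = a i (s i x)" "\<And>x. D (1, x) = x"
      using homotopicE[OF as[of i]] by (metis comp_apply id_apply)
    have aB: "continuous_map (cylinder (W (Suc i))) Q (\<lambda>z. a i (B z))"
      using continuous_map_compose[OF B(1) a] by (simp add: o_def)
    obtain G1 where G1: "continuous_map (cylinder (cylinder T)) Q G1"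
      "\<And>t x. t \<in> {0..1} \<Longrightarrow> x \<in> topspace T \<Longrightarrow> G1 (0, (t, x)) = u (t, x)"
      "\<And>t x. t \<in> {0..1} \<Longrightarrow> x \<in> topspace T \<Longrightarrow> G1 (t, (0, x)) = a i (B (t, x (Suc i)))"
      "\<And>t x. t \<in> {0..1} \<Longrightarrow> x \<in> topspace T \<Longrightarrow> G1 (t, (1, x)) = a i (B (t, s (Suc i) (r x)))"
      using square_filling[OF u(1) cm[OF aB cT[of "Suc i"]] cm[OF aB cs[of "Suc i"]]]
      by (simp add: B u T wsS rQ) blast
    have aa: "continuous_map T Q (\<lambda>x. a (Suc i) (x (Suc i)))" "continuous_map T Q (\<lambda>x. a (Suc i) (s (Suc i) (r x)))"
      using continuous_map_compose[OF cT a] continuous_map_compose[OF cs a] by (simp_all add: o_def)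
    obtain G2 where G2: "continuous_map (cylinder (cylinder T)) Q G2"
      "\<And>t x. t \<in> {0..1} \<Longrightarrow> x \<in> topspace T \<Longrightarrow> G2 (0, (t, x)) = G1 (1, (t, x))"
      "\<And>t x. t \<in> {0..1} \<Longrightarrow> x \<in> topspace T \<Longrightarrow> G2 (t, (0, x)) = D (t, a (Suc i) (x (Suc i)))"
      "\<And>t x. t \<in> {0..1} \<Longrightarrow> x \<in> topspace T \<Longrightarrow> G2 (t, (1, x)) = D (t, a (Suc i) (s (Suc i) (r x)))"
      using square_filling[OF cms[OF G1(1)] cm[OF D(1) aa(1)] cm[OF D(1) aa(2)], of 1]
      by (simp add: B D G1) blast
    define u' where "u' = (\<lambda>z. G2 (1, z))"
    have u': "continuous_map (cylinder T) Q u'"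
      unfolding u'_def using G2(1) by (intro cms) auto
    have u'ends: "u' (0, x) = a (Suc i) (x (Suc i))" "u' (1, x) = a (Suc i) (s (Suc i) (r x))"
      if "x \<in> topspace T" for x
      using that by (simp_all add: u'_def G2 D)
    have su': "continuous_map (cylinder T) (W i) (\<lambda>z. s i (u' z))"
      using continuous_map_compose[OF u' s] by (simp add: o_def)
    note Bx = continuous_map_reverse[OF cm[OF B(1) cT[of "Suc i"]]] and By = continuous_map_reverse[OF cm[OF B(1) cs[of "Suc i"]]]
    obtain G3 where G3: "continuous_map (cylinder (cylinder T)) (W i) G3"
      "\<And>t x. t \<in> {0..1} \<Longrightarrow> x \<in> topspace T \<Longrightarrow> G3 (0, (t, x)) = s i (u' (t, x))"
      "\<And>t x. t \<in> {0..1} \<Longrightarrow> x \<in> topspace T \<Longrightarrow> G3 (t, (0, x)) = B (1 - t, x (Suc i))"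
      "\<And>t x. t \<in> {0..1} \<Longrightarrow> x \<in> topspace T \<Longrightarrow> G3 (t, (1, x)) = B (1 - t, s (Suc i) (r x))"
      using square_filling[OF su' Bx By] by (simp add: B u'ends) blast
    define v where "v = (\<lambda>z. G3 (1, z))"
    have v: "Hom i v"
      unfolding Hom_def v_def using G3(1) by (auto intro: cms simp: G3 B T wsS rQ)
    have aG3: "continuous_map (cylinder (cylinder T)) Q (\<lambda>z. a i (G3 (1 - fst z, snd z)))"
      using continuous_map_compose[OF continuous_map_reverse[OF G3(1)] a] by (simp add: o_def)
    \<comment> \<open>Both squares have their sides along \<open>D\<close> and \<open>u'\<close> as
      top, so their bottoms are homotopic. Comparing squares with sides along
      \<open>a i \<circ> B\<close> then leads back to \<open>u\<close>.\<close>
    have "homotopic_rel_ends T Q (\<lambda>z. D (0, u' z)) (\<lambda>z. G2 (0, z))"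
    proof -
      have "homotopic_rel_ends T Q (\<lambda>z. (\<lambda>z. D (fst z, u' (snd z))) (0, z)) (\<lambda>z. G2 (0, z))"
      proof (rule square_bottom_unique[OF cm2[OF D(1) u'] G2(1)])
        show "homotopic_rel_ends T Q (\<lambda>z. D (fst (1, z), u' (snd (1, z)))) (\<lambda>z. G2 (1, z))"
          using u' by (intro homotopic_rel_ends_eq) (simp_all add: D u'_def)
      qed (simp_all add: u'ends G2)
      then show ?thesis
        by simp
    qed
    moreover have "homotopic_rel_ends T Q (\<lambda>z. G2 (0, z)) (\<lambda>z. G1 (1, z))"
      using cms[OF G2(1)] by (intro homotopic_rel_ends_eq) (simp_all add: G2)
    moreover have "homotopic_rel_ends T Q (\<lambda>z. a i (G3 (0, z))) (\<lambda>z. D (0, u' z))"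
      using continuous_map_compose[OF cms[OF G3(1)] a] by (intro homotopic_rel_ends_eq) (simp_all add: D G3 o_def)
    ultimately have top: "homotopic_rel_ends T Q (\<lambda>z. a i (G3 (0, z))) (\<lambda>z. G1 (1, z))"
      using homotopic_rel_ends_trans by blast
    have "homotopic_rel_ends T Q (\<lambda>z. (\<lambda>z. a i (G3 (1 - fst z, snd z))) (0, z)) (\<lambda>z. G1 (0, z))"
      by (rule square_bottom_unique[OF aG3 G1(1)]) (use top in \<open>simp_all add: G1 G3\<close>)
    then have "homotopic_rel_ends T Q (a i \<circ> v) (\<lambda>z. G1 (0, z))"
      by (simp add: v_def o_def)
    moreover have "homotopic_rel_ends T Q (\<lambda>z. G1 (0, z)) u"
      using cms[OF G1(1)] by (intro homotopic_rel_ends_eq) (simp_all add: G1)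
    ultimately show ?thesis
      using v homotopic_rel_ends_trans by blast
  qed
  \<comment> \<open>Up to the homotopy \<open>B\<close>, \<open>w i\<close> factors through
    \<open>a (Suc i)\<close>; so the image of a path under \<open>w i\<close> depends only on its
    image in \<open>Q\<close>.\<close>
  have inj: "homotopic_rel_ends T (W i) (w i \<circ> g) (w i \<circ> g')"
    if g: "Hom (Suc i) g" "Hom (Suc i) g'" and "homotopic_rel_ends T Q (a (Suc i) \<circ> g) (a (Suc i) \<circ> g')" for i g g'
  proof -
    obtain B where B: "continuous_map (cylinder (W (Suc i))) (W i) B"
      "\<And>x. B (0, x) = w i x" "\<And>x. B (1, x) = s i (a (Suc i) x)"
      using homotopicE[OF ws[of i]] by (metis comp_apply)
    have "homotopic_rel_ends T (W i) (\<lambda>z. (\<lambda>z. B (fst z, g (snd z))) (0, z)) (\<lambda>z. (\<lambda>z. B (fst z, g' (snd z))) (0, z))"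
    proof (rule square_bottom_unique)
      show "continuous_map (cylinder (cylinder T)) (W i) (\<lambda>z. B (fst z, g (snd z)))"
        "continuous_map (cylinder (cylinder T)) (W i) (\<lambda>z. B (fst z, g' (snd z)))"
        using g by (auto intro: cm2[OF B(1)] simp: Hom_def)
      show "homotopic_rel_ends T (W i) (\<lambda>z. B (fst (1, z), g (snd (1, z)))) (\<lambda>z. B (fst (1, z), g' (snd (1, z))))"
        using homotopic_rel_ends_compose[OF that(3) s] by (simp add: B o_def)
    qed (use g in \<open>simp_all add: Hom_def\<close>)
    then show ?thesis
      by (simp add: B o_def)
  qed
  have wHom: "Hom i (w i \<circ> v)" if "Hom (Suc i) v" for i v
    using that by (auto simp: Hom_def T wsS rQ intro: continuous_map_compose[OF _ w])
  \<comment> \<open>The Mittag-Leffler condition: what comes to \<open>Hom i\<close> from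
    \<open>Hom (Suc i)\<close> also comes from \<open>Hom (Suc (Suc i))\<close>, up to homotopy. The
    path \<open>a (Suc i) \<circ> v\<close> is transported along \<open>A\<close> and realised two
    levels up by \<open>surj\<close>; \<open>inj\<close> compares the images.\<close>
  have step: "\<exists>v'. Hom (Suc (Suc i)) v' \<and> homotopic_rel_ends T (W i) (w i \<circ> (w (Suc i) \<circ> v')) (w i \<circ> v)"
    if v: "Hom (Suc i) v" for i v
  proof -
    obtain A where A: "continuous_map (cylinder (W (Suc (Suc i)))) Q A"
      "\<And>x. A (0, x) = a (Suc i) (w (Suc i) x)" "\<And>x. A (1, x) = a (Suc (Suc i)) x"
      using homotopicE[OF aw[of "Suc i"]] by (metis comp_apply)
    have av: "continuous_map (cylinder T) Q (\<lambda>z. a (Suc i) (v z))"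
      using v continuous_map_compose[OF _ a] by (auto simp: Hom_def o_def)
    obtain G where G: "continuous_map (cylinder (cylinder T)) Q G"
      "\<And>t x. t \<in> {0..1} \<Longrightarrow> x \<in> topspace T \<Longrightarrow> G (0, (t, x)) = a (Suc i) (v (t, x))"
      "\<And>t x. t \<in> {0..1} \<Longrightarrow> x \<in> topspace T \<Longrightarrow> G (t, (0, x)) = A (t, x (Suc (Suc i)))"
      "\<And>t x. t \<in> {0..1} \<Longrightarrow> x \<in> topspace T \<Longrightarrow> G (t, (1, x)) = A (t, s (Suc (Suc i)) (r x))"
      using square_filling[OF av cm[OF A(1) cT[of "Suc (Suc i)"]] cm[OF A(1) cs[of "Suc (Suc i)"]]] v
      by (simp add: A T wsS rQ Hom_def) blast
    obtain v' where v': "Hom (Suc (Suc i)) v'"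
      and top: "homotopic_rel_ends T Q (a (Suc (Suc i)) \<circ> v') (\<lambda>z. G (1, z))"
      using surj[OF cms[OF G(1)], of 1 "Suc (Suc i)"] by (auto simp: G A)
    have "homotopic_rel_ends T Q (\<lambda>z. (\<lambda>z. A (fst z, v' (snd z))) (0, z)) (\<lambda>z. G (0, z))"
    proof (rule square_bottom_unique[OF _ G(1)])
      show "continuous_map (cylinder (cylinder T)) Q (\<lambda>z. A (fst z, v' (snd z)))"
        using v' by (auto intro: cm2[OF A(1)] simp: Hom_def)
    qed (use v' top in \<open>simp_all add: G A Hom_def o_def\<close>)
    moreover have "homotopic_rel_ends T Q (\<lambda>z. G (0, z)) (a (Suc i) \<circ> v)"
      using cms[OF G(1)] by (intro homotopic_rel_ends_eq) (simp_all add: G)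
    ultimately have "homotopic_rel_ends T Q (a (Suc i) \<circ> (w (Suc i) \<circ> v')) (a (Suc i) \<circ> v)"
      using homotopic_rel_ends_trans by (fastforce simp: A o_def)
    then show ?thesis
      using inj[OF wHom[OF v'] v] v' by blast
  qed
  \<comment> \<open>The invariant says that \<open>h i\<close> lifts one step up to homotopy. By
    \<open>step\<close> this lift can be replaced by one that comes from the next level, and
    \<open>HLP_rel_ends\<close> moves it strictly over \<open>h i\<close> without losing that
    property.\<close>
  have "\<exists>h. \<forall>i. (Hom i (h i) \<and> (\<exists>v. Hom (Suc i) v \<and> homotopic_rel_ends T (W i) (w i \<circ> v) (h i))) \<and>
     (\<forall>t\<in>{0..1}. \<forall>x\<in>topspace T. w i (h (Suc i) (t, x)) = h i (t, x))"
  proof (rule dependent_nat_choice)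
    \<comment> \<open>The construction starts in coordinate 1, so that \<open>w 0 \<circ> v\<close>
      satisfies the invariant at once.\<close>
    have "homotopic T Q (\<lambda>x. a (Suc 0) (x (Suc 0))) (\<lambda>x. a 0 (w 0 (x (Suc 0))))"
      using homotopic_with_symD[OF homotopic_comp_right[OF aw cT]] by (simp add: o_def)
    moreover have "homotopic T Q (\<lambda>x. a 0 (w 0 (x (Suc 0)))) r"
      using continuous_map_compose[OF cT continuous_map_compose[OF w a]]
      by (intro homotopic_eq) (simp_all add: o_def r_def T)
    moreover have "homotopic T Q r (\<lambda>x. a (Suc 0) (s (Suc 0) (r x)))"
      using homotopic_with_symD[OF homotopic_comp_right[OF as r]] by (simp add: o_def)
    ultimately have "homotopic T Q (\<lambda>x. a (Suc 0) (x (Suc 0))) (\<lambda>x. a (Suc 0) (s (Suc 0) (r x)))"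
      using homotopic_with_trans by meson
    then obtain u where "continuous_map (cylinder T) Q u"
      "\<And>x. u (0, x) = a (Suc 0) (x (Suc 0))" "\<And>x. u (1, x) = a (Suc 0) (s (Suc 0) (r x))"
      using homotopicE by blast
    then obtain v where v: "Hom (Suc 0) v"
      using surj by blast
    have "homotopic_rel_ends T (W 0) (w 0 \<circ> v) (w 0 \<circ> v)"
      using wHom[OF v] by (intro homotopic_rel_ends_eq) (auto simp: Hom_def)
    then show "\<exists>h. Hom 0 h \<and> (\<exists>v. Hom (Suc 0) v \<and> homotopic_rel_ends T (W 0) (w 0 \<circ> v) h)"
      using v wHom by blast
  next
    fix h i assume "Hom i h \<and> (\<exists>v. Hom (Suc i) v \<and> homotopic_rel_ends T (W i) (w i \<circ> v) h)"
    then obtain v where v: "Hom i h" "Hom (Suc i) v" "homotopic_rel_ends T (W i) (w i \<circ> v) h"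
      by blast
    obtain v' where v': "Hom (Suc (Suc i)) v'" "homotopic_rel_ends T (W i) (w i \<circ> (w (Suc i) \<circ> v')) (w i \<circ> v)"
      using step[OF v(2)] by blast
    have c: "continuous_map (cylinder T) (W (Suc i)) (w (Suc i) \<circ> v')"
      using wHom[OF v'(1)] by (simp add: Hom_def)
    obtain h' where h': "homotopic_rel_ends T (W (Suc i)) (w (Suc i) \<circ> v') h'"
      "\<And>t x. t \<in> {0..1} \<Longrightarrow> x \<in> topspace T \<Longrightarrow> w i (h' (t, x)) = h (t, x)"
      using HLP_rel_ends[OF lift c homotopic_rel_ends_trans[OF v'(2) v(3)]] by blast
    have "Hom (Suc i) h'"
      using wHom[OF v'(1)] homotopic_rel_ends_continuous[OF h'(1)] homotopic_rel_ends_endpoints[OF h'(1)]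
      by (simp add: Hom_def)
    then show "\<exists>y. (Hom (Suc i) y \<and> (\<exists>v. Hom (Suc (Suc i)) v \<and> homotopic_rel_ends T (W (Suc i)) (w (Suc i) \<circ> v) y)) \<and>
         (\<forall>t\<in>{0..1}. \<forall>x\<in>topspace T. w i (y (t, x)) = h (t, x))"
      using h' v'(1) by blast
  qed
  then obtain h where h: "\<And>i. Hom i (h i)"
    "\<And>i t x. t \<in> {0..1} \<Longrightarrow> x \<in> topspace T \<Longrightarrow> w i (h (Suc i) (t, x)) = h i (t, x)"
    by blast
  have S: "continuous_map Q T (\<lambda>q i. s i q)"
    unfolding T_def by (rule continuous_map_into_inverse_limit) (use s wsS in auto)
  have "homotopic T T id ((\<lambda>q i. s i q) \<circ> r)"
  proof (rule homotopicI)
    show "continuous_map (cylinder T) T (\<lambda>z i. h i z)"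
      unfolding T_def by (rule continuous_map_into_inverse_limit)
        (use h in \<open>auto simp: Hom_def T_def\<close>)
  qed (use h in \<open>auto simp: Hom_def\<close>)
  moreover have "homotopic Q Q (r \<circ> (\<lambda>q i. s i q)) id"
    using as[of 0] by (simp add: r_def o_def)
  ultimately show ?thesis
    using r S homotopic_with_symD unfolding homotopy_equivalent_space_def T_def by blast
qed

lemma split_tower_limit:
  assumes W: "inverse_sequence_of_fibrations W w" and P: "inverse_sequence P p" and Q: "inverse_sequence Q q"
    and split: "splits_as_product W w P p Q q"
    and null: "\<And>i. nullhomotopic_map (P (Suc i)) (P i) (p i)"
    and heq: "\<And>i. homotopy_equivalence_map (Q (Suc i)) (Q i) (q i)"
  shows "inverse_limit W w homotopy_equivalent_space Q 0"
proof -
  obtain f where f: "\<And>i. homotopy_equivalence_map (prod_topology (P i) (Q i)) (W i) (f i)"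
    and wf: "\<And>i. homotopic (prod_topology (P (Suc i)) (Q (Suc i))) (W i) (w i \<circ> f (Suc i)) (f i \<circ> map_prod (p i) (q i))"
    using split unfolding splits_as_product_def by blast
  obtain g where cf: "\<And>i. continuous_map (prod_topology (P i) (Q i)) (W i) (f i)"
    and g: "\<And>i. continuous_map (W i) (prod_topology (P i) (Q i)) (g i)"
    and gf: "\<And>i. homotopic (prod_topology (P i) (Q i)) (prod_topology (P i) (Q i)) (g i \<circ> f i) id"
    and fg: "\<And>i. homotopic (W i) (W i) (f i \<circ> g i) id"
    using f unfolding homotopy_equivalence_map_def by metis
  \<comment> \<open>The constants are points of \<open>P i\<close>, so pairing with
    \<open>c i\<close> embeds \<open>Q i\<close> in the product; this defines the sections
    \<open>s i\<close>.\<close>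
  obtain c where c: "\<And>i. c i \<in> topspace (P i)" and pc: "\<And>i. homotopic (P (Suc i)) (P i) (p i) (\<lambda>_. c i)"
    using null unfolding nullhomotopic_map_def by metis
  have q: "continuous_map (Q (Suc i)) (Q i) (q i)" for i
    using Q by (simp add: inverse_sequence_def)
  have w: "continuous_map (W (Suc i)) (W i) (w i)" for i
    using W by (simp add: inverse_sequence_of_fibrations_def inverse_sequence_def)
  define \<theta> where "\<theta> = rec_nat id (\<lambda>i u. u \<circ> q i)"
  have \<theta>_simps: "\<theta> 0 = id" "\<theta> (Suc i) = \<theta> i \<circ> q i" for i
    by (simp_all add: \<theta>_def)
  have "\<exists>\<psi>. continuous_map (Q i) (Q 0) (\<theta> i) \<and> continuous_map (Q 0) (Q i) \<psi> \<and>
      homotopic (Q i) (Q i) (\<psi> \<circ> \<theta> i) id \<and> homotopic (Q 0) (Q 0) (\<theta> i \<circ> \<psi>) id" for i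
  proof (induction i)
    case 0
    show ?case
      by (rule exI[of _ id]) (simp add: \<theta>_simps)
  next
    case (Suc i)
    then obtain \<psi> where \<psi>: "continuous_map (Q i) (Q 0) (\<theta> i)" "continuous_map (Q 0) (Q i) \<psi>"
      "homotopic (Q i) (Q i) (\<psi> \<circ> \<theta> i) id" "homotopic (Q 0) (Q 0) (\<theta> i \<circ> \<psi>) id"
      by blast
    obtain q' where q': "continuous_map (Q i) (Q (Suc i)) q'"
      "homotopic (Q (Suc i)) (Q (Suc i)) (q' \<circ> q i) id" "homotopic (Q i) (Q i) (q i \<circ> q') id"
      using heq unfolding homotopy_equivalence_map_def by blast
    have "homotopic (Q (Suc i)) (Q (Suc i)) (q' \<circ> (\<psi> \<circ> \<theta> i) \<circ> q i) (q' \<circ> id \<circ> q i)"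
      by (intro homotopic_comp_both[OF \<psi>(3)] \<psi> q q')
    then have 1: "homotopic (Q (Suc i)) (Q (Suc i)) ((q' \<circ> \<psi>) \<circ> \<theta> (Suc i)) id"
      using q'(2) homotopic_with_trans by (fastforce simp: \<theta>_simps o_assoc)
    have "homotopic (Q 0) (Q 0) (\<theta> i \<circ> (q i \<circ> q') \<circ> \<psi>) (\<theta> i \<circ> id \<circ> \<psi>)"
      by (intro homotopic_comp_both[OF q'(3)] \<psi> q q')
    then have 2: "homotopic (Q 0) (Q 0) (\<theta> (Suc i) \<circ> (q' \<circ> \<psi>)) id"
      using \<psi>(4) homotopic_with_trans by (fastforce simp: \<theta>_simps o_assoc)
    have 3: "continuous_map (Q (Suc i)) (Q 0) (\<theta> (Suc i))"
      unfolding \<theta>_simps by (rule continuous_map_compose[OF q \<psi>(1)])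
    show ?case
      using 1 2 3 continuous_map_compose[OF \<psi>(2) q'(1)] by blast
  qed
  then obtain \<psi> where \<theta>: "\<And>i. continuous_map (Q i) (Q 0) (\<theta> i)" and \<psi>: "\<And>i. continuous_map (Q 0) (Q i) (\<psi> i)"
    and \<psi>\<theta>: "\<And>i. homotopic (Q i) (Q i) (\<psi> i \<circ> \<theta> i) id" and \<theta>\<psi>: "\<And>i. homotopic (Q 0) (Q 0) (\<theta> i \<circ> \<psi> i) id"
    by metis
  define a where "a = (\<lambda>i. snd \<circ> g i)"
  have a: "continuous_map (W i) (Q i) (a i)" for i
    unfolding a_def by (rule continuous_map_compose[OF g continuous_map_snd])
  define s where "s = (\<lambda>i x. f i (c i, x))"
  have inc: "continuous_map (Q i) (prod_topology (P i) (Q i)) (Pair (c i))" for i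
    using c by (simp add: continuous_map_pairwise o_def)
  have s: "continuous_map (Q i) (W i) (s i)" for i
    using continuous_map_compose[OF inc cf] by (simp add: s_def o_def)
  have as: "homotopic (Q i) (Q i) (a i \<circ> s i) id" for i
    using homotopic_comp_left[OF homotopic_comp_right[OF gf inc] continuous_map_snd, of i]
    by (simp add: a_def s_def o_def id_def)
  \<comment> \<open>The bonding map is read as
    \<open>f i \<circ> map_prod (p i) (q i) \<circ> g (Suc i)\<close>, and replacing
    \<open>p i\<close> by a constant leaves only the \<open>Q\<close> coordinate.\<close>
  have ws: "homotopic (W (Suc i)) (W i) (w i) (s i \<circ> q i \<circ> a (Suc i))" for i
  proof -
    have "homotopic (W (Suc i)) (W i) (w i \<circ> id) (w i \<circ> (f (Suc i) \<circ> g (Suc i)))"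
      by (intro homotopic_comp_left[OF _ w] homotopic_with_symD[OF fg])
    moreover have "homotopic (W (Suc i)) (W i) (w i \<circ> f (Suc i) \<circ> g (Suc i)) (f i \<circ> map_prod (p i) (q i) \<circ> g (Suc i))"
      by (rule homotopic_comp_right[OF wf g])
    moreover have "homotopic (prod_topology (P (Suc i)) (Q (Suc i))) (prod_topology (P i) (Q i))
        (map_prod (p i) (q i)) (\<lambda>z. (c i, q i (snd z)))"
    proof -
      have "homotopic (prod_topology (P (Suc i)) (Q (Suc i))) (prod_topology (P i) (Q i))
          (\<lambda>z. (p i (fst z), q i (snd z))) (\<lambda>z. (c i, q i (snd z)))"
        using homotopic_with_prod_topology[OF pc[of i], of "\<lambda>_. True" "Q (Suc i)" "Q i" "q i" "q i" "\<lambda>_. True"] q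
        by (simp add: case_prod_unfold)
      then show ?thesis
        by (simp add: map_prod_def case_prod_unfold)
    qed
    then have "homotopic (W (Suc i)) (W i) (f i \<circ> map_prod (p i) (q i) \<circ> g (Suc i)) (s i \<circ> q i \<circ> a (Suc i))"
      using homotopic_comp_right[OF homotopic_comp_left[OF _ cf] g] by (fastforce simp: s_def a_def o_def)
    ultimately show ?thesis
      by (metis comp_id o_assoc homotopic_with_trans)
  qed
  show ?thesis
  proof (rule inverse_limit_homotopy_equivalent[OF W])
    fix i
    show "continuous_map (W i) (Q 0) (\<theta> i \<circ> a i)" "continuous_map (Q 0) (W i) (s i \<circ> \<psi> i)"
      by (rule continuous_map_compose[OF a \<theta>] continuous_map_compose[OF \<psi> s])+
    have "homotopic (Q 0) (Q 0) (\<theta> i \<circ> (a i \<circ> s i) \<circ> \<psi> i) (\<theta> i \<circ> id \<circ> \<psi> i)"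
      by (intro homotopic_comp_both[OF as] \<theta> \<psi>)
    then show "homotopic (Q 0) (Q 0) (\<theta> i \<circ> a i \<circ> (s i \<circ> \<psi> i)) id"
      using \<theta>\<psi> homotopic_with_trans by (fastforce simp: o_assoc)
    have "homotopic (W (Suc i)) (W i) (s i \<circ> (\<psi> i \<circ> \<theta> i) \<circ> (q i \<circ> a (Suc i))) (s i \<circ> id \<circ> (q i \<circ> a (Suc i)))"
      by (intro homotopic_comp_both[OF \<psi>\<theta>] continuous_map_compose[OF a q] s)
    then show "homotopic (W (Suc i)) (W i) (w i) (s i \<circ> \<psi> i \<circ> (\<theta> (Suc i) \<circ> a (Suc i)))"
      using ws[of i] homotopic_with_trans homotopic_with_symD by (fastforce simp: o_assoc \<theta>_simps)
  qed
qed

section \<open>Exponential law and tube lemma for the interval\<close>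

lemma continuous_map_uncurry:
  assumes "continuous_map X (compact_open_topology I01 Y) g"
  shows "continuous_map (cylinder X) Y (\<lambda>z. g (snd z) (fst z))"
  using continuous_map_pair_compose[OF continuous_map_eval_interval cm_coords(1) continuous_map_compose[OF cm_coords(2) assms]]
  by (simp add: o_def)

text \<open>Compactness of the interval makes this set the preimage, under the curried map, of a
  subbasic open set of the path space.\<close>

lemma openin_tube:
  assumes "continuous_map (cylinder X) Y g" "openin Y U"
  shows "openin X {x \<in> topspace X. \<forall>t\<in>{0..1}. g (t, x) \<in> U}"
proof -
  have c: "continuous_map X (compact_open_topology I01 Y) (\<lambda>x. restrict (\<lambda>t. g (t, x)) (topspace I01))"
    by (rule continuous_map_curry[OF assms(1)])
  have "compactin I01 {0..1}"
    by (simp add: compactin_subtopology)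
  from openin_continuous_map_preimage[OF c openin_compact_open_subbasic[OF this assms(2)]]
  show ?thesis
    by (rule back_subst[of "openin X"])
      (use c in \<open>auto simp: continuous_map_def Pi_iff image_subset_iff\<close>)
qed

section \<open>Local contractibility of CW complexes\<close>

definition cnorm :: "nat \<Rightarrow> (nat \<Rightarrow> real) \<Rightarrow> real" where
  "cnorm n v = sqrt (\<Sum>i<n. (v i)\<^sup>2)"

lemma cell_disc_eq: "cell_disc n = {v. (\<forall>i\<ge>n. v i = 0) \<and> cnorm n v \<le> 1}"
  and cell_interior_eq: "cell_interior n = {v. (\<forall>i\<ge>n. v i = 0) \<and> cnorm n v < 1}"
  and cell_boundary_eq: "cell_boundary n = {v. (\<forall>i\<ge>n. v i = 0) \<and> cnorm n v = 1}"
  by (auto simp: cell_disc_def cell_interior_def cell_boundary_def topspace_Euclidean_space cnorm_def)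

lemma cell_disc_split: "cell_disc n = cell_interior n \<union> cell_boundary n"
  by (auto simp: cell_disc_eq cell_interior_eq cell_boundary_eq)

lemma continuous_on_cnorm [continuous_intros]:
  assumes "continuous_on S f"
  shows "continuous_on S (\<lambda>z. cnorm n (f z))"
proof -
  have "continuous_on S (\<lambda>z. f z i)" for i
    using assms by (rule continuous_on_product_then_coordinatewise)
  then show ?thesis
    unfolding cnorm_def by (intro continuous_on_real_sqrt continuous_on_sum continuous_on_power)
qed

lemma cnorm_nonneg: "0 \<le> cnorm n v"
  by (simp add: cnorm_def sum_nonneg)

lemma cnorm_scale: "cnorm n (\<lambda>i. c * v i) = \<bar>c\<bar> * cnorm n v"
  by (simp add: cnorm_def power_mult_distrib real_sqrt_mult flip: sum_distrib_left)

lemma cnorm_eq_0: "v \<in> cell_disc n \<Longrightarrow> cnorm n v = 0 \<longleftrightarrow> v = (\<lambda>_. 0)"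
  by (auto simp: cnorm_def cell_disc_eq sum_nonneg_eq_0_iff fun_eq_iff) (meson lessThan_iff not_less)

lemma subtopology_Euclidean_space:
  "S \<subseteq> topspace (Euclidean_space n) \<Longrightarrow> subtopology (Euclidean_space n) S = top_of_set S"
  by (simp add: Euclidean_space_def subtopology_subtopology euclidean_product_topology Int_absorb1)

lemma cell_sets_subset: "cell_disc n \<subseteq> topspace (Euclidean_space n)"
    "cell_interior n \<subseteq> topspace (Euclidean_space n)"
  by (auto simp: cell_disc_def cell_interior_def)

text \<open>Discs are sets of real sequences here, so compactness is inherited from the product of
  countably many intervals \<open>{-1..1}\<close>.\<close>

lemma compact_cell_disc: "compact (cell_disc n)"
proof -
  have "compactin (product_topology (\<lambda>i. euclideanreal) UNIV) (PiE UNIV (\<lambda>i::nat. {-1..1}))"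
    by (simp add: compactin_PiE)
  then have "compact (PiE UNIV (\<lambda>i::nat. {-1..1::real}))"
    by (simp add: euclidean_product_topology)
  moreover have "closed (cell_disc n)"
  proof -
    have eq: "cell_disc n = (\<Inter>i\<in>{n..}. {v. v i = 0}) \<inter> {v. cnorm n v \<le> 1}"
      by (auto simp: cell_disc_eq)
    show ?thesis
      unfolding eq by (intro closed_Int closed_INT ballI closed_Collect_eq closed_Collect_le
          continuous_on_product_coordinates continuous_intros)
  qed
  moreover have "cell_disc n \<subseteq> PiE UNIV (\<lambda>i::nat. {-1..1::real})"
  proof
    fix v assume v: "v \<in> cell_disc n"
    have "\<bar>v i\<bar> \<le> 1" for i
    proof (cases "i < n")
      case True
      then have "(v i)\<^sup>2 \<le> (\<Sum>i<n. (v i)\<^sup>2)"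
        by (intro member_le_sum) auto
      also have "\<dots> \<le> 1"
        using v by (simp add: cell_disc_eq cnorm_def)
      finally show ?thesis
        by (simp add: abs_square_le_1)
    qed (use v in \<open>auto simp: cell_disc_eq\<close>)
    then show "v \<in> PiE UNIV (\<lambda>i::nat. {-1..1::real})"
      by (simp add: PiE_def Pi_def abs_le_iff minus_le_iff)
  qed
  ultimately show ?thesis
    by (metis compact_Int_closed inf.absorb_iff2)
qed

section \<open>Cells, skeleta and the weak topology of a CW complex\<close>

locale cw_structure =
  fixes K :: "'a topology" and \<C> :: "(nat \<times> ((nat \<Rightarrow> real) \<Rightarrow> 'a)) set"
  assumes Hausdorff: "Hausdorff_space K" and decomposition: "CW_decomposition K \<C>"
begin

lemma decomposition_conditions:
  "\<forall>(n, \<Phi>) \<in> \<C>.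
        continuous_map (subtopology (Euclidean_space n) (cell_disc n)) K \<Phi> \<and>
        homeomorphic_map (subtopology (Euclidean_space n) (cell_interior n))
          (subtopology K (\<Phi> ` cell_interior n)) \<Phi>"
  "(\<Union>(n, \<Phi>) \<in> \<C>. \<Phi> ` cell_interior n) = topspace K"
  "pairwise (\<lambda>(m, \<Psi>) (n, \<Phi>). disjnt (\<Psi> ` cell_interior m) (\<Phi> ` cell_interior n)) \<C>"
  "\<forall>(n, \<Phi>) \<in> \<C>. \<exists>\<F> \<subseteq> \<C>. finite \<F> \<and> (\<forall>(m, \<Psi>) \<in> \<F>. m < n) \<and>
        \<Phi> ` cell_boundary n \<subseteq> (\<Union>(m, \<Psi>) \<in> \<F>. \<Psi> ` cell_interior m)"
  "\<forall>A \<subseteq> topspace K.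
        closedin K A \<longleftrightarrow> (\<forall>(n, \<Phi>) \<in> \<C>. closedin K (A \<inter> \<Phi> ` cell_disc n))"
  using decomposition[unfolded CW_decomposition_def] by simp_all

lemma cell_continuous:
  assumes "(n, \<Phi>) \<in> \<C>"
  shows "continuous_map (top_of_set (cell_disc n)) K \<Phi>"
  using bspec[OF decomposition_conditions(1) assms]
  by (simp add: subtopology_Euclidean_space[OF cell_sets_subset(1)])

lemma cell_inj:
  assumes "(n, \<Phi>) \<in> \<C>"
  shows "inj_on \<Phi> (cell_interior n)"
proof -
  have "homeomorphic_map (top_of_set (cell_interior n)) (subtopology K (\<Phi> ` cell_interior n)) \<Phi>"
    using bspec[OF decomposition_conditions(1) assms]
    by (simp add: subtopology_Euclidean_space[OF cell_sets_subset(2)])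
  from homeomorphic_imp_injective_map[OF this] show ?thesis
    by simp
qed

lemma cell_cover:
  assumes "x \<in> topspace K"
  obtains n \<Phi> v where "(n, \<Phi>) \<in> \<C>" "v \<in> cell_interior n" "\<Phi> v = x"
  using assms that unfolding decomposition_conditions(2)[symmetric] by auto

lemma cell_unique:
  assumes "(n, \<Phi>) \<in> \<C>" "(m, \<Psi>) \<in> \<C>" "v \<in> cell_interior n" "u \<in> cell_interior m" "\<Phi> v = \<Psi> u"
  shows "n = m \<and> \<Phi> = \<Psi> \<and> v = u"
proof -
  have "(n, \<Phi>) = (m, \<Psi>)"
  proof (rule ccontr)
    assume "(n, \<Phi>) \<noteq> (m, \<Psi>)"
    from pairwiseD[OF decomposition_conditions(3) assms(1,2) this]
    have "disjnt (\<Phi> ` cell_interior n) (\<Psi> ` cell_interior m)"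
      by simp
    moreover have "\<Phi> v \<in> \<Phi> ` cell_interior n" "\<Phi> v \<in> \<Psi> ` cell_interior m"
      using assms(3) by (rule imageI) (use assms(4,5) in auto)
    ultimately show False
      by (meson disjnt_iff)
  qed
  then show ?thesis
    using cell_inj[OF assms(1)] assms(3-5) by (auto simp: inj_on_def)
qed

lemma cell_image:
  assumes "(n, \<Phi>) \<in> \<C>" "v \<in> cell_disc n"
  shows "\<Phi> v \<in> topspace K"
  using cell_continuous[OF assms(1)] assms(2) by (auto simp: continuous_map_def)

lemma cell_boundary_finite:
  assumes "(n, \<Phi>) \<in> \<C>"
  obtains F where "F \<subseteq> \<C>" "finite F" "\<forall>c \<in> F. fst c < n"
    "\<Phi> ` cell_boundary n \<subseteq> (\<Union>(m, \<Psi>) \<in> F. \<Psi> ` cell_interior m)"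
proof -
  obtain F where F: "F \<subseteq> \<C>" "finite F" "\<forall>(m, \<Psi>) \<in> F. m < n"
    "\<Phi> ` cell_boundary n \<subseteq> (\<Union>(m, \<Psi>) \<in> F. \<Psi> ` cell_interior m)"
    using bspec[OF decomposition_conditions(4) assms] by auto
  show thesis
    by (rule that[OF F(1,2) _ F(4)]) (use F(3) in auto)
qed

lemma weak_topology:
  assumes "A \<subseteq> topspace K" "\<And>n \<Phi>. (n, \<Phi>) \<in> \<C> \<Longrightarrow> closedin K (A \<inter> \<Phi> ` cell_disc n)"
  shows "closedin K A"
  using decomposition_conditions(5)[rule_format, OF assms(1)] assms(2) by auto

lemma closedin_cell_image:
  assumes "(n, \<Phi>) \<in> \<C>" "closedin (top_of_set (cell_disc n)) S"
  shows "closedin K (\<Phi> ` S)"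
proof -
  have "compactin (top_of_set (cell_disc n)) S"
    using closedin_compact[OF compact_cell_disc assms(2)] closedin_imp_subset[OF assms(2)]
    by (simp add: compactin_subtopology)
  then show ?thesis
    using image_compactin[OF _ cell_continuous[OF assms(1)]] compactin_imp_closedin[OF Hausdorff] by blast
qed

text \<open>Dimension, characteristic map and coordinates for the open cell that contains
  \<open>x\<close>. By \<open>cell_unique\<close> the choice is forced at points of
  \<open>K\<close>.\<close>

definition cell_of :: "'a \<Rightarrow> nat \<times> ((nat \<Rightarrow> real) \<Rightarrow> 'a) \<times> (nat \<Rightarrow> real)" where
  "cell_of x = (SOME c. (fst c, fst (snd c)) \<in> \<C> \<and> snd (snd c) \<in> cell_interior (fst c) \<and>
     fst (snd c) (snd (snd c)) = x)"

definition "cdim x = fst (cell_of x)"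
definition "cchar x = fst (snd (cell_of x))"
definition "ccoord x = snd (snd (cell_of x))"

lemma cell_of:
  assumes "x \<in> topspace K"
  shows "(cdim x, cchar x) \<in> \<C>" "ccoord x \<in> cell_interior (cdim x)" "cchar x (ccoord x) = x"
proof -
  obtain n \<Phi> v where "(n, \<Phi>) \<in> \<C>" "v \<in> cell_interior n" "\<Phi> v = x"
    by (rule cell_cover[OF assms])
  then have "\<exists>c. (fst c, fst (snd c)) \<in> \<C> \<and> snd (snd c) \<in> cell_interior (fst c) \<and> fst (snd c) (snd (snd c)) = x"
    by (intro exI[of _ "(n, \<Phi>, v)"]) simp
  from someI_ex[OF this] show "(cdim x, cchar x) \<in> \<C>" "ccoord x \<in> cell_interior (cdim x)" "cchar x (ccoord x) = x"
    by (simp_all add: cdim_def cchar_def ccoord_def cell_of_def)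
qed

lemma cell_of_interior:
  assumes "(n, \<Phi>) \<in> \<C>" "v \<in> cell_interior n"
  shows "cdim (\<Phi> v) = n" "cchar (\<Phi> v) = \<Phi>" "ccoord (\<Phi> v) = v"
  using cell_unique[OF cell_of(1) assms(1) cell_of(2) assms(2) cell_of(3)] cell_image[OF assms(1)] assms(2)
  by (auto simp: cell_disc_split)

lemma dim_boundary:
  assumes "(n, \<Phi>) \<in> \<C>" "v \<in> cell_boundary n"
  shows "cdim (\<Phi> v) < n"
proof -
  obtain F where F: "F \<subseteq> \<C>" "finite F" "\<forall>c \<in> F. fst c < n"
    "\<Phi> ` cell_boundary n \<subseteq> (\<Union>(m, \<Psi>) \<in> F. \<Psi> ` cell_interior m)"
    by (rule cell_boundary_finite[OF assms(1)])
  then obtain m \<Psi> u where "(m, \<Psi>) \<in> F" "u \<in> cell_interior m" "\<Phi> v = \<Psi> u"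
    using assms(2) by blast
  then show ?thesis
    using F(1,3) cell_of_interior(1)[of m \<Psi> u] by (metis fst_conv subsetD)
qed

text \<open>Cells of dimension at least \<open>n\<close> meet \<open>A\<close> only in their
  boundary, which finitely many cells of lower dimension cover. So the condition of the weak
  topology at these cells follows by induction on the dimension.\<close>

lemma closedin_skeleton_part:
  assumes A: "A \<subseteq> topspace K" "\<And>x. x \<in> A \<Longrightarrow> cdim x < n"
    and low: "\<And>m \<Psi>. (m, \<Psi>) \<in> \<C> \<Longrightarrow> m < n \<Longrightarrow> closedin K (A \<inter> \<Psi> ` cell_disc m)"
  shows "closedin K A"
proof -
  have "(m, \<Psi>) \<in> \<C> \<Longrightarrow> closedin K (A \<inter> \<Psi> ` cell_disc m)" for m \<Psi>
  proof (induction m arbitrary: \<Psi> rule: less_induct)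
    case (less m)
    show ?case
    proof (cases "m < n")
      case False
      obtain F where F: "F \<subseteq> \<C>" "finite F" "\<forall>c \<in> F. fst c < m"
        "\<Psi> ` cell_boundary m \<subseteq> (\<Union>(l, \<Theta>) \<in> F. \<Theta> ` cell_interior l)"
        by (rule cell_boundary_finite[OF less.prems])
      have "A \<inter> \<Psi> ` cell_interior m = {}"
      proof (rule equals0I)
        fix x assume "x \<in> A \<inter> \<Psi> ` cell_interior m"
        then obtain v where "x \<in> A" "v \<in> cell_interior m" "x = \<Psi> v"
          by auto
        then show False
          using A(2)[of x] cell_of_interior(1)[OF less.prems, of v] False by simp
      qed
      then have "A \<inter> \<Psi> ` cell_disc m = A \<inter> \<Psi> ` cell_boundary m"
        by (auto simp: cell_disc_split)
      also have "\<dots> = (\<Union>c\<in>F. A \<inter> snd c ` cell_disc (fst c)) \<inter> \<Psi> ` cell_boundary m"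
      proof -
        have "(\<Union>(l, \<Theta>) \<in> F. \<Theta> ` cell_interior l) \<subseteq> (\<Union>c\<in>F. snd c ` cell_disc (fst c))"
          by (auto simp: cell_disc_split)
        with F(4) have "\<Psi> ` cell_boundary m \<subseteq> (\<Union>c\<in>F. snd c ` cell_disc (fst c))"
          by (rule subset_trans)
        then show ?thesis
          by blast
      qed
      finally have eq: "A \<inter> \<Psi> ` cell_disc m = (\<Union>c\<in>F. A \<inter> snd c ` cell_disc (fst c)) \<inter> \<Psi> ` cell_boundary m" .
      have "closedin K (\<Union>c\<in>F. A \<inter> snd c ` cell_disc (fst c))"
      proof (rule closedin_Union)
        fix S assume "S \<in> (\<lambda>c. A \<inter> snd c ` cell_disc (fst c)) ` F"
        then obtain l \<Theta> where "(l, \<Theta>) \<in> F" "S = A \<inter> \<Theta> ` cell_disc l"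
          by auto
        then show "closedin K S"
          using less.IH[of l \<Theta>] F(1,3) by (metis fst_conv subsetD)
      qed (use F in auto)
      moreover have "closedin (top_of_set (cell_disc m)) (cell_boundary m)"
      proof -
        have "closed {v. cnorm m v = 1}"
          by (intro closed_Collect_eq continuous_intros) auto
        moreover have "cell_boundary m = cell_disc m \<inter> {v. cnorm m v = 1}"
          by (auto simp: cell_disc_eq cell_boundary_eq)
        ultimately show ?thesis
          by (metis closedin_closed_Int)
      qed
      ultimately show ?thesis
        unfolding eq by (intro closedin_Int closedin_cell_image[OF less.prems])
    qed (rule low[OF less.prems])
  qed
  then show ?thesis
    by (rule weak_topology[OF A(1)])
qed

lemma closedin_cell_complement:
  assumes c: "(m, \<Psi>) \<in> \<C>" and o: "openin (top_of_set (cell_disc m)) {v \<in> cell_disc m. \<Psi> v \<in> S}"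
  shows "closedin K (\<Psi> ` cell_disc m - S)"
proof -
  have "closedin (top_of_set (cell_disc m)) (cell_disc m - {v \<in> cell_disc m. \<Psi> v \<in> S})"
    using closedin_diff[OF closedin_topspace o] by simp
  from closedin_cell_image[OF c this] show ?thesis
    by (rule back_subst[of "closedin K"]) auto
qed

lemma open_in_cells_imp_openin:
  assumes "S \<subseteq> topspace K"
    "\<And>m \<Psi>. (m, \<Psi>) \<in> \<C> \<Longrightarrow> openin (top_of_set (cell_disc m)) {v \<in> cell_disc m. \<Psi> v \<in> S}"
  shows "openin K S"
proof -
  have "closedin K (topspace K - S)"
  proof (rule weak_topology)
    fix m \<Psi> assume c: "(m, \<Psi>) \<in> \<C>"
    have "(topspace K - S) \<inter> \<Psi> ` cell_disc m = \<Psi> ` cell_disc m - S"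
      using cell_image[OF c] by blast
    then show "closedin K ((topspace K - S) \<inter> \<Psi> ` cell_disc m)"
      using closedin_cell_complement[OF c assms(2)[OF c]] by simp
  qed auto
  then show ?thesis
    using assms(1) by (simp add: openin_closedin_eq)
qed

lemma dim_cell_disc:
  assumes "(m, \<Psi>) \<in> \<C>" "v \<in> cell_disc m"
  shows "cdim (\<Psi> v) \<le> m"
proof (cases "v \<in> cell_interior m")
  case True
  then show ?thesis
    using cell_of_interior(1)[OF assms(1)] by simp
next
  case False
  then show ?thesis
    using dim_boundary[OF assms(1), of v] assms(2) by (simp add: cell_disc_split)
qed

text \<open>The boundary of an \<open>n\<close>-cell is mapped into the skeleton below
  \<open>n\<close>, and there the complement of \<open>S\<close> is closed as soon as it is closed
  in the lower cells. This carries the induction hypothesis of \<open>good_cell\<close> to the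
  boundary sphere.\<close>

lemma open_in_lower_cells_imp_open_in_boundary:
  assumes c: "(n, \<Phi>) \<in> \<C>"
    and low: "\<And>m \<Psi>. (m, \<Psi>) \<in> \<C> \<Longrightarrow> m < n \<Longrightarrow> openin (top_of_set (cell_disc m)) {v \<in> cell_disc m. \<Psi> v \<in> S}"
  shows "openin (top_of_set (cell_boundary n)) {v \<in> cell_boundary n. \<Phi> v \<in> S}"
proof -
  define A where "A = {x \<in> topspace K. cdim x < n} - S"
  have "closedin K A"
  proof (rule closedin_skeleton_part)
    fix m \<Psi> assume m: "(m, \<Psi>) \<in> \<C>" "m < n"
    have "A \<inter> \<Psi> ` cell_disc m = \<Psi> ` cell_disc m - S"
      using cell_image[OF m(1)] le_less_trans[OF dim_cell_disc[OF m(1)] m(2)] by (auto simp: A_def)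
    then show "closedin K (A \<inter> \<Psi> ` cell_disc m)"
      using closedin_cell_complement[OF m(1) low[OF m]] by simp
  qed (auto simp: A_def)
  moreover have "continuous_map (top_of_set (cell_boundary n)) K \<Phi>"
    using continuous_map_from_subtopology[OF cell_continuous[OF c], of "cell_boundary n"]
    by (simp add: subtopology_subtopology cell_disc_split Int_absorb1)
  ultimately have "openin (top_of_set (cell_boundary n)) {v \<in> topspace (top_of_set (cell_boundary n)). \<Phi> v \<in> topspace K - A}"
    by (intro openin_continuous_map_preimage) auto
  then show ?thesis
    by (rule back_subst[of "openin (top_of_set (cell_boundary n))"])
      (use dim_boundary[OF c] cell_image[OF c] in \<open>auto simp: A_def cell_disc_split\<close>)
qed


end

text \<open>A neighbourhood of \<open>pt\<close> inside \<open>U\<close> is built by pushing points of each cell of dimension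
  above that of the cell of \<open>pt\<close> radially to the boundary, hence into cells of lower dimension.
  It consists of the points whose trajectory stays in \<open>U\<close> and reaches the cell of \<open>pt\<close> at a point
  from which the segment to \<open>pt\<close> stays in \<open>U\<close>. Cells of dimension \<open>d\<close> move during the times
  between \<open>stage d\<close> and \<open>stage (d - 1)\<close>.\<close>

locale cw_point = cw_structure K \<C> for K :: "'a topology" and \<C> +
  fixes pt :: 'a and U :: "'a set"
  assumes pt: "pt \<in> topspace K" "pt \<in> U" and U: "openin K U"
begin

definition segment :: "(nat \<Rightarrow> real) \<Rightarrow> real \<Rightarrow> nat \<Rightarrow> real" where
  "segment v t = (\<lambda>i. (1 - t) * v i + t * ccoord pt i)"

definition radial :: "nat \<Rightarrow> (nat \<Rightarrow> real) \<Rightarrow> real \<Rightarrow> nat \<Rightarrow> real" where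
  "radial n v t = (\<lambda>i. ((1 - t) + t / cnorm n v) * v i)"

text \<open>The times decrease to 0, so that cells of arbitrarily high dimension get their turn, and
  end at 1/2, the value at \<open>cdim pt\<close>. The second half of the interval is reserved for
  the segment inside the cell of \<open>pt\<close>.\<close>

definition stage :: "nat \<Rightarrow> real" where
  "stage d = 1 / (real (d - cdim pt) + 2)"

definition phase :: "nat \<Rightarrow> real \<Rightarrow> real" where
  "phase d t = max 0 (min 1 ((t - stage d) / (stage (d - 1) - stage d)))"

definition home :: "'a \<Rightarrow> bool" where
  "home y \<longleftrightarrow> cdim y = cdim pt \<and> cchar y = cchar pt"

definition pushed :: "'a \<Rightarrow> 'a" where
  "pushed y = cchar y (radial (cdim y) (ccoord y) 1)"

text \<open>The guard \<open>cdim (pushed y) < cdim y\<close> makes the recursion terminate for all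
  arguments, including points outside \<open>K\<close> and centres of cells, where division by zero
  leaves the centre in place. At other points of \<open>K\<close> it holds by
  \<open>pushed_boundary\<close>.\<close>

function near :: "'a \<Rightarrow> bool" where
  "near y =
    (if home y then \<forall>t\<in>{0..1}. cchar pt (segment (ccoord y) t) \<in> U
     else if cdim pt < cdim y \<and> cdim (pushed y) < cdim y then
       ccoord y \<noteq> (\<lambda>_. 0) \<and> (\<forall>t\<in>{0..1}. cchar y (radial (cdim y) (ccoord y) t) \<in> U) \<and> near (pushed y)
     else False)"
  by auto
termination by (relation "Wellfounded.measure cdim") auto

text \<open>\<open>pushed y\<close> may lie several dimensions lower; the recursive call then keeps
  it at rest until the stage of its own dimension. The value \<open>y\<close> in the last case is a
  default that does not occur on \<open>V\<close>.\<close>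

function flow :: "'a \<Rightarrow> real \<Rightarrow> 'a" where
  "flow y t =
    (if home y then cchar pt (segment (ccoord y) (max 0 (2 * t - 1)))
     else if cdim pt < cdim y \<and> cdim (pushed y) < cdim y then
       if t \<le> stage (cdim y - 1) then cchar y (radial (cdim y) (ccoord y) (phase (cdim y) t))
       else flow (pushed y) t
     else y)"
  by auto
termination by (relation "Wellfounded.measure (\<lambda>(y, t). cdim y)") auto

declare near.simps [simp del] flow.simps [simp del]

definition V :: "'a set" where
  "V = {y \<in> topspace K. near y}"

lemma radial_0: "radial n v 0 = v"
  by (simp add: radial_def)

lemma radial_boundary: "v \<in> cell_boundary n \<Longrightarrow> radial n v t = v"
  by (simp add: radial_def cell_boundary_eq)

lemma cnorm_pos: "v \<in> cell_disc n \<Longrightarrow> v \<noteq> (\<lambda>_. 0) \<Longrightarrow> 0 < cnorm n v"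
  using cnorm_eq_0 cnorm_nonneg[of n v] by fastforce

lemma radial_1:
  assumes "v \<in> cell_disc n" "v \<noteq> (\<lambda>_. 0)"
  shows "radial n v 1 \<in> cell_boundary n"
proof -
  have "cnorm n (radial n v 1) = 1"
    unfolding radial_def cnorm_scale using cnorm_pos[OF assms] by simp
  then show ?thesis
    using assms(1) by (simp add: cell_boundary_eq cell_disc_eq radial_def)
qed

lemma radial_disc:
  assumes "v \<in> cell_disc n" "v \<noteq> (\<lambda>_. 0)" "t \<in> {0..1}"
  shows "radial n v t \<in> cell_disc n"
proof -
  have pos: "0 < cnorm n v" "cnorm n v \<le> 1"
    using cnorm_pos[OF assms(1,2)] assms(1) by (auto simp: cell_disc_eq)
  have "cnorm n (radial n v t) = (1 - t + t / cnorm n v) * cnorm n v"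
    unfolding radial_def cnorm_scale using assms(3) pos by simp
  also have "\<dots> = (1 - t) * cnorm n v + t"
    using pos by (simp add: field_simps)
  also have "\<dots> \<le> (1 - t) * 1 + t"
    using assms(3) pos by (intro add_right_mono mult_left_mono) auto
  finally show ?thesis
    using assms(1) by (simp add: cell_disc_eq radial_def)
qed

lemma segment_ends: "segment v 0 = v" "segment v 1 = ccoord pt"
  by (simp_all add: segment_def)

lemma cnorm_triangle: "cnorm n (\<lambda>i. u i + v i) \<le> cnorm n u + cnorm n v"
  using L2_set_triangle_ineq[of u v "{..<n}"] by (simp add: cnorm_def L2_set_def)

lemma segment_interior:
  assumes "v \<in> cell_interior (cdim pt)" "t \<in> {0..1}"
  shows "segment v t \<in> cell_interior (cdim pt)"
proof -
  let ?n = "cdim pt"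
  have c: "ccoord pt \<in> cell_interior ?n"
    using cell_of[OF pt(1)] by blast
  have "cnorm ?n (segment v t) \<le> (1 - t) * cnorm ?n v + t * cnorm ?n (ccoord pt)"
    using cnorm_triangle[of ?n "\<lambda>i. (1 - t) * v i" "\<lambda>i. t * ccoord pt i"] assms(2)
    by (simp add: segment_def cnorm_scale)
  also have "\<dots> < 1"
    using assms c convex_bound_lt[of "cnorm ?n v" 1 "cnorm ?n (ccoord pt)" "1 - t" t]
    by (simp add: cell_interior_eq)
  finally show ?thesis
    using assms c by (simp add: cell_interior_eq segment_def)
qed

lemma stage_pos: "0 < stage d" and stage_le: "stage d \<le> 1/2"
  by (simp_all add: stage_def field_simps)

lemma stage_mono: "d \<le> e \<Longrightarrow> stage e \<le> stage d"
  unfolding stage_def by (intro divide_left_mono mult_pos_pos) auto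

lemma stage_strict: "cdim pt < d \<Longrightarrow> stage d < stage (d - 1)"
  unfolding stage_def by (intro divide_strict_left_mono mult_pos_pos) auto

lemma phase_le: "cdim pt < d \<Longrightarrow> t \<le> stage d \<Longrightarrow> phase d t = 0"
  using stage_strict[of d] by (simp add: phase_def divide_nonpos_pos)

lemma phase_ge: "cdim pt < d \<Longrightarrow> t = stage (d - 1) \<Longrightarrow> phase d t = 1"
  using stage_strict[of d] by (simp add: phase_def)

lemma phase_01: "phase d t \<in> {0..1}"
  by (simp add: phase_def)

lemma home_pt: "home pt"
  by (simp add: home_def)

lemma pushed_boundary:
  assumes "y \<in> topspace K" "ccoord y \<noteq> (\<lambda>_. 0)"
  shows "pushed y \<in> topspace K" "cdim (pushed y) < cdim y"
proof -
  have "radial (cdim y) (ccoord y) 1 \<in> cell_boundary (cdim y)"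
    using cell_of[OF assms(1)] assms(2) by (intro radial_1) (auto simp: cell_disc_split)
  then show "pushed y \<in> topspace K" "cdim (pushed y) < cdim y"
    using dim_boundary cell_of(1)[OF assms(1)] cell_image unfolding pushed_def
    by (auto simp: cell_disc_split)
qed

lemma V_home:
  assumes "y \<in> topspace K" "home y"
  shows "y \<in> V \<longleftrightarrow> (\<forall>t\<in>{0..1}. cchar pt (segment (ccoord y) t) \<in> U)"
  using assms by (simp add: V_def near.simps[of y])

lemma V_away:
  assumes "y \<in> topspace K" "\<not> home y"
  shows "y \<in> V \<longleftrightarrow> cdim pt < cdim y \<and> ccoord y \<noteq> (\<lambda>_. 0) \<and>
    (\<forall>t\<in>{0..1}. cchar y (radial (cdim y) (ccoord y) t) \<in> U) \<and> pushed y \<in> V"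
  using assms pushed_boundary[OF assms(1)] by (auto simp: V_def near.simps[of y])

lemma V_topspace: "V \<subseteq> topspace K"
  by (auto simp: V_def)

lemma pt_V: "pt \<in> V"
  using pt cell_of[OF pt(1)] by (simp add: V_home home_pt segment_def distrib_right[symmetric])

lemma flow_home: "home y \<Longrightarrow> flow y t = cchar pt (segment (ccoord y) (max 0 (2 * t - 1)))"
  by (simp add: flow.simps)

lemma flow_away:
  assumes "y \<in> V" "\<not> home y"
  shows "flow y t = (if t \<le> stage (cdim y - 1) then cchar y (radial (cdim y) (ccoord y) (phase (cdim y) t))
       else flow (pushed y) t)"
  using assms V_away[of y] pushed_boundary[of y] V_topspace by (subst flow.simps) auto

lemma V_dim:
  assumes "y \<in> V"
  shows "cdim pt \<le> cdim y"
  using assms V_away[of y] V_topspace by (cases "home y") (auto simp: home_def)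

text \<open>The reason why the pieces of the flow fit together: when a point arrives at the boundary
  of its cell, the trajectory of the point reached there has not yet begun to move.\<close>

lemma flow_early:
  assumes "y \<in> V" "t \<le> stage (cdim y)"
  shows "flow y t = y"
proof -
  have y: "y \<in> topspace K"
    using assms V_topspace by blast
  show ?thesis
  proof (cases "home y")
    case True
    then have "stage (cdim y) = 1/2"
      by (simp add: home_def stage_def)
    then show ?thesis
      using True cell_of[OF y] assms(2) by (simp add: flow_home segment_ends home_def)
  next
    case False
    then have "cdim pt < cdim y"
      using assms(1) V_away[OF y] by blast
    then show ?thesis
      using flow_away[OF assms(1) False] phase_le[OF _ assms(2)] stage_strict[of "cdim y"] assms(2) cell_of[OF y]
      by (simp add: radial_0)
  qed
qed

lemma flow_U:
  assumes "y \<in> V" "t \<in> {0..1}"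
  shows "flow y t \<in> U"
  using assms(1)
proof (induction "cdim y" arbitrary: y rule: less_induct)
  case less
  then have y: "y \<in> topspace K"
    using V_topspace by blast
  show ?case
  proof (cases "home y")
    case True
    then show ?thesis
      using less.prems V_home[OF y True] assms(2) by (simp add: flow_home)
  next
    case False
    have "cdim (pushed y) < cdim y" "pushed y \<in> V"
      using less.prems V_away[OF y False] pushed_boundary[OF y] by auto
    then show ?thesis
      using less.hyps less.prems V_away[OF y False] phase_01 by (simp add: flow_away[OF less.prems False])
  qed
qed

lemma flow_end:
  assumes "y \<in> V"
  shows "flow y 1 = pt"
  using assms(1)
proof (induction "cdim y" arbitrary: y rule: less_induct)
  case less
  then have y: "y \<in> topspace K"
    using V_topspace by blast
  show ?case
  proof (cases "home y")
    case True
    then show ?thesis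
      using cell_of[OF pt(1)] by (simp add: flow_home segment_ends)
  next
    case False
    have "cdim (pushed y) < cdim y" "pushed y \<in> V"
      using less.prems V_away[OF y False] pushed_boundary[OF y] by auto
    then show ?thesis
      using less.hyps stage_le[of "cdim y - 1"] by (simp add: flow_away[OF less.prems False])
  qed
qed

end

section \<open>Openness of the neighbourhood and continuity of the flow\<close>

context cw_point
begin

lemma V_U: "V \<subseteq> U"
proof
  fix y assume y: "y \<in> V"
  have "flow y 0 = y"
    using y less_imp_le[OF stage_pos] by (rule flow_early)
  then show "y \<in> U"
    using flow_U[OF y, of 0] by simp
qed

lemma V_low_cell:
  assumes c: "(n, \<Phi>) \<in> \<C>" "n \<le> cdim pt" "(n, \<Phi>) \<noteq> (cdim pt, cchar pt)" and v: "v \<in> cell_disc n"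
  shows "\<Phi> v \<notin> V"
proof (cases "v \<in> cell_interior n")
  case True
  then have "cdim (\<Phi> v) = n" "cchar (\<Phi> v) = \<Phi>"
    using cell_of_interior[OF c(1)] by blast+
  then show ?thesis
    using c V_away[OF cell_image[OF c(1) v]] by (auto simp: home_def)
next
  case False
  then show ?thesis
    using v c(2) dim_boundary[OF c(1)] V_dim[of "\<Phi> v"] by (force simp: cell_disc_split)
qed

lemma pt_cell: "(cdim pt, cchar pt) \<in> \<C>"
  using cell_of[OF pt(1)] by blast

lemma V_home_cell:
  assumes v: "v \<in> cell_disc (cdim pt)"
  shows "cchar pt v \<in> V \<longleftrightarrow> v \<in> cell_interior (cdim pt) \<and> (\<forall>t\<in>{0..1}. cchar pt (segment v t) \<in> U)"
proof (cases "v \<in> cell_interior (cdim pt)")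
  case True
  note c = cell_of_interior[OF pt_cell True]
  have "home (cchar pt v)"
    using c by (simp add: home_def)
  then show ?thesis
    using V_home[OF cell_image[OF pt_cell v]] c True by simp
next
  case False
  then show ?thesis
    using v dim_boundary[OF pt_cell] V_dim[of "cchar pt v"] by (force simp: cell_disc_split)
qed

lemma flow_home_cell:
  assumes "v \<in> cell_interior (cdim pt)"
  shows "flow (cchar pt v) t = cchar pt (segment v (max 0 (2 * t - 1)))"
  using cell_of_interior[OF pt_cell assms] by (simp add: flow_home home_def)

lemma pushed_interior:
  assumes "(n, \<Phi>) \<in> \<C>" "v \<in> cell_interior n"
  shows "pushed (\<Phi> v) = \<Phi> (radial n v 1)"
  using cell_of_interior[OF assms] by (simp add: pushed_def)

text \<open>On the boundary of the disc the radial motion is constant, so the recursive description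
  from inside the cell persists there. A single description on the closed disc is what an argument
  up to the boundary requires.\<close>

lemma V_high_cell:
  assumes c: "(n, \<Phi>) \<in> \<C>" "cdim pt < n" and v: "v \<in> cell_disc n"
  shows "\<Phi> v \<in> V \<longleftrightarrow> v \<noteq> (\<lambda>_. 0) \<and> (\<forall>t\<in>{0..1}. \<Phi> (radial n v t) \<in> U) \<and> \<Phi> (radial n v 1) \<in> V"
proof (cases "v \<in> cell_interior n")
  case True
  note i = cell_of_interior[OF c(1) True]
  have "\<not> home (\<Phi> v)"
    using i c(2) by (simp add: home_def)
  from V_away[OF cell_image[OF c(1) v] this] show ?thesis
    using i c(2) pushed_interior[OF c(1) True] by simp
next
  case False
  then have b: "v \<in> cell_boundary n"
    using v by (simp add: cell_disc_split)
  then have "v \<noteq> (\<lambda>_. 0)"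
    by (auto simp: cell_boundary_eq cnorm_def)
  then show ?thesis
    using V_U by (auto simp: radial_boundary[OF b])
qed

text \<open>At a boundary point the dimension is at most \<open>n - 1\<close>, so the flow rests
  until \<open>stage (n - 1)\<close>, just as the radial formula does.\<close>

lemma flow_high_cell:
  assumes c: "(n, \<Phi>) \<in> \<C>" "cdim pt < n" and v: "v \<in> cell_disc n" "\<Phi> v \<in> V"
  shows "flow (\<Phi> v) t = (if t \<le> stage (n - 1) then \<Phi> (radial n v (phase n t)) else flow (\<Phi> (radial n v 1)) t)"
proof (cases "v \<in> cell_interior n")
  case True
  note i = cell_of_interior[OF c(1) True]
  have "\<not> home (\<Phi> v)"
    using i c(2) by (simp add: home_def)
  from flow_away[OF v(2) this] show ?thesis
    using i pushed_interior[OF c(1) True] by simp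
next
  case False
  then have b: "v \<in> cell_boundary n"
    using v by (simp add: cell_disc_split)
  have "cdim (\<Phi> v) \<le> n - 1"
    using dim_boundary[OF c(1) b] by simp
  then have "stage (n - 1) \<le> stage (cdim (\<Phi> v))"
    by (rule stage_mono)
  then show ?thesis
    using flow_early[OF v(2), of t] by (auto simp: radial_boundary[OF b])
qed

lemma continuous_on_radial:
  assumes "continuous_on S f" "continuous_on S g" "\<And>z. z \<in> S \<Longrightarrow> cnorm n (f z) \<noteq> 0"
  shows "continuous_on S (\<lambda>z. radial n (f z) (g z))"
proof -
  have "continuous_on S (\<lambda>z. f z i)" for i
    using assms(1) by (rule continuous_on_product_then_coordinatewise)
  then show ?thesis
    unfolding radial_def using assms
    by (intro continuous_on_coordinatewise_then_product continuous_on_add continuous_on_mult continuous_on_diff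
        continuous_on_divide continuous_on_cnorm continuous_on_const) auto
qed

lemma continuous_on_segment:
  assumes "continuous_on S f" "continuous_on S g"
  shows "continuous_on S (\<lambda>z. segment (f z) (g z))"
proof -
  have "continuous_on S (\<lambda>z. f z i)" for i
    using assms(1) by (rule continuous_on_product_then_coordinatewise)
  then show ?thesis
    unfolding segment_def using assms
    by (intro continuous_on_coordinatewise_then_product continuous_on_add continuous_on_mult continuous_on_diff
         continuous_on_const)
qed

text \<open>Trajectories as points of a path space. Continuity of a map from \<open>V\<close> to
  that space can be tested on the cells, whereas testing the flow itself would call for a weak
  topology on the product with the interval.\<close>

definition FL :: "'a \<Rightarrow> real \<Rightarrow> 'a" where
  "FL y = restrict (flow y) {0..1}"

definition good :: "nat \<Rightarrow> ((nat \<Rightarrow> real) \<Rightarrow> 'a) \<Rightarrow> bool" where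
  "good n \<Phi> \<longleftrightarrow> openin (top_of_set (cell_disc n)) {v \<in> cell_disc n. \<Phi> v \<in> V} \<and>
     continuous_map (cylinder (top_of_set {v \<in> cell_disc n. \<Phi> v \<in> V})) K
       (\<lambda>z. flow (\<Phi> (snd z)) (fst z))"

lemma good_FL:
  assumes "good n \<Phi>"
  shows "continuous_map (top_of_set {v \<in> cell_disc n. \<Phi> v \<in> V}) (compact_open_topology I01 K) (\<lambda>v. FL (\<Phi> v))"
  using continuous_map_curry[of I01 "top_of_set {v \<in> cell_disc n. \<Phi> v \<in> V}" K "\<lambda>z. flow (\<Phi> (snd z)) (fst z)"] assms
  by (simp add: good_def FL_def)

lemma good_openin:
  assumes "good n \<Phi>" "openin (compact_open_topology I01 K) O'"
  shows "openin (top_of_set (cell_disc n)) {v \<in> cell_disc n. \<Phi> v \<in> {y \<in> V. FL y \<in> O'}}"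
proof -
  have "openin (top_of_set {v \<in> cell_disc n. \<Phi> v \<in> V}) {v \<in> {v \<in> cell_disc n. \<Phi> v \<in> V}. FL (\<Phi> v) \<in> O'}"
    using openin_continuous_map_preimage[OF good_FL[OF assms(1)] assms(2)] by simp
  then have "openin (top_of_set (cell_disc n)) {v \<in> {v \<in> cell_disc n. \<Phi> v \<in> V}. FL (\<Phi> v) \<in> O'}"
    using assms(1) unfolding good_def by (meson openin_trans)
  then show ?thesis
    by (rule back_subst[of "openin (top_of_set (cell_disc n))"]) auto
qed

lemma good_topspace:
  assumes "y \<in> V" "good (cdim y) (cchar y)"
  shows "FL y \<in> topspace (compact_open_topology I01 K)"
proof -
  have y: "y \<in> topspace K"
    using assms V_topspace by blast
  have "ccoord y \<in> {v \<in> cell_disc (cdim y). cchar y v \<in> V}"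
    using cell_of[OF y] assms(1) by (simp add: cell_disc_split)
  then have "FL (cchar y (ccoord y)) \<in> topspace (compact_open_topology I01 K)"
    using good_FL[OF assms(2)] unfolding continuous_map_def by auto
  then show ?thesis
    using cell_of[OF y] by simp
qed

lemma good_cell:
  "(n, \<Phi>) \<in> \<C> \<Longrightarrow> good n \<Phi>"
proof (induction n arbitrary: \<Phi> rule: less_induct)
  case (less n)
  let ?S = "{v \<in> cell_disc n. \<Phi> v \<in> V}"
  note c\<Phi> = cell_continuous[OF less.prems]
  consider "n \<le> cdim pt" "(n, \<Phi>) \<noteq> (cdim pt, cchar pt)" | "(n, \<Phi>) = (cdim pt, cchar pt)" | "cdim pt < n"
    by linarith
  then show ?case
  proof cases
    case 1
    then have S: "?S = {}"
      using V_low_cell[OF less.prems 1] by blast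
    show ?thesis
      unfolding good_def S by (simp add: continuous_map_def)
  next
    case 2
    then have [simp]: "n = cdim pt" "\<Phi> = cchar pt"
      by auto
    let ?I = "cell_interior n"
    have "open {v. cnorm n v < 1}"
      by (intro open_Collect_less continuous_intros)
    moreover have "?I = cell_disc n \<inter> {v. cnorm n v < 1}"
      by (auto simp: cell_disc_eq cell_interior_eq)
    ultimately have I: "openin (top_of_set (cell_disc n)) ?I"
      by (metis openin_open_Int)
    have "continuous_on ({0..1} \<times> ?I) (\<lambda>z. segment (snd z) (fst z))"
      by (intro continuous_on_segment continuous_on_snd continuous_on_fst continuous_on_id)
    then have "continuous_map (top_of_set ({0..1} \<times> ?I)) (top_of_set (cell_disc n)) (\<lambda>z. segment (snd z) (fst z))"
      using segment_interior by (auto simp: cell_disc_split)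
    from continuous_map_compose[OF this c\<Phi>]
    have sg: "continuous_map (cylinder (top_of_set ?I)) K (\<lambda>z. \<Phi> (segment (snd z) (fst z)))"
      by (simp add: o_def)
    have S: "?S = {v \<in> topspace (top_of_set ?I). \<forall>t\<in>{0..1}. \<Phi> (segment (snd (t, v)) (fst (t, v))) \<in> U}"
      using V_home_cell by (auto simp: cell_disc_split)
    have "openin (top_of_set ?I) ?S"
      unfolding S by (rule openin_tube[OF sg U])
    then have open_S: "openin (top_of_set (cell_disc n)) ?S"
      using I openin_trans by blast
    have SI: "?S \<subseteq> ?I"
      unfolding S by auto
    have "continuous_map (cylinder (top_of_set ?S)) K (\<lambda>z. (\<lambda>z. \<Phi> (segment (snd z) (fst z))) (max 0 (2 * fst z - 1), snd z))"
    proof (rule continuous_map_pair_compose[OF sg])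
      show "continuous_map (cylinder (top_of_set ?S)) I01 (\<lambda>z. max 0 (2 * fst z - 1))"
        by (rule continuous_map_into_I01) (auto intro!: continuous_intros)
      show "continuous_map (cylinder (top_of_set ?S)) (top_of_set ?I) snd"
        using SI by (auto intro: continuous_on_snd[OF continuous_on_id])
    qed
    then have "continuous_map (cylinder (top_of_set ?S)) K (\<lambda>z. flow (\<Phi> (snd z)) (fst z))"
      by (rule continuous_map_eq) (use SI flow_home_cell in force)
    then show ?thesis
      using open_S unfolding good_def by blast
  next
    case 3
    let ?D = "{v \<in> cell_disc n. v \<noteq> (\<lambda>_. 0)}" and ?B = "{u \<in> cell_boundary n. \<Phi> u \<in> V}"
    have D: "openin (top_of_set (cell_disc n)) ?D"
    proof -
      have "open (- {\<lambda>_::nat. 0::real})"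
        by (rule open_Compl[OF closed_singleton])
      from openin_open_Int[OF this, of "cell_disc n"] show ?thesis
        by (rule back_subst[of "openin (top_of_set (cell_disc n))"]) auto
    qed
    have pos: "cnorm n v \<noteq> 0" if "v \<in> ?D" for v
      using that cnorm_pos[of v n] by auto
    have rad: "continuous_map (top_of_set ({0..1} \<times> ?D)) (top_of_set (cell_disc n)) (\<lambda>z. radial n (snd z) (fst z))"
    proof -
      have "continuous_on ({0..1} \<times> ?D) (\<lambda>z. radial n (snd z) (fst z))"
        using pos by (intro continuous_on_radial continuous_on_snd continuous_on_fst continuous_on_id) auto
      then show ?thesis
        using radial_disc by auto
    qed
    have r1: "continuous_map (top_of_set ?D) (top_of_set (cell_boundary n)) (\<lambda>v. radial n v 1)"
    proof -
      have "continuous_on ?D (\<lambda>v. radial n v 1)"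
        using pos by (intro continuous_on_radial continuous_on_id continuous_on_const)
      then show ?thesis
        using radial_1 by auto
    qed
    from continuous_map_compose[OF rad c\<Phi>]
    have sg: "continuous_map (cylinder (top_of_set ?D)) K (\<lambda>z. \<Phi> (radial n (snd z) (fst z)))"
      by (simp add: o_def)
    have open_B: "openin (top_of_set (cell_boundary n)) ?B"
    proof (rule open_in_lower_cells_imp_open_in_boundary[OF less.prems])
      fix m \<Psi> assume "(m, \<Psi>) \<in> \<C>" "m < n"
      then show "openin (top_of_set (cell_disc m)) {v \<in> cell_disc m. \<Psi> v \<in> V}"
        using less.IH by (simp add: good_def)
    qed
    have "openin (top_of_set ?D) {v \<in> topspace (top_of_set ?D). \<forall>t\<in>{0..1}. \<Phi> (radial n (snd (t, v)) (fst (t, v))) \<in> U}"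
      by (rule openin_tube[OF sg U])
    moreover have "openin (top_of_set ?D) {v \<in> topspace (top_of_set ?D). radial n v 1 \<in> ?B}"
      by (rule openin_continuous_map_preimage[OF r1 open_B])
    ultimately have "openin (top_of_set ?D)
       ({v \<in> topspace (top_of_set ?D). \<forall>t\<in>{0..1}. \<Phi> (radial n (snd (t, v)) (fst (t, v))) \<in> U} \<inter>
        {v \<in> topspace (top_of_set ?D). radial n v 1 \<in> ?B})"
      by (rule openin_Int)
    moreover have "\<dots> = ?S"
      using V_high_cell[OF less.prems 3] radial_1 by auto
    ultimately have open_S: "openin (top_of_set (cell_disc n)) ?S"
      using D openin_trans by simp
    have SD: "?S \<subseteq> ?D"
      using V_high_cell[OF less.prems 3] by auto
    \<comment> \<open>By induction, an open set of paths pulls back to a subset of \<open>V\<close>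
      that is open in all lower cells, hence to an open subset of the boundary sphere. This gives
      continuity of the trajectories along the boundary.\<close>
    have cB: "continuous_map (top_of_set ?B) (compact_open_topology I01 K) (\<lambda>u. FL (\<Phi> u))"
      unfolding continuous_map_def
    proof (intro conjI allI impI)
      show "(\<lambda>u. FL (\<Phi> u)) \<in> topspace (top_of_set ?B) \<rightarrow> topspace (compact_open_topology I01 K)"
      proof
        fix u assume "u \<in> topspace (top_of_set ?B)"
        then have u: "u \<in> cell_boundary n" "\<Phi> u \<in> V"
          by auto
        then have "cdim (\<Phi> u) < n" "(cdim (\<Phi> u), cchar (\<Phi> u)) \<in> \<C>"
          using dim_boundary[OF less.prems] cell_of V_topspace by auto
        then show "FL (\<Phi> u) \<in> topspace (compact_open_topology I01 K)"
          using less.IH u good_topspace by blast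
      qed
      fix O' assume O': "openin (compact_open_topology I01 K) O'"
      have "openin (top_of_set (cell_boundary n)) {u \<in> cell_boundary n. \<Phi> u \<in> {y \<in> V. FL y \<in> O'}}"
      proof (rule open_in_lower_cells_imp_open_in_boundary[OF less.prems])
        fix m \<Psi> assume "(m, \<Psi>) \<in> \<C>" "m < n"
        then show "openin (top_of_set (cell_disc m)) {v \<in> cell_disc m. \<Psi> v \<in> {y \<in> V. FL y \<in> O'}}"
          using less.IH good_openin O' by blast
      qed
      then have "openin (top_of_set ?B) {u \<in> cell_boundary n. \<Phi> u \<in> {y \<in> V. FL y \<in> O'}}"
        by (rule openin_subset_trans) auto
      then show "openin (top_of_set ?B) {u \<in> topspace (top_of_set ?B). FL (\<Phi> u) \<in> O'}"
        by (rule back_subst[of "openin (top_of_set ?B)"]) auto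
    qed
    let ?X = "cylinder (top_of_set ?S)"
    \<comment> \<open>Until \<open>stage (n - 1)\<close> a point moves radially, afterwards it
      follows the trajectory of the boundary point it has reached. At the switch
      \<open>phase\<close> is 1 and that trajectory is still at its start.\<close>
    have glue: "continuous_map ?X K (\<lambda>z. if fst z \<le> stage (n - 1) then \<Phi> (radial n (snd z) (phase n (fst z)))
        else FL (\<Phi> (radial n (snd z) 1)) (fst z))"
    proof (rule continuous_map_I01_cases)
      show "continuous_map ?X euclideanreal fst"
        by (rule cm_coords)
      have snd: "continuous_map ?X (top_of_set ?D) snd"
        using SD by (auto intro: continuous_on_snd[OF continuous_on_id])
      have "continuous_map ?X K (\<lambda>z. (\<lambda>z. \<Phi> (radial n (snd z) (fst z))) (phase n (fst z), snd z))"
      proof (rule continuous_map_pair_compose[OF sg _ snd])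
        have "stage (n - 1) - stage n \<noteq> 0"
          using stage_strict[OF 3] by simp
        then show "continuous_map ?X I01 (\<lambda>z. phase n (fst z))"
          by (intro continuous_map_into_I01) (auto intro!: continuous_intros simp: phase_def)
      qed
      then show "continuous_map (subtopology ?X {z \<in> topspace ?X. fst z \<le> stage (n - 1)}) K
          (\<lambda>z. \<Phi> (radial n (snd z) (phase n (fst z))))"
        by (intro continuous_map_from_subtopology) simp
      have "continuous_map (top_of_set ?S) (top_of_set ?B) (\<lambda>v. radial n v 1)"
        using continuous_map_from_subtopology[OF r1, of ?S] SD V_high_cell[OF less.prems 3]
        by (auto simp: continuous_map_in_subtopology subtopology_subtopology Int_absorb1)
      from continuous_map_compose[OF cm_coords(2) this, of I01]
      have "continuous_map ?X (top_of_set ?B) (\<lambda>z. radial n (snd z) 1)"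
        unfolding o_def .
      from continuous_map_pair_compose[OF continuous_map_uncurry[OF cB] cm_coords(1) this]
      have "continuous_map ?X K (\<lambda>z. FL (\<Phi> (radial n (snd z) 1)) (fst z))"
        by simp
      then show "continuous_map (subtopology ?X {z \<in> topspace ?X. stage (n - 1) \<le> fst z}) K
          (\<lambda>z. FL (\<Phi> (radial n (snd z) 1)) (fst z))"
        by (rule continuous_map_from_subtopology)
      fix z assume z: "z \<in> topspace ?X" and fz: "fst z = stage (n - 1)"
      then have v: "snd z \<in> cell_disc n" "\<Phi> (snd z) \<in> V" "fst z \<in> {0..1}"
        by auto
      then have w: "radial n (snd z) 1 \<in> cell_boundary n" "\<Phi> (radial n (snd z) 1) \<in> V"
        using V_high_cell[OF less.prems 3] radial_1 by auto
      have "cdim (\<Phi> (radial n (snd z) 1)) \<le> n - 1"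
        using dim_boundary[OF less.prems w(1)] by simp
      then have "flow (\<Phi> (radial n (snd z) 1)) (fst z) = \<Phi> (radial n (snd z) 1)"
        using flow_early[OF w(2)] stage_mono fz by metis
      then show "\<Phi> (radial n (snd z) (phase n (fst z))) = FL (\<Phi> (radial n (snd z) 1)) (fst z)"
        using phase_ge[OF 3 fz] v(3) by (simp add: FL_def)
    qed
    have "continuous_map ?X K (\<lambda>z. flow (\<Phi> (snd z)) (fst z))"
      by (rule continuous_map_eq[OF glue]) (use flow_high_cell[OF less.prems 3] in \<open>auto simp: FL_def\<close>)
    then show ?thesis
      using open_S unfolding good_def by blast
  qed
qed

lemma openin_V: "openin K V"
  by (rule open_in_cells_imp_openin[OF V_topspace]) (use good_cell in \<open>auto simp: good_def\<close>)

text \<open>\<open>FL\<close> is continuous by the weak topology, and the exponential law for the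
  interval turns this into joint continuity.\<close>

lemma continuous_map_flow:
  "continuous_map (cylinder (subtopology K V)) K (\<lambda>z. flow (snd z) (fst z))"
proof -
  have "continuous_map (subtopology K V) (compact_open_topology I01 K) FL"
    unfolding continuous_map_def
  proof (intro conjI allI impI)
    show "FL \<in> topspace (subtopology K V) \<rightarrow> topspace (compact_open_topology I01 K)"
      using good_topspace good_cell cell_of by auto
    fix O' assume O': "openin (compact_open_topology I01 K) O'"
    have "openin K {y \<in> V. FL y \<in> O'}"
    proof (rule open_in_cells_imp_openin)
      fix m \<Psi> assume "(m, \<Psi>) \<in> \<C>"
      then show "openin (top_of_set (cell_disc m)) {v \<in> cell_disc m. \<Psi> v \<in> {y \<in> V. FL y \<in> O'}}"
        by (intro good_openin good_cell O')
    qed (use V_topspace in auto)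
    then have "openin (subtopology K V) {y \<in> V. FL y \<in> O'}"
      by (simp add: openin_open_subtopology[OF openin_V] subset_iff)
    then show "openin (subtopology K V) {y \<in> topspace (subtopology K V). FL y \<in> O'}"
      by (rule back_subst[of "openin (subtopology K V)"]) (use V_topspace in auto)
  qed
  from continuous_map_uncurry[OF this] show ?thesis
    by (rule continuous_map_eq) (auto simp: FL_def)
qed

end

text \<open>The contraction stays in \<open>U\<close> but may move \<open>x\<close>. Control by
  \<open>U\<close> is what the treatment of loops relies on.\<close>

definition locally_contractible :: "'a topology \<Rightarrow> bool" where
  "locally_contractible X \<longleftrightarrow>
     (\<forall>U x. openin X U \<and> x \<in> U \<longrightarrow>
        (\<exists>V. openin X V \<and> x \<in> V \<and> V \<subseteq> U \<and>
          homotopic (subtopology X V) (subtopology X U) id (\<lambda>_. x)))"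

lemma CW_complex_locally_contractible:
  assumes "CW_complex K"
  shows "locally_contractible K"
  unfolding locally_contractible_def
proof (intro allI impI, elim conjE)
  fix U x assume U: "openin K U" "x \<in> U"
  obtain \<C> where "Hausdorff_space K" "CW_decomposition K \<C>"
    using assms unfolding CW_complex_def by blast
  then interpret cw_point K \<C> x U
    using U openin_subset by unfold_locales auto
  have "homotopic (subtopology K V) (subtopology K U) id (\<lambda>_. x)"
  proof (rule homotopicI)
    show "continuous_map (cylinder (subtopology K V)) (subtopology K U) (\<lambda>z. flow (snd z) (fst z))"
      using continuous_map_flow flow_U by (auto simp: continuous_map_in_subtopology)
  qed (use flow_end flow_early less_imp_le[OF stage_pos] in auto)
  then show "\<exists>V. openin K V \<and> x \<in> V \<and> V \<subseteq> U \<and> homotopic (subtopology K V) (subtopology K U) id (\<lambda>_. x)"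
    using openin_V pt_V V_U by blast
qed

section \<open>Loop spaces\<close>

lemma topspace_loop_space:
  "topspace (loop_space X x) = {\<gamma> \<in> extensional {0..1}. continuous_map I01 X \<gamma> \<and> \<gamma> 0 = x \<and> \<gamma> 1 = x}"
  by (auto simp: loop_space_def topspace_compact_open_topology)

text \<open>The adjoint of a map on the cylinder; the restriction to the interval makes its values
  extensional, as points of a loop space are.\<close>

definition family :: "(real \<times> 't \<Rightarrow> 'x) \<Rightarrow> 't \<Rightarrow> real \<Rightarrow> 'x" where
  "family g y = restrict (\<lambda>t. g (t, y)) {0..1}"

lemma continuous_map_family:
  assumes "continuous_map (cylinder T) X g"
    "\<And>y. y \<in> topspace T \<Longrightarrow> g (0, y) = x \<and> g (1, y) = x"
  shows "continuous_map T (loop_space X x) (family g)"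
  using continuous_map_curry[OF assms(1)] assms(2) unfolding loop_space_def family_def[abs_def]
  by (auto simp: continuous_map_in_subtopology)

lemma continuous_map_loop_eval:
  assumes "continuous_map T (loop_space X x) F"
  shows "continuous_map (cylinder T) X (\<lambda>z. F (snd z) (fst z))"
  using assms by (intro continuous_map_uncurry) (simp add: loop_space_def continuous_map_in_subtopology)

lemma homotopic_family:
  assumes "homotopic_rel_ends T X g g'"
    and "\<And>y. y \<in> topspace T \<Longrightarrow> g (0, y) = x \<and> g (1, y) = x"
  shows "homotopic T (loop_space X x) (family g) (family g')"
proof -
  obtain G where G: "continuous_map (cylinder (cylinder T)) X G"
     "\<And>t y. t\<in>{0..1} \<Longrightarrow> y \<in> topspace T \<Longrightarrow> G (0, (t, y)) = g (t, y)"
     "\<And>t y. t\<in>{0..1} \<Longrightarrow> y \<in> topspace T \<Longrightarrow> G (1, (t, y)) = g' (t, y)"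
     "\<And>s y. s\<in>{0..1} \<Longrightarrow> y \<in> topspace T \<Longrightarrow> G (s, (0, y)) = g (0, y)"
     "\<And>s y. s\<in>{0..1} \<Longrightarrow> y \<in> topspace T \<Longrightarrow> G (s, (1, y)) = g (1, y)"
    using assms(1) unfolding homotopic_rel_ends_alt by auto
  \<comment> \<open>The two interval coordinates are exchanged: the time of the deformation joins
    the parameters, and the path coordinate becomes the argument of the loops.\<close>
  have "continuous_map (cylinder (cylinder T)) X (\<lambda>z. G (fst (snd z), (fst z, snd (snd z))))"
    by (intro continuous_map_square_compose[OF G(1)] cm_coords)
  then have "continuous_map (cylinder T) (loop_space X x) (family (\<lambda>z. G (fst (snd z), (fst z, snd (snd z)))))"
    by (rule continuous_map_family) (use G assms(2) in auto)
  then show ?thesis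
    by (rule homotopicI) (auto simp: family_def G)
qed

lemma family_eval:
  assumes "F y \<in> topspace (loop_space X x)"
  shows "family (\<lambda>z. F (snd z) (fst z)) y = F y"
  using assms by (auto simp: family_def topspace_loop_space intro: extensional_restrict)

lemma continuous_map_loop_map:
  assumes "continuous_map X Y f"
  shows "continuous_map (loop_space X x) (loop_space Y (f x)) (loop_map f)"
proof -
  have "continuous_map (cylinder (loop_space X x)) Y (\<lambda>z. f (snd z (fst z)))"
    using continuous_map_compose[OF continuous_map_loop_eval[OF continuous_map_id[unfolded id_def]] assms]
    by (simp add: o_def)
  then have "continuous_map (loop_space X x) (loop_space Y (f x)) (family (\<lambda>z. f (snd z (fst z))))"
    by (rule continuous_map_family) (auto simp: topspace_loop_space)
  then show ?thesis
    by (rule continuous_map_eq) (auto simp: family_def loop_map_def)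
qed

lemma openin_loop_space_subbasic:
  assumes "compact C" "C \<subseteq> {0..1}" "openin X U"
  shows "openin (loop_space X x) {\<gamma> \<in> topspace (loop_space X x). \<gamma> ` C \<subseteq> U}"
proof -
  have "compactin I01 C"
    using assms by (simp add: compactin_subtopology)
  from openin_subtopology_Int[OF openin_compact_open_subbasic[OF this assms(3)]]
  have "openin (loop_space X x) ({f \<in> topspace (compact_open_topology I01 X). f ` C \<subseteq> U} \<inter> {\<gamma>. \<gamma> 0 = x \<and> \<gamma> 1 = x})"
    unfolding loop_space_def by blast
  then show ?thesis
    by (rule back_subst[of "openin (loop_space X x)"]) (auto simp: loop_space_def)
qed

section \<open>Semilocal contractibility\<close>

text \<open>The contraction may run through all of \<open>X\<close>. This makes the notion inherited
  by homotopy retracts, unlike local contractibility.\<close>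

definition semilocally_contractible_at :: "'a topology \<Rightarrow> 'a \<Rightarrow> bool" where
  "semilocally_contractible_at X x \<longleftrightarrow>
     (\<exists>V. openin X V \<and> x \<in> V \<and> homotopic (subtopology X V) X id (\<lambda>_. x))"

lemma semilocally_contractible_at_retract:
  assumes f: "continuous_map X Y f" and g: "continuous_map Y X g" and gf: "homotopic X X (g \<circ> f) id"
    and x: "x \<in> topspace X" and slc: "semilocally_contractible_at Y (f x)"
  shows "semilocally_contractible_at X x"
proof -
  obtain V where V: "openin Y V" "f x \<in> V" "homotopic (subtopology Y V) Y id (\<lambda>_. f x)"
    using slc unfolding semilocally_contractible_at_def by blast
  define V' where "V' = {y \<in> topspace X. f y \<in> V}"
  have V': "openin X V'" "x \<in> V'"
    using openin_continuous_map_preimage[OF f V(1)] x V(2) by (auto simp: V'_def)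
  have i: "continuous_map (subtopology X V') X id"
    by simp
  have "continuous_map (subtopology X V') (subtopology Y V) f"
    using f by (auto simp: continuous_map_in_subtopology V'_def intro: continuous_map_from_subtopology)
  from homotopic_comp_both[OF V(3) this g]
  have "homotopic (subtopology X V') X (g \<circ> f) (\<lambda>_. g (f x))"
    by (simp add: o_def)
  moreover have "homotopic (subtopology X V') X (id \<circ> id) (g \<circ> f \<circ> id)"
    by (rule homotopic_comp_right[OF homotopic_with_symD[OF gf] i])
  ultimately have 1: "homotopic (subtopology X V') X id (\<lambda>_. g (f x))"
    using homotopic_with_trans by auto
  \<comment> \<open>The contraction ends at \<open>g (f x)\<close>. Restricted to the point
    \<open>x\<close> it is a path from \<open>x\<close> to that end, and following this path
    backwards moves the end to \<open>x\<close>.\<close>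
  have "continuous_map (subtopology X V') (subtopology X V') (\<lambda>_. x)"
    using V' x by simp
  from homotopic_comp_right[OF 1 this] have "homotopic (subtopology X V') X (\<lambda>_. x) (\<lambda>_. g (f x))"
    by (simp add: o_def)
  with 1 have "homotopic (subtopology X V') X id (\<lambda>_. x)"
    using homotopic_with_trans homotopic_with_symD by blast
  then show ?thesis
    using V' unfolding semilocally_contractible_at_def by blast
qed

lemma locally_contractible_imp_semilocally:
  assumes "locally_contractible X" "x \<in> topspace X"
  shows "semilocally_contractible_at X x"
proof -
  obtain V where "openin X V" "x \<in> V" "homotopic (subtopology X V) (subtopology X (topspace X)) id (\<lambda>_. x)"
    using assms unfolding locally_contractible_def by (meson openin_topspace)
  then show ?thesis
    unfolding semilocally_contractible_at_def by (auto simp: subtopology_topspace)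
qed

text \<open>The contraction of \<open>V\<close> carries both families to the same constant, with the
  same tracks of the ends, so \<open>square_bottom_unique\<close> applies.\<close>

lemma homotopic_rel_ends_in_contractible_set:
  assumes "continuous_map (cylinder T) (subtopology X V) h"
    and "continuous_map (cylinder T) (subtopology X V) k"
    and null: "homotopic (subtopology X V) X id (\<lambda>_. c)"
    and ends: "\<And>y. y \<in> topspace T \<Longrightarrow> h (0, y) = k (0, y) \<and> h (1, y) = k (1, y)"
  shows "homotopic_rel_ends T X h k"
proof -
  obtain C where C: "continuous_map (cylinder (subtopology X V)) X C" "\<And>x. C (0, x) = x" "\<And>x. C (1, x) = c"
    using homotopicE[OF null] unfolding id_apply by blast
  have cC: "continuous_map (cylinder (cylinder T)) X (\<lambda>z. C (fst z, h (snd z)))"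
    if "continuous_map (cylinder T) (subtopology X V) h" for h
    using continuous_map_compose[OF continuous_map_snd that]
    by (intro continuous_map_pair_compose[OF C(1)] cm_coords) (simp add: o_def)
  have "homotopic_rel_ends T X (\<lambda>z. (\<lambda>z. C (fst z, h (snd z))) (0, z)) (\<lambda>z. (\<lambda>z. C (fst z, k (snd z))) (0, z))"
  proof (rule square_bottom_unique[OF cC cC])
    have "continuous_map (cylinder T) X (\<lambda>z. C (1, h z))"
      using continuous_map_compose[OF assms(1) conjunct2[OF homotopic_with_imp_continuous_maps[OF null]]]
      by (simp add: C o_def)
    then show "homotopic_rel_ends T X (\<lambda>z. C (fst (1, z), h (snd (1, z)))) (\<lambda>z. C (fst (1, z), k (snd (1, z))))"
      by (intro homotopic_rel_ends_eq) (simp_all add: C)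
  qed (use assms in auto)
  then show ?thesis
    by (simp add: C)
qed

text \<open>A deformation of the restrictions to \<open>[0, c]\<close> of all loops
  near \<open>\<gamma>0\<close> into that of \<open>\<gamma>0\<close>, with the track of the value at \<open>c\<close> in a contractible set
  \<open>V'\<close>, extends over \<open>[c, c']\<close>.\<close>

lemma deformation_extend:
  fixes T :: "(real \<Rightarrow> 'a) topology"
  assumes cc: "0 \<le> c" "c < c'" "c' \<le> 1"
    and ev: "continuous_map (cylinder T) X (\<lambda>z. snd z (fst z))"
    and \<gamma>0: "continuous_map I01 X \<gamma>0"
    and G: "continuous_map (cylinder (prod_topology (top_of_set {0..c}) T)) X G"
    and G0: "\<And>t \<gamma>. t \<in> {0..c} \<Longrightarrow> \<gamma> \<in> topspace T \<Longrightarrow> G (0, (t, \<gamma>)) = \<gamma> t"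
    and G1: "\<And>t \<gamma>. t \<in> {0..c} \<Longrightarrow> \<gamma> \<in> topspace T \<Longrightarrow> G (1, (t, \<gamma>)) = \<gamma>0 t"
    and GV: "\<And>s \<gamma>. s \<in> {0..1} \<Longrightarrow> \<gamma> \<in> topspace T \<Longrightarrow> G (s, (c, \<gamma>)) \<in> V'"
    and null: "homotopic (subtopology X V') X id (\<lambda>_. k0)"
    and \<gamma>0V: "\<gamma>0 ` {c..c'} \<subseteq> V'" and \<gamma>V: "\<And>\<gamma>. \<gamma> \<in> topspace T \<Longrightarrow> \<gamma> ` {c..c'} \<subseteq> V'"
    and r: "continuous_map (cylinder T) (subtopology X V') r"
    and r0: "\<And>\<gamma>. \<gamma> \<in> topspace T \<Longrightarrow> r (0, \<gamma>) = \<gamma> c'" and r1: "\<And>\<gamma>. \<gamma> \<in> topspace T \<Longrightarrow> r (1, \<gamma>) = \<gamma>0 c'"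
  obtains G' where "continuous_map (cylinder (prod_topology (top_of_set {0..c'}) T)) X G'"
    "\<And>t \<gamma>. t \<in> {0..c'} \<Longrightarrow> \<gamma> \<in> topspace T \<Longrightarrow> G' (0, (t, \<gamma>)) = \<gamma> t"
    "\<And>t \<gamma>. t \<in> {0..c'} \<Longrightarrow> \<gamma> \<in> topspace T \<Longrightarrow> G' (1, (t, \<gamma>)) = \<gamma>0 t"
    "\<And>s \<gamma>. s \<in> {0..1} \<Longrightarrow> \<gamma> \<in> topspace T \<Longrightarrow> G' (s, (0, \<gamma>)) = (if s \<le> 1/2 then G (2 * s, (0, \<gamma>)) else \<gamma>0 0)"
    "\<And>s \<gamma>. s \<in> {0..1} \<Longrightarrow> \<gamma> \<in> topspace T \<Longrightarrow> G' (s, (c', \<gamma>)) = r (min 1 (2 * s), \<gamma>)"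
proof -
  have aff: "c + u * (c' - c) \<in> {c..c'}" "c + u * (c' - c) \<in> {0..1}" if "u \<in> {0..1}" for u
  proof -
    have "u * (c' - c) \<le> c' - c" "0 \<le> u * (c' - c)"
      using that cc mult_right_mono[of u 1 "c' - c"] by simp_all
    then show "c + u * (c' - c) \<in> {c..c'}" "c + u * (c' - c) \<in> {0..1}"
      using cc unfolding atLeastAtMost_iff by linarith+
  qed
  have caff: "continuous_map (cylinder T) I01 (\<lambda>z. c + fst z * (c' - c))"
    using aff(2) by (intro continuous_map_into_I01 continuous_intros cm_coords) auto
  define h where "h = (\<lambda>z :: real \<times> (real \<Rightarrow> 'a). snd z (c + fst z * (c' - c)))"
  define h0 where "h0 = (\<lambda>z :: real \<times> (real \<Rightarrow> 'a). \<gamma>0 (c + fst z * (c' - c)))"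
  have "continuous_map (cylinder T) X h"
    using continuous_map_pair_compose[OF ev caff cm_coords(2)] by (simp add: h_def)
  then have h: "continuous_map (cylinder T) (subtopology X V') h"
    using \<gamma>V aff(1) by (fastforce simp: continuous_map_in_subtopology h_def)
  have "continuous_map (cylinder T) X h0"
    using continuous_map_compose[OF caff \<gamma>0] by (simp add: h0_def o_def)
  then have h0: "continuous_map (cylinder T) (subtopology X V') h0"
    using \<gamma>0V aff(1) by (fastforce simp: continuous_map_in_subtopology h0_def)
  have "continuous_map (cylinder T) X (\<lambda>z. G (fst z, (c, snd z)))"
    using cc by (intro continuous_map_square_compose[OF G] cm_coords) auto
  then have l: "continuous_map (cylinder T) (subtopology X V') (\<lambda>z. G (fst z, (c, snd z)))"
    using GV by (fastforce simp: continuous_map_in_subtopology)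
  \<comment> \<open>Over \<open>[c, c']\<close> the ends are first moved along their tracks at
    \<open>c\<close> and \<open>c'\<close>. This yields some path in \<open>V'\<close> with the same
    ends as the corresponding piece of \<open>\<gamma>0\<close>, and the contractibility of
    \<open>V'\<close> in \<open>X\<close> then deforms it into that piece with the ends
    fixed.\<close>
  obtain F1 where F1: "continuous_map (cylinder (cylinder T)) (subtopology X V') F1"
    "\<And>t y. t \<in> {0..1} \<Longrightarrow> y \<in> topspace T \<Longrightarrow> F1 (0, (t, y)) = h (t, y)"
    "\<And>s y. s \<in> {0..1} \<Longrightarrow> y \<in> topspace T \<Longrightarrow> F1 (s, (0, y)) = G (s, (c, y))"
    "\<And>s y. s \<in> {0..1} \<Longrightarrow> y \<in> topspace T \<Longrightarrow> F1 (s, (1, y)) = r (s, y)"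
    by (rule square_filling[OF h l r]) (use cc in \<open>simp_all add: h_def G0 r0\<close>)
  have "continuous_map (cylinder T) (subtopology X V') (\<lambda>z. F1 (1, z))"
    by (intro continuous_map_pair_compose[OF F1(1)] continuous_map_id[unfolded id_def]) auto
  then have "homotopic_rel_ends T X (\<lambda>z. F1 (1, z)) h0"
    by (rule homotopic_rel_ends_in_contractible_set[OF _ h0 null]) (use cc in \<open>simp_all add: F1 G1 r1 h0_def\<close>)
  then obtain F2 where F2: "continuous_map (cylinder (cylinder T)) X F2"
     "\<And>t y. t\<in>{0..1} \<Longrightarrow> y \<in> topspace T \<Longrightarrow> F2 (0, (t, y)) = F1 (1, (t, y))"
     "\<And>t y. t\<in>{0..1} \<Longrightarrow> y \<in> topspace T \<Longrightarrow> F2 (1, (t, y)) = h0 (t, y)"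
     "\<And>s y. s\<in>{0..1} \<Longrightarrow> y \<in> topspace T \<Longrightarrow> F2 (s, (0, y)) = F1 (1, (0, y))"
     "\<And>s y. s\<in>{0..1} \<Longrightarrow> y \<in> topspace T \<Longrightarrow> F2 (s, (1, y)) = F1 (1, (1, y))"
    unfolding homotopic_rel_ends_alt by auto
  define F where "F = (\<lambda>z. if fst z \<le> 1/2 then F1 (2 * fst z, snd z) else F2 (2 * fst z - 1, snd z))"
  have F: "continuous_map (cylinder (cylinder T)) X F"
    unfolding F_def
    by (rule continuous_map_two_pieces) (use F1(1) F2 in \<open>auto simp: continuous_map_in_subtopology\<close>)
  \<comment> \<open>Over \<open>[0, c]\<close> the deformation is finished at time 1/2 and waits at
    \<open>\<gamma>0\<close> while \<open>F2\<close> acts on the remaining piece.\<close>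
  define E where "E = (\<lambda>z. if fst z \<le> 1/2 then G (2 * fst z, snd z) else (\<lambda>z. \<gamma>0 (fst (snd z))) (2 * fst z - 1, snd z))"
  have "continuous_map (cylinder (prod_topology (top_of_set {0..c}) T)) I01 (\<lambda>z. fst (snd z))"
    using cc continuous_map_fst_snd[of I01 "top_of_set {0..c}" T]
    by (auto simp: continuous_map_in_subtopology)
  from continuous_map_compose[OF this \<gamma>0]
  have E: "continuous_map (cylinder (prod_topology (top_of_set {0..c}) T)) X E"
    unfolding E_def by (intro continuous_map_two_pieces G) (auto simp: o_def G1)
  let ?X = "cylinder (prod_topology (top_of_set {0..c'}) T)"
  have c1: "continuous_map ?X euclideanreal (\<lambda>z. fst (snd z))"
    using continuous_map_fst_snd[of I01 "top_of_set {0..c'}" T] by (simp add: continuous_map_in_subtopology)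
  have "continuous_map ?X X (\<lambda>z. if fst (snd z) \<le> c then E (fst z, (fst (snd z), snd (snd z)))
     else F (fst z, ((fst (snd z) - c) / (c' - c), snd (snd z))))"
  proof (rule continuous_map_I01_cases[OF c1])
    let ?A = "subtopology ?X {z \<in> topspace ?X. fst (snd z) \<le> c}"
    have "continuous_map ?A (top_of_set {0..c}) (\<lambda>z. fst (snd z))"
      using c1 by (auto simp: continuous_map_in_subtopology intro: continuous_map_from_subtopology)
    then show "continuous_map ?A X (\<lambda>z. E (fst z, (fst (snd z), snd (snd z))))"
      by (intro continuous_map_square_compose[OF E] cm_sub_coords)
    let ?B = "subtopology ?X {z \<in> topspace ?X. c \<le> fst (snd z)}"
    have "continuous_map ?B I01 (\<lambda>z. (fst (snd z) - c) / (c' - c))"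
    proof (rule continuous_map_into_I01)
      show "continuous_map ?B euclideanreal (\<lambda>z. (fst (snd z) - c) / (c' - c))"
        using cc by (intro continuous_intros continuous_map_from_subtopology[OF c1]) auto
    qed (use cc in auto)
    then show "continuous_map ?B X (\<lambda>z. F (fst z, ((fst (snd z) - c) / (c' - c), snd (snd z))))"
      by (intro continuous_map_square_compose[OF F] cm_sub_coords)
    fix z assume "z \<in> topspace ?X" "fst (snd z) = c"
    then obtain s \<gamma> where "z = (s, (c, \<gamma>))" "s \<in> {0..1}" "\<gamma> \<in> topspace T"
      by (cases z) auto
    then show "E (fst z, (fst (snd z), snd (snd z))) = F (fst z, ((fst (snd z) - c) / (c' - c), snd (snd z)))"
      using cc by (simp add: E_def F_def F1 F2 G1)
  qed
  then show thesis
  proof (rule that, goal_cases)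
    case (1 t \<gamma>)
    then show ?case
      using cc by (auto simp: E_def F_def G0 F1 h_def)
  next
    case (2 t \<gamma>)
    then show ?case
      using cc by (auto simp: E_def F_def F2 h0_def)
  next
    case (3 s \<gamma>)
    then show ?case
      using cc by (simp add: E_def)
  next
    case (4 s \<gamma>)
    have "min 1 (2 * s) = (if s \<le> 1/2 then 2 * s else 1)"
      by auto
    with 4 show ?case
      using cc by (simp add: F_def F1 F2)
  qed
qed


text \<open>The deformation is extended over the interval piece by piece along a subdivision, which is
  hidden in the bisection principle \<open>Bolzano\<close>.\<close>

lemma semilocally_contractible_loop_space:
  assumes lc: "locally_contractible X" and g0: "\<gamma>0 \<in> topspace (loop_space X x)"
  shows "semilocally_contractible_at (loop_space X x) \<gamma>0"
proof -
  let ?L = "loop_space X x"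
  have \<gamma>0: "continuous_map I01 X \<gamma>0" "\<gamma>0 0 = x" "\<gamma>0 1 = x"
    using g0 by (auto simp: topspace_loop_space)
  have \<gamma>0X: "\<gamma>0 t \<in> topspace X" if "t \<in> {0..1}" for t
    using \<gamma>0(1) that by (auto simp: continuous_map_def)
  have ev: "continuous_map (cylinder (subtopology ?L V)) X (\<lambda>z. snd z (fst z))" for V
    by (rule continuous_map_loop_eval[of _ X x]) (simp add: continuous_map_from_subtopology)
  \<comment> \<open>The set \<open>N\<close> confines the track of the value at \<open>c\<close>, so
    that the next piece can be attached inside a set that contracts in \<open>X\<close>. The value
    at 0 stays at \<open>x\<close> throughout.\<close>
  define good where "good = (\<lambda>c. \<forall>N. openin X N \<and> \<gamma>0 c \<in> N \<longrightarrow>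
     (\<exists>V G. openin ?L V \<and> \<gamma>0 \<in> V \<and>
        continuous_map (cylinder (prod_topology (top_of_set {0..c}) (subtopology ?L V))) X G \<and>
        (\<forall>t\<in>{0..c}. \<forall>\<gamma>\<in>V. G (0, (t, \<gamma>)) = \<gamma> t \<and> G (1, (t, \<gamma>)) = \<gamma>0 t) \<and>
        (\<forall>s\<in>{0..1}. \<forall>\<gamma>\<in>V. G (s, (0, \<gamma>)) = x \<and> G (s, (c, \<gamma>)) \<in> N)))"
  have good0: "good 0"
    unfolding good_def
  proof (intro allI impI exI conjI)
    show "openin ?L (topspace ?L)" "\<gamma>0 \<in> topspace ?L"
      using g0 by auto
    show "continuous_map (cylinder (prod_topology (top_of_set {0..0}) (subtopology ?L (topspace ?L)))) X (\<lambda>_. x)"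
      using \<gamma>0X[of 0] \<gamma>0 by simp
  qed (use \<gamma>0 in \<open>auto simp: topspace_loop_space\<close>)
  \<comment> \<open>Common to the intermediate steps, where \<open>k\<close> contracts
    \<open>M\<close> inside a small set, and to the last step, where \<open>M\<close> is the single
    point \<open>x\<close> and \<open>k\<close> leaves it in place.\<close>
  have extend: "\<exists>V G. openin ?L V \<and> \<gamma>0 \<in> V \<and>
        continuous_map (cylinder (prod_topology (top_of_set {0..c'}) (subtopology ?L V))) X G \<and>
        (\<forall>t\<in>{0..c'}. \<forall>\<gamma>\<in>V. G (0, (t, \<gamma>)) = \<gamma> t \<and> G (1, (t, \<gamma>)) = \<gamma>0 t) \<and>
        (\<forall>s\<in>{0..1}. \<forall>\<gamma>\<in>V. G (s, (0, \<gamma>)) = x \<and> G (s, (c', \<gamma>)) = k (min 1 (2 * s), \<gamma> c'))"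
    if cc: "0 \<le> c" "c < c'" "c' \<le> 1" and good: "good c"
      and V': "openin X V'" "\<gamma>0 ` {c..c'} \<subseteq> V'" "homotopic (subtopology X V') X id (\<lambda>_. k0)"
      and N: "openin ?L N" "\<gamma>0 \<in> N" "\<forall>\<gamma>\<in>N. \<gamma> c' \<in> M"
      and k: "continuous_map (cylinder (subtopology X M)) (subtopology X V') k"
        "\<forall>y\<in>M. k (0, y) = y" "\<forall>y\<in>M. k (1, y) = \<gamma>0 c'"
    for c c' V' k0 N M k
  proof -
    have "\<gamma>0 c \<in> V'"
      using V'(2) cc by auto
    from good[unfolded good_def, rule_format, OF conjI[OF V'(1) this]]
    obtain V G where VG: "openin ?L V" "\<gamma>0 \<in> V"
        "continuous_map (cylinder (prod_topology (top_of_set {0..c}) (subtopology ?L V))) X G"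
        "\<forall>t\<in>{0..c}. \<forall>\<gamma>\<in>V. G (0, (t, \<gamma>)) = \<gamma> t \<and> G (1, (t, \<gamma>)) = \<gamma>0 t"
        "\<forall>s\<in>{0..1}. \<forall>\<gamma>\<in>V. G (s, (0, \<gamma>)) = x \<and> G (s, (c, \<gamma>)) \<in> V'"
      by (elim exE conjE) (rule that)
    define V1 where "V1 = V \<inter> N \<inter> {\<gamma> \<in> topspace ?L. \<gamma> ` {c..c'} \<subseteq> V'}"
    have V1: "openin ?L V1"
      unfolding V1_def using cc VG N V' by (intro openin_Int openin_loop_space_subbasic) auto
    have V1L: "V1 \<subseteq> topspace ?L" "\<gamma>0 \<in> V1"
      using VG N V' g0 by (auto simp: V1_def)
    let ?T = "subtopology ?L V1"
    have T: "\<gamma> \<in> topspace ?T \<longleftrightarrow> \<gamma> \<in> V1" for \<gamma>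
      using V1L by auto
    have i: "continuous_map ?T (subtopology ?L V) id"
      by (auto simp: continuous_map_in_subtopology V1_def)
    have "continuous_map (cylinder (prod_topology (top_of_set {0..c}) ?T)) (subtopology ?L V) (\<lambda>z. snd (snd z))"
      using continuous_map_compose[OF continuous_map_snd_snd[of I01 "top_of_set {0..c}" ?T] i] unfolding o_def id_apply .
    then have G: "continuous_map (cylinder (prod_topology (top_of_set {0..c}) ?T)) X (\<lambda>z. G (fst z, (fst (snd z), snd (snd z))))"
      by (intro continuous_map_square_compose[OF VG(3)] continuous_map_fst continuous_map_fst_snd)
    define r where "r = (\<lambda>z :: real \<times> (real \<Rightarrow> 'a). k (fst z, snd z c'))"
    have "continuous_map ?T X (\<lambda>\<gamma>. \<gamma> c')"
    proof -
      have "continuous_map ?T X (\<lambda>\<gamma>. (\<lambda>z. snd z (fst z)) (c', \<gamma>))"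
        using cc by (intro continuous_map_pair_compose[OF ev[of V1]] continuous_map_id[unfolded id_def]) auto
      then show ?thesis
        by simp
    qed
    then have e: "continuous_map ?T (subtopology X M) (\<lambda>\<gamma>. \<gamma> c')"
      using N(3) by (auto simp: continuous_map_in_subtopology V1_def)
    have r: "continuous_map (cylinder ?T) (subtopology X V') r"
      unfolding r_def using continuous_map_compose[OF continuous_map_snd[of I01 ?T] e]
      by (intro continuous_map_pair_compose[OF k(1)] cm_coords) (simp only: o_def)
    obtain G' where "continuous_map (cylinder (prod_topology (top_of_set {0..c'}) ?T)) X G'"
        "\<And>t \<gamma>. t \<in> {0..c'} \<Longrightarrow> \<gamma> \<in> topspace ?T \<Longrightarrow> G' (0, (t, \<gamma>)) = \<gamma> t"
        "\<And>t \<gamma>. t \<in> {0..c'} \<Longrightarrow> \<gamma> \<in> topspace ?T \<Longrightarrow> G' (1, (t, \<gamma>)) = \<gamma>0 t"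
        "\<And>s \<gamma>. s \<in> {0..1} \<Longrightarrow> \<gamma> \<in> topspace ?T \<Longrightarrow> G' (s, (0, \<gamma>)) = (if s \<le> 1/2 then G (2 * s, (0, \<gamma>)) else \<gamma>0 0)"
        "\<And>s \<gamma>. s \<in> {0..1} \<Longrightarrow> \<gamma> \<in> topspace ?T \<Longrightarrow> G' (s, (c', \<gamma>)) = r (min 1 (2 * s), \<gamma>)"
    proof (rule deformation_extend[OF cc ev \<gamma>0(1) G _ _ _ V'(3,2) _ r])
      show "r (0, \<gamma>) = \<gamma> c'" "r (1, \<gamma>) = \<gamma>0 c'" if "\<gamma> \<in> topspace ?T" for \<gamma>
        using that k N(3) by (auto simp: r_def V1_def)
    qed (use VG in \<open>auto simp: V1_def\<close>)
    note G' = this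
    show ?thesis
    proof (intro exI conjI ballI)
      fix s \<gamma> assume "s \<in> {0..1::real}" "\<gamma> \<in> V1"
      then show "G' (s, (0, \<gamma>)) = x" "G' (s, (c', \<gamma>)) = k (min 1 (2 * s), \<gamma> c')"
        using G'(4,5)[of s \<gamma>] VG(5)[THEN bspec, of "2 * s"] \<gamma>0(2) T by (auto simp: r_def V1_def)
    next
      fix t \<gamma> assume "t \<in> {0..c'}" "\<gamma> \<in> V1"
      then show "G' (0, (t, \<gamma>)) = \<gamma> t" "G' (1, (t, \<gamma>)) = \<gamma>0 t"
        using G'(2,3) T by auto
    qed (use V1 V1L G'(1) in auto)
  qed
  have nbhd: "\<exists>V' d. d > 0 \<and> openin X V' \<and> homotopic (subtopology X V') X id (\<lambda>_. \<gamma>0 u) \<and>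
      (\<forall>t\<in>{0..1}. \<bar>t - u\<bar> < d \<longrightarrow> \<gamma>0 t \<in> V')" if u: "u \<in> {0..1}" for u
  proof -
    obtain V' where V': "openin X V'" "\<gamma>0 u \<in> V'" "homotopic (subtopology X V') X id (\<lambda>_. \<gamma>0 u)"
      using locally_contractible_imp_semilocally[OF lc \<gamma>0X[OF u]] unfolding semilocally_contractible_at_def by blast
    have "openin I01 {t \<in> topspace I01. \<gamma>0 t \<in> V'}"
      by (rule openin_continuous_map_preimage[OF \<gamma>0(1) V'(1)])
    then obtain d where "d > 0" "ball u d \<inter> {0..1} \<subseteq> {t \<in> topspace I01. \<gamma>0 t \<in> V'}"
      using u V'(2) unfolding openin_contains_ball by auto
    then have "\<forall>t\<in>{0..1}. \<bar>t - u\<bar> < d \<longrightarrow> \<gamma>0 t \<in> V'"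
      by (auto simp: dist_real_def abs_minus_commute subset_iff)
    with \<open>d > 0\<close> V' show ?thesis
      by blast
  qed
  have good_step: "good b" if ab: "0 \<le> a" "a < b" "b \<le> 1" and good: "good a"
     and V': "openin X V'" "homotopic (subtopology X V') X id (\<lambda>_. k0)" "\<gamma>0 ` {a..b} \<subseteq> V'" for a b V' k0
    unfolding good_def
  proof (intro allI impI, elim conjE)
    fix N assume N: "openin X N" "\<gamma>0 b \<in> N"
    have "openin X (N \<inter> V')" "\<gamma>0 b \<in> N \<inter> V'"
      using N V' ab by auto
    \<comment> \<open>Here local contractibility is used in full: the track at \<open>b\<close> must
      stay in \<open>V'\<close> for this step and in \<open>N\<close> for the next one.\<close>
    then obtain M where M: "openin X M" "\<gamma>0 b \<in> M" "M \<subseteq> N \<inter> V'"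
      "homotopic (subtopology X M) (subtopology X (N \<inter> V')) id (\<lambda>_. \<gamma>0 b)"
      using lc unfolding locally_contractible_def by meson
    obtain k where k: "continuous_map (cylinder (subtopology X M)) (subtopology X (N \<inter> V')) k"
      "\<And>y. k (0, y) = y" "\<And>y. k (1, y) = \<gamma>0 b"
      using homotopicE[OF M(4)] unfolding id_apply by blast
    have kV: "continuous_map (cylinder (subtopology X M)) (subtopology X V') k"
      using k(1) by (auto simp: continuous_map_in_subtopology)
    have kN: "k (s, y) \<in> N" if "s \<in> {0..1}" "y \<in> M" for s y
    proof -
      have "(s, y) \<in> topspace (cylinder (subtopology X M))"
        using that openin_subset[OF M(1)] by auto
      then show ?thesis
        using k(1) by (auto simp: continuous_map_def)
    qed
    let ?NL = "{\<gamma> \<in> topspace ?L. \<gamma> ` {b} \<subseteq> M}"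
    have NL: "openin ?L ?NL"
      using ab M(1) by (intro openin_loop_space_subbasic) auto
    have NL': "\<gamma>0 \<in> ?NL" "\<forall>\<gamma>\<in>?NL. \<gamma> b \<in> M" "\<forall>y\<in>M. k (0, y) = y" "\<forall>y\<in>M. k (1, y) = \<gamma>0 b"
      using g0 M(2) by (auto simp: k)
    from extend[OF ab good V'(1,3,2) NL NL'(1,2) kV NL'(3,4)]
    obtain V G where VG: "openin ?L V" "\<gamma>0 \<in> V"
        "continuous_map (cylinder (prod_topology (top_of_set {0..b}) (subtopology ?L V))) X G"
        "\<forall>t\<in>{0..b}. \<forall>\<gamma>\<in>V. G (0, (t, \<gamma>)) = \<gamma> t \<and> G (1, (t, \<gamma>)) = \<gamma>0 t"
        "\<forall>s\<in>{0..1}. \<forall>\<gamma>\<in>V. G (s, (0, \<gamma>)) = x \<and> G (s, (b, \<gamma>)) = k (min 1 (2 * s), \<gamma> b)"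
      by (elim exE conjE) (rule that)

    define V2 where "V2 = V \<inter> ?NL"
    have V2: "openin ?L V2" "\<gamma>0 \<in> V2"
      using VG NL g0 M(2) by (auto simp: V2_def)
    have i: "continuous_map (subtopology ?L V2) (subtopology ?L V) id"
      by (auto simp: continuous_map_in_subtopology V2_def)
    have "continuous_map (cylinder (prod_topology (top_of_set {0..b}) (subtopology ?L V2))) (subtopology ?L V) (\<lambda>z. snd (snd z))"
      using continuous_map_compose[OF continuous_map_snd_snd[of I01 "top_of_set {0..b}" "subtopology ?L V2"] i]
      unfolding o_def id_apply .
    then have "continuous_map (cylinder (prod_topology (top_of_set {0..b}) (subtopology ?L V2))) X (\<lambda>z. G (fst z, (fst (snd z), snd (snd z))))"
      by (intro continuous_map_square_compose[OF VG(3)] continuous_map_fst continuous_map_fst_snd)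
    then show "\<exists>V G. openin ?L V \<and> \<gamma>0 \<in> V \<and>
        continuous_map (cylinder (prod_topology (top_of_set {0..b}) (subtopology ?L V))) X G \<and>
        (\<forall>t\<in>{0..b}. \<forall>\<gamma>\<in>V. G (0, (t, \<gamma>)) = \<gamma> t \<and> G (1, (t, \<gamma>)) = \<gamma>0 t) \<and>
        (\<forall>s\<in>{0..1}. \<forall>\<gamma>\<in>V. G (s, (0, \<gamma>)) = x \<and> G (s, (b, \<gamma>)) \<in> N)"
    proof (intro exI conjI)
      show "\<forall>s\<in>{0..1}. \<forall>\<gamma>\<in>V2. G (s, (0, \<gamma>)) = x \<and> G (s, (b, \<gamma>)) \<in> N"
      proof (intro ballI)
        fix s \<gamma> assume "s \<in> {0..1::real}" "\<gamma> \<in> V2"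
        then show "G (s, (0, \<gamma>)) = x \<and> G (s, (b, \<gamma>)) \<in> N"
          using VG(5) kN[of "min 1 (2 * s)" "\<gamma> b"] by (simp add: V2_def)
      qed
    qed (use V2 VG(4) in \<open>auto simp: V2_def\<close>)
  qed
  have all_good: "good c" if c: "c \<in> {0..1}" for c
  proof -
    have "0 \<le> (0::real) \<and> c \<le> 1 \<longrightarrow> good 0 \<longrightarrow> good c"
    proof (rule Bolzano[of 0 c "\<lambda>a b. 0 \<le> a \<and> b \<le> 1 \<longrightarrow> good a \<longrightarrow> good b"])
      fix u assume "0 \<le> u" "u \<le> c"
      then obtain V' d where V': "d > 0" "openin X V'" "homotopic (subtopology X V') X id (\<lambda>_. \<gamma>0 u)"
        "\<And>t. t\<in>{0..1} \<Longrightarrow> \<bar>t - u\<bar> < d \<Longrightarrow> \<gamma>0 t \<in> V'"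
        using nbhd[of u] c by auto
      have "0 \<le> a \<and> b \<le> 1 \<longrightarrow> good a \<longrightarrow> good b" if "a \<le> u" "u \<le> b" "b - a < d" for a b
      proof (cases "a = b")
        case False
        have "\<gamma>0 ` {a..b} \<subseteq> V'" if "0 \<le> a" "b \<le> 1"
          using V'(4) that \<open>a \<le> u\<close> \<open>u \<le> b\<close> \<open>b - a < d\<close> by (auto simp: abs_if)
        then show ?thesis
          using good_step[of a b V' "\<gamma>0 u"] False V'(2,3) that by auto
      qed simp
      then show "\<exists>d>0. \<forall>a b. a \<le> u \<and> u \<le> b \<and> b - a < d \<longrightarrow> 0 \<le> a \<and> b \<le> 1 \<longrightarrow> good a \<longrightarrow> good b"
        using V'(1) by blast
    qed (use c in auto)
    then show ?thesis
      using good0 c by simp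
  qed
  obtain V' d where V': "d > 0" "openin X V'" "homotopic (subtopology X V') X id (\<lambda>_. \<gamma>0 1)"
        "\<And>t. t\<in>{0..1} \<Longrightarrow> \<bar>t - 1\<bar> < d \<Longrightarrow> \<gamma>0 t \<in> V'"
    using nbhd[of 1] by auto
  \<comment> \<open>The last subinterval is treated apart, because there the end value must not
    move. With this \<open>a\<close> it lies within distance \<open>d\<close> of 1, hence is mapped
    into \<open>V'\<close>.\<close>
  define a where "a = max 0 (1 - d/2)"
  have a: "0 \<le> a" "a < 1" "1 - a < d"
    using V'(1) by (auto simp: a_def)
  have sub: "\<gamma>0 ` {a..1} \<subseteq> V'"
    using V'(4) a by auto
  have xV: "x \<in> V'"
    using V'(4)[of 1] V'(1) \<gamma>0 by simp
  have "continuous_map (cylinder (subtopology X {x})) (subtopology X V') snd"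
    using xV by (auto simp: continuous_map_in_subtopology intro: continuous_map_into_fulltopology[OF continuous_map_snd])
  note k = this
  have NL: "\<gamma>0 \<in> topspace ?L" "\<forall>\<gamma>\<in>topspace ?L. \<gamma> 1 \<in> {x}"
     "\<forall>y\<in>{x}. snd (0::real, y) = y" "\<forall>y\<in>{x}. snd (1::real, y) = \<gamma>0 1"
    using g0 \<gamma>0 by (auto simp: topspace_loop_space)
  have "good a"
    using a by (intro all_good) auto
  from extend[OF a(1,2) order_refl this V'(2) sub V'(3) openin_topspace NL(1,2) k NL(3,4)]
  obtain V G where VG: "openin ?L V" "\<gamma>0 \<in> V"
        "continuous_map (cylinder (cylinder (subtopology ?L V))) X G"
        "\<forall>t\<in>{0..1}. \<forall>\<gamma>\<in>V. G (0, (t, \<gamma>)) = \<gamma> t \<and> G (1, (t, \<gamma>)) = \<gamma>0 t"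
        "\<forall>s\<in>{0..1}. \<forall>\<gamma>\<in>V. G (s, (0, \<gamma>)) = x \<and> G (s, (1, \<gamma>)) = snd (min 1 (2 * s), \<gamma> 1)"
    by (elim exE conjE) (rule that)
  have VL: "V \<subseteq> topspace ?L"
    by (rule openin_subset[OF VG(1)])
  have "homotopic_rel_ends (subtopology ?L V) X (\<lambda>z. snd z (fst z)) (\<lambda>z. \<gamma>0 (fst z))"
    by (rule homotopic_rel_endsI[OF VG(3)]) (use VG(4,5) VL in \<open>auto simp: topspace_loop_space\<close>)
  then have "homotopic (subtopology ?L V) ?L (family (\<lambda>z. snd z (fst z))) (family (\<lambda>z. \<gamma>0 (fst z)))"
    by (rule homotopic_family) (auto simp: topspace_loop_space)
  moreover have "homotopic (subtopology ?L V) ?L id (family (\<lambda>z. snd z (fst z)))"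
  proof (rule homotopic_eq)
    fix \<gamma> assume "\<gamma> \<in> topspace (subtopology ?L V)"
    then show "id \<gamma> = family (\<lambda>z. snd z (fst z)) \<gamma>"
      using family_eval[of "\<lambda>y. y" \<gamma> X x] by simp
  qed simp
  moreover have "homotopic (subtopology ?L V) ?L (family (\<lambda>z. \<gamma>0 (fst z))) (\<lambda>_. \<gamma>0)"
    using homotopic_with_imp_continuous_maps[OF calculation(1)] g0
    by (intro homotopic_eq) (auto simp: family_def topspace_loop_space extensional_restrict)
  ultimately have "homotopic (subtopology ?L V) ?L id (\<lambda>_. \<gamma>0)"
    using homotopic_with_trans by blast
  then show ?thesis
    using VG unfolding semilocally_contractible_at_def by blast
qed

section \<open>Passage to spaces of CW homotopy type\<close>

lemma homotopic_pairing:
  assumes "homotopic T A a a'" "homotopic T B b b'"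
  shows "homotopic T (prod_topology A B) (\<lambda>x. (a x, b x)) (\<lambda>x. (a' x, b' x))"
proof -
  obtain H where H: "continuous_map (cylinder T) A H" "\<And>x. H (0, x) = a x" "\<And>x. H (1, x) = a' x"
    using homotopicE[OF assms(1)] by blast
  obtain K where K: "continuous_map (cylinder T) B K" "\<And>x. K (0, x) = b x" "\<And>x. K (1, x) = b' x"
    using homotopicE[OF assms(2)] by blast
  show ?thesis
    by (rule homotopicI[of _ _ "\<lambda>z. (H z, K z)"]) (simp_all add: H K continuous_map_pairedI)
qed

lemma has_CW_homotopy_typeE:
  assumes "has_CW_homotopy_type TYPE('c) X"
  obtains K :: "'c topology" and f g where "locally_contractible K" "continuous_map X K f" "continuous_map K X g"
    "homotopic X X (g \<circ> f) id"
  using assms CW_complex_locally_contractible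
  unfolding has_CW_homotopy_type_def homotopy_equivalent_space_def by metis

lemma CW_homotopy_type_semilocally_contractible:
  assumes "has_CW_homotopy_type TYPE('c) X" "x \<in> topspace X"
  shows "semilocally_contractible_at X x"
proof -
  obtain K :: "'c topology" and f g where K: "locally_contractible K" and f: "continuous_map X K f"
    and g: "continuous_map K X g" "homotopic X X (g \<circ> f) id"
    using has_CW_homotopy_typeE[OF assms(1)] by blast
  have "f x \<in> topspace K"
    using f assms(2) by (auto simp: continuous_map_def)
  then show ?thesis
    using semilocally_contractible_at_retract[OF f g assms(2)] locally_contractible_imp_semilocally[OF K] by blast
qed

text \<open>The loop space of \<open>X\<close> is a homotopy retract of that of the complex
  \<open>K\<close>, where local contractibility is available. Since \<open>g \<circ> f\<close> moves
  the base point, the map back is corrected by conjugation with the track of \<open>x\<close> under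
  \<open>H\<close>.\<close>

lemma CW_homotopy_type_loop_space_semilocally_contractible:
  assumes "has_CW_homotopy_type TYPE('c) X" and \<gamma>0: "\<gamma>0 \<in> topspace (loop_space X x)"
  shows "semilocally_contractible_at (loop_space X x) \<gamma>0"
proof -
  obtain K :: "'c topology" and f g where K: "locally_contractible K" and f: "continuous_map X K f"
    and g: "continuous_map K X g" "homotopic X X (g \<circ> f) id"
    using has_CW_homotopy_typeE[OF assms(1)] by blast
  obtain H where H: "continuous_map (cylinder X) X H" "\<And>y. H (0, y) = y" "\<And>y. H (1, y) = g (f y)"
    using homotopicE[OF homotopic_with_symD[OF g(2)]] unfolding comp_apply id_apply by blast
  have x: "x \<in> topspace X"
    using \<gamma>0 by (force simp: topspace_loop_space continuous_map_def)
  let ?L = "loop_space X x" and ?M = "loop_space K (f x)"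
  have idL: "continuous_map ?L ?L (\<lambda>y. y)" and idM: "continuous_map ?M ?M (\<lambda>y. y)"
    using continuous_map_id[unfolded id_def] by blast+
  note evL = continuous_map_loop_eval[OF idL] and evM = continuous_map_loop_eval[OF idM]
  have F: "continuous_map ?L ?M (loop_map f)"
    by (rule continuous_map_loop_map[OF f])
  define u where "u = (\<lambda>z :: real \<times> (real \<Rightarrow> 'c). if fst z \<le> 1/3 then (\<lambda>z. H (fst z, x)) (3 * fst z, snd z)
         else if fst z \<le> 2/3 then (\<lambda>z. g (snd z (fst z))) (3 * fst z - 1, snd z)
         else (\<lambda>z. H (1 - fst z, x)) (3 * fst z - 2, snd z))"
  have c1: "continuous_map (cylinder ?M) X (\<lambda>z. H (fst z, x))"
    using x by (intro continuous_map_pair_compose[OF H(1)] cm_coords) auto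
  have c2: "continuous_map (cylinder ?M) X (\<lambda>z. g (snd z (fst z)))"
    using continuous_map_compose[OF evM g(1)] by (simp add: o_def)
  have c3: "continuous_map (cylinder ?M) X (\<lambda>z. H (1 - fst z, x))"
    by (rule continuous_map_reverse[OF c1, simplified])
  have u: "continuous_map (cylinder ?M) X u"
    unfolding u_def by (rule continuous_map_three_pieces[OF c1 c2 c3]) (auto simp: H topspace_loop_space)
  have U: "continuous_map ?M ?L (family u)"
    by (rule continuous_map_family[OF u]) (simp add: u_def H)
  have S: "continuous_map (cylinder (cylinder ?L)) X (\<lambda>z. H (fst z, snd (snd z) (fst (snd z))))"
    using continuous_map_compose[OF continuous_map_snd evL, of I01] unfolding o_def
    by (intro continuous_map_pair_compose[OF H(1)] cm_coords)
  \<comment> \<open>The sides of the square \<open>H (s, \<gamma> t)\<close> are the track of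
    \<open>x\<close>, so the detour around it is exactly the conjugated loop.\<close>
  have "homotopic_rel_ends ?L X (\<lambda>z. snd z (fst z)) (\<lambda>z. u (fst z, loop_map f (snd z)))"
  proof (rule homotopic_rel_ends_trans[OF homotopic_rel_ends_detour[OF S, unfolded fst_conv snd_conv H(2)] homotopic_rel_ends_eq])
    show "continuous_map (cylinder ?L) X (\<lambda>z. if fst z \<le> 1/3 then H (3 * fst z, snd z 0)
        else if fst z \<le> 2/3 then H (1, snd z (3 * fst z - 1)) else H (3 - 3 * fst z, snd z 1))"
      by (rule homotopic_rel_ends_continuous(2)[OF homotopic_rel_ends_detour[OF S, unfolded fst_conv snd_conv]])
  qed (auto simp: u_def H loop_map_def topspace_loop_space)
  from homotopic_rel_ends_sym[OF this]
  have 1: "homotopic ?L ?L (family (\<lambda>z. u (fst z, loop_map f (snd z)))) (family (\<lambda>z. snd z (fst z)))"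
    by (rule homotopic_family) (simp add: u_def H)
  have 2: "family (\<lambda>z. u (fst z, loop_map f (snd z))) = family u \<circ> loop_map f"
    by (rule ext) (simp add: family_def)
  have 3: "homotopic ?L ?L id (family (\<lambda>z. snd z (fst z)))"
  proof (rule homotopic_eq)
    fix \<gamma> assume "\<gamma> \<in> topspace ?L"
    then show "id \<gamma> = family (\<lambda>z. snd z (fst z)) \<gamma>"
      using family_eval[of "\<lambda>y. y" \<gamma> X x] by simp
  qed simp
  have retract: "homotopic ?L ?L (family u \<circ> loop_map f) id"
    using homotopic_with_trans[OF 1 homotopic_with_symD[OF 3]] unfolding 2 .
  have "loop_map f \<gamma>0 \<in> topspace ?M"
    using F \<gamma>0 by (auto simp: continuous_map_def)
  then show ?thesis
    by (intro semilocally_contractible_at_retract[OF F U retract \<gamma>0] semilocally_contractible_loop_space[OF K])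
qed

section \<open>Projections of the limit\<close>

lemma bonding_self: "bonding f m m = id"
  by (cases m) auto

text \<open>The definition of \<open>bonding\<close> recurses on the upper index; this is the
  recursion on the lower one.\<close>

lemma bonding_Suc_left:
  "i < n \<Longrightarrow> f i (bonding f (Suc i) n y) = bonding f i n y"
proof (induction n arbitrary: y)
  case (Suc n)
  show ?case
  proof (cases "i = n")
    case True
    then show ?thesis
      by (simp add: bonding_self)
  qed (use Suc in auto)
qed simp

lemma bonding_limit:
  assumes "x \<in> topspace (inverse_limit Z z)" "i \<le> n"
  shows "bonding z i n (x n) = x i"
  using assms(2)
proof (induction n rule: dec_induct)
  case (step n)
  then show ?case
    using assms(1) by (simp add: topspace_inverse_limit)
qed (simp add: bonding_self)

lemma continuous_map_bonding:
  assumes "inverse_sequence Z z" "i \<le> n"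
  shows "continuous_map (Z n) (Z i) (bonding z i n)"
  using assms(2)
proof (induction n rule: dec_induct)
  case (step n)
  have "continuous_map (Z (Suc n)) (Z n) (z n)"
    using assms(1) by (simp add: inverse_sequence_def)
  from continuous_map_compose[OF this step.IH] show ?case
    using step.hyps by (simp add: o_def)
qed (simp add: bonding_self)

lemma bonding_loop_map:
  assumes "i \<le> n"
  shows "bonding (\<lambda>j. loop_map (z j)) i n (restrict g {0..1}) = restrict (\<lambda>t. bonding z i n (g t)) {0..1}"
  using assms
proof (induction n arbitrary: g rule: dec_induct)
  case (step n)
  have "loop_map (z n) (restrict g {0..1}) = restrict (\<lambda>t. z n (g t)) {0..1}"
    by (auto simp: loop_map_def)
  then show ?case
    by (simp only: bonding.simps if_P[OF step.hyps(1)] comp_apply step.IH)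
qed (simp only: bonding_self id_apply)

text \<open>Lifts are chosen successively in the coordinates above \<open>m\<close>, each over the
  one before; the coordinates below \<open>m\<close> are determined by the given homotopy.\<close>

lemma HLP_inverse_limit_projection:
  fixes X :: "'x topology"
  assumes Z: "inverse_sequence_of_fibrations Z z"
  shows "homotopy_lifting_property X (inverse_limit Z z) (Z m) (\<lambda>x. x m)"
  unfolding homotopy_lifting_property_def
proof (intro allI impI, elim conjE)
  fix h f assume h: "continuous_map (cylinder X) (Z m) h"
    and f: "continuous_map X (inverse_limit Z z) f" and hf: "\<forall>x\<in>topspace X. f x m = h (0, x)"
  have zc: "continuous_map (Z (Suc i)) (Z i) (z i)" and inv: "inverse_sequence Z z" for i
    using Z by (auto simp: inverse_sequence_of_fibrations_def inverse_sequence_def)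
  have lift: "homotopy_lifting_property X (Z (Suc i)) (Z i) (z i)" for i
    using Z by (intro Hurewicz_fibration_imp_HLP)
      (auto simp: inverse_sequence_of_fibrations_def inverse_sequence_def)
  have fi: "continuous_map X (Z i) (\<lambda>x. f x i)" for i
    using continuous_map_compose[OF f continuous_map_inverse_limit_coordinate] by (simp add: o_def)
  have fL: "f x \<in> topspace (inverse_limit Z z)" if "x \<in> topspace X" for x
    using f that by (auto simp: continuous_map_def)
  have "\<exists>H. \<forall>j. (continuous_map (cylinder X) (Z (m + j)) (H j) \<and>
      (\<forall>x\<in>topspace X. H j (0, x) = f x (m + j)) \<and> (j = 0 \<longrightarrow> H j = h)) \<and>
      (\<forall>t\<in>{0..1}. \<forall>x\<in>topspace X. z (m + j) (H (Suc j) (t, x)) = H j (t, x))"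
  proof (rule dependent_nat_choice)
    show "\<exists>H. continuous_map (cylinder X) (Z (m + 0)) H \<and>
      (\<forall>x\<in>topspace X. H (0, x) = f x (m + 0)) \<and> (0 = (0::nat) \<longrightarrow> H = h)"
      using h hf by auto
    fix H j assume H: "continuous_map (cylinder X) (Z (m + j)) H \<and>
      (\<forall>x\<in>topspace X. H (0, x) = f x (m + j)) \<and> (j = 0 \<longrightarrow> H = h)"
    have cH: "continuous_map (cylinder X) (Z (m + j)) H"
      using H by blast
    have 0: "z (m + j) (f x (Suc (m + j))) = H (0, x)" if "x \<in> topspace X" for x
      using H that fL[OF that] by (simp add: topspace_inverse_limit)
    obtain H' where "continuous_map (cylinder X) (Z (Suc (m + j))) H'"
      "\<And>x. x \<in> topspace X \<Longrightarrow> H' (0, x) = f x (Suc (m + j))"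
      "\<And>t x. t \<in> {0..1} \<Longrightarrow> x \<in> topspace X \<Longrightarrow> z (m + j) (H' (t, x)) = H (t, x)"
      using homotopy_lifting_propertyE[OF lift cH fi 0] by blast
    then show "\<exists>H'. (continuous_map (cylinder X) (Z (m + Suc j)) H' \<and>
      (\<forall>x\<in>topspace X. H' (0, x) = f x (m + Suc j)) \<and> (Suc j = 0 \<longrightarrow> H' = h)) \<and>
      (\<forall>t\<in>{0..1}. \<forall>x\<in>topspace X. z (m + j) (H' (t, x)) = H (t, x))"
      by (intro exI[of _ H']) auto
  qed
  then obtain H where H: "\<And>j. continuous_map (cylinder X) (Z (m + j)) (H j)"
    "\<And>j x. x \<in> topspace X \<Longrightarrow> H j (0, x) = f x (m + j)" "H 0 = h"
    "\<And>j t x. t \<in> {0..1} \<Longrightarrow> x \<in> topspace X \<Longrightarrow> z (m + j) (H (Suc j) (t, x)) = H j (t, x)"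
    by blast
  \<comment> \<open>\<open>max i m\<close> unites both cases: below \<open>m\<close> the coordinate
    is the image of \<open>H 0\<close>, and from \<open>m\<close> on \<open>bonding\<close> is the
    identity and the coordinate is the chosen lift.\<close>
  define L where "L = (\<lambda>p i. bonding z i (max i m) (H (max i m - m) p))"
  have L: "continuous_map (cylinder X) (inverse_limit Z z) L"
  proof (rule continuous_map_into_inverse_limit)
    fix i
    have "continuous_map (cylinder X) (Z (max i m)) (H (max i m - m))"
      using H(1)[of "max i m - m"] by simp
    from continuous_map_compose[OF this continuous_map_bonding[OF inv]]
    show "continuous_map (cylinder X) (Z i) (\<lambda>p. L p i)"
      by (simp add: L_def o_def)
  next
    fix p i assume p: "p \<in> topspace (cylinder X)"
    show "z i (L p (Suc i)) = L p i"
    proof (cases "m \<le> i")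
      case True
      then have "z i (H (Suc i - m) p) = H (i - m) p"
        using H(4)[of "fst p" "snd p" "i - m"] p by (auto simp: Suc_diff_le)
      then show ?thesis
        using True by (simp add: L_def bonding_self max_def)
    next
      case False
      then show ?thesis
        using bonding_Suc_left[of i m z] by (simp add: L_def max_def)
    qed
  qed
  show "\<exists>H. continuous_map (cylinder X) (inverse_limit Z z) H \<and>
      (\<forall>x\<in>topspace X. H (0, x) = f x) \<and> (\<forall>t\<in>{0..1}. \<forall>x\<in>topspace X. H (t, x) m = h (t, x))"
  proof (intro exI[of _ L] conjI ballI)
    show "L (0, x) = f x" if "x \<in> topspace X" for x
      using that bonding_limit[OF fL[OF that]] by (auto simp: L_def H(2))
    show "L (t, x) m = h (t, x)" for t x
      by (simp add: L_def H(3) bonding_self)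
  qed (rule L)
qed

text \<open>A basic neighbourhood in the product restricts finitely many coordinates, and a point of
  the limit with \<open>x n = \<zeta> n\<close> agrees with \<open>\<zeta>\<close> in all
  coordinates up to \<open>n\<close>.\<close>

lemma fibre_neighbourhood_basis:
  assumes \<zeta>: "\<zeta> \<in> U" and U: "openin (inverse_limit Z z) U"
  obtains m where "\<And>n x. m \<le> n \<Longrightarrow> x \<in> topspace (inverse_limit Z z) \<Longrightarrow> x n = \<zeta> n \<Longrightarrow> x \<in> U"
proof -
  obtain S where S: "openin (product_topology Z UNIV) S" "U = S \<inter> {x. \<forall>i. z i (x (Suc i)) = x i}"
    using U unfolding inverse_limit_def openin_subtopology by blast
  have \<zeta>L: "\<zeta> \<in> topspace (inverse_limit Z z)"
    using openin_subset[OF U] \<zeta> by blast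
  have "\<exists>V. finite {i \<in> UNIV. V i \<noteq> topspace (Z i)} \<and> (\<forall>i\<in>UNIV. openin (Z i) (V i)) \<and> \<zeta> \<in> PiE UNIV V \<and> PiE UNIV V \<subseteq> S"
    using S(1)[unfolded openin_product_topology_alt] \<zeta> S(2) by blast
  then obtain V where V: "finite {i. V i \<noteq> topspace (Z i)}" "\<zeta> \<in> PiE UNIV V" "PiE UNIV V \<subseteq> S"
    by auto
  obtain m where m: "\<And>i. V i \<noteq> topspace (Z i) \<Longrightarrow> i \<le> m"
    using V(1) finite_nat_set_iff_bounded_le by auto
  show thesis
  proof
    fix n x assume n: "m \<le> n" and x: "x \<in> topspace (inverse_limit Z z)" and eq: "x n = \<zeta> n"
    have "x i \<in> V i" for i
    proof (cases "V i = topspace (Z i)")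
      case True
      then show ?thesis
        using x by (simp add: topspace_inverse_limit)
    next
      case False
      then have "i \<le> n"
        using m n order_trans by blast
      then have "x i = \<zeta> i"
        using bonding_limit[OF x] bonding_limit[OF \<zeta>L] eq by metis
      then show ?thesis
        using V(2) by auto
    qed
    then show "x \<in> U"
      using V(3) x S(2) by (auto simp: topspace_inverse_limit)
  qed
qed

section \<open>Splitting of loop spaces\<close>

text \<open>The loop \<open>\<gamma>\<close> followed by the path \<open>n (_, y)\<close> from the
  base point to \<open>y\<close>, projected to \<open>B\<close>. The path in \<open>E\<close> does
  not depend on \<open>p\<close>; with projections of one limit in place of \<open>p\<close>, the
  resulting maps commute strictly with the bonding maps.\<close>

definition loop_product ::
    "('e \<Rightarrow> 'b) \<Rightarrow> (real \<times> 'e \<Rightarrow> 'e) \<Rightarrow> 'e \<times> (real \<Rightarrow> 'e) \<Rightarrow> real \<Rightarrow> 'b" where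
  "loop_product p n =
     family (\<lambda>(t, (y, \<gamma>)). p (if t \<le> 1/2 then \<gamma> (2 * t) else n (2 * t - 1, y)))"

text \<open>The nullhomotopy of the fibre \<open>F\<close> in \<open>E\<close> gives paths \<open>n (_, y)\<close> in \<open>E\<close> from the base point to
  the points \<open>y\<close> of \<open>F\<close>; their images in \<open>B\<close> are loops. The inverse lifts a loop in \<open>B\<close> to a path
  in \<open>E\<close>, which ends at some \<open>y\<close> in \<open>F\<close> and is closed up by the reverse of \<open>n (_, y)\<close>.\<close>

lemma loop_space_splitting:
  fixes E :: "'e topology" and B :: "'b topology"
  assumes p: "continuous_map E B p" and \<zeta>: "\<zeta> \<in> topspace E"
    and F_def: "F = subtopology E {y. p y = p \<zeta>}"
    and n: "continuous_map (cylinder F) E n"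
    and n0: "\<And>y. y \<in> topspace F \<Longrightarrow> n (0, y) = \<zeta>" and n1: "\<And>y. y \<in> topspace F \<Longrightarrow> n (1, y) = y"
    and lift1: "homotopy_lifting_property (loop_space B (p \<zeta>)) E B p"
    and lift2: "homotopy_lifting_property (cylinder (cylinder (prod_topology F (loop_space E \<zeta>)))) E B p"
  shows "homotopy_equivalence_map (prod_topology F (loop_space E \<zeta>)) (loop_space B (p \<zeta>)) (loop_product p n)"
proof -
  let ?LE = "loop_space E \<zeta>" and ?LB = "loop_space B (p \<zeta>)"
  let ?T = "prod_topology F ?LE"
  have F: "y \<in> topspace E" "p y = p \<zeta>" if "y \<in> topspace F" for y
    using that by (auto simp: F_def)
  define c where "c = (\<lambda>z. if fst z \<le> 1/2 then (\<lambda>z. snd (snd z) (fst z)) (2 * fst z, snd z)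
      else (\<lambda>z. n (fst z, fst (snd z))) (2 * fst z - 1, snd z))"
  have c: "continuous_map (cylinder ?T) E c"
    unfolding c_def
  proof (rule continuous_map_two_pieces)
    show "continuous_map (cylinder ?T) E (\<lambda>z. snd (snd z) (fst z))"
      by (rule continuous_map_loop_eval[OF continuous_map_snd])
    show "continuous_map (cylinder ?T) E (\<lambda>z. n (fst z, fst (snd z)))"
      by (intro continuous_map_pair_compose[OF n] cm_coords)
  qed (auto simp: n0 topspace_loop_space)
  have f_eq: "loop_product p n = family (\<lambda>z. p (c z))"
    unfolding loop_product_def by (rule arg_cong[of _ _ family]) (auto simp: c_def)
  have pc: "continuous_map (cylinder ?T) B (\<lambda>z. p (c z))"
    using continuous_map_compose[OF c p] by (simp add: o_def)
  have c_ends: "c (0, x) = \<zeta>" "c (1, x) = fst x" if "x \<in> topspace ?T" for x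
    using that by (auto simp: c_def n1 topspace_loop_space)
  have f: "continuous_map ?T ?LB (loop_product p n)"
    unfolding f_eq by (rule continuous_map_family[OF pc]) (auto simp: c_ends F)
  have f_in: "loop_product p n x \<in> topspace ?LB" if "x \<in> topspace ?T" for x
    using continuous_map_image_subset_topspace[OF f] that by blast
  have idB: "continuous_map ?LB ?LB (\<lambda>y. y)" and idE: "continuous_map ?LE ?LE (\<lambda>y. y)"
    using continuous_map_id[unfolded id_def] by blast+
  note evB = continuous_map_loop_eval[OF idB]
  have cz: "continuous_map ?LB E (\<lambda>_. \<zeta>)"
    using \<zeta> by simp
  have "p \<zeta> = snd (0, \<omega>) (fst (0, \<omega>))" if "\<omega> \<in> topspace ?LB" for \<omega>
    using that by (simp add: topspace_loop_space)
  from homotopy_lifting_propertyE[OF lift1 evB cz this]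
  obtain L where L: "continuous_map (cylinder ?LB) E L"
    "\<And>\<omega>. \<omega> \<in> topspace ?LB \<Longrightarrow> L (0, \<omega>) = \<zeta>"
    "\<And>t \<omega>. t \<in> {0..1} \<Longrightarrow> \<omega> \<in> topspace ?LB \<Longrightarrow> p (L (t, \<omega>)) = \<omega> t"
    by auto
  define e where "e = (\<lambda>\<omega>. L (1, \<omega>))"
  then have L1: "L (1, \<omega>) = e \<omega>" for \<omega>
    by simp
  have "continuous_map ?LB E e"
    unfolding e_def by (intro continuous_map_pair_compose[OF L(1)] idB) auto
  then have e: "continuous_map ?LB F e"
    using L(3)[of 1] by (auto simp: F_def continuous_map_in_subtopology e_def topspace_loop_space)
  have eF: "e \<omega> \<in> topspace F" if "\<omega> \<in> topspace ?LB" for \<omega>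
    using continuous_map_image_subset_topspace[OF e] that by blast
  define d where "d = (\<lambda>z. if fst z \<le> 1/2 then L (2 * fst z, snd z)
      else (\<lambda>z. n (1 - fst z, e (snd z))) (2 * fst z - 1, snd z))"
  have ne: "continuous_map (cylinder ?LB) E (\<lambda>z. n (fst z, e (snd z)))"
    using continuous_map_compose[OF continuous_map_snd e, of I01] unfolding o_def
    by (intro continuous_map_pair_compose[OF n] cm_coords)
  have d: "continuous_map (cylinder ?LB) E d"
    unfolding d_def
    by (rule continuous_map_two_pieces[OF L(1) continuous_map_reverse[OF ne, simplified]]) (simp add: n1 eF L1)
  have fd: "continuous_map ?LB ?LE (family d)"
    by (rule continuous_map_family[OF d]) (simp add: d_def L(2) n0 eF)
  define g where "g = (\<lambda>\<omega>. (e \<omega>, family d \<omega>))"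
  have g: "continuous_map ?LB ?T g"
    unfolding g_def by (intro continuous_map_pairedI e fd)
  \<comment> \<open>Runs to 1 at double speed and then back to 1/2. Along \<open>d\<close> this is a
    lifted path, then \<open>n\<close> backwards and forwards again; along \<open>c\<close> it is a
    loop, then \<open>n\<close> forwards and backwards. In both cases it contracts to the first
    half, run through by \<open>t/2\<close>.\<close>
  define \<phi> where "\<phi> = (\<lambda>t::real. min (2 * t) (3/2 - t))"
  have \<phi>: "continuous_on {0..1} \<phi>" "\<phi> ` {0..1} \<subseteq> {0..1}" "\<phi> 0 = 0" "\<phi> 1 = 1/2"
    unfolding \<phi>_def by (intro continuous_intros) auto
  have \<phi>_le: "\<phi> t = 2 * t" if "t \<le> 1/2" for t
    using that by (simp add: \<phi>_def)
  have \<phi>_ge: "\<phi> t = 3/2 - t" if "1/2 < t" for t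
    using that by (simp add: \<phi>_def)
  have half: "continuous_on {0..1} (\<lambda>t::real. t/2)" "(\<lambda>t::real. t/2) ` {0..1} \<subseteq> {0..1}"
    by (auto intro!: continuous_intros)
  have fg: "homotopic ?LB ?LB (loop_product p n \<circ> g) id"
  proof -
    have pd: "continuous_map (cylinder ?LB) B (\<lambda>z. p (d z))"
      using continuous_map_compose[OF d p] by (simp add: o_def)
    have "homotopic_rel_ends ?LB B (\<lambda>z. p (c (fst z, g (snd z)))) (\<lambda>z. snd z (fst z))"
    proof (rule homotopic_rel_ends_reparam[OF pd \<phi>(1) half(1) \<phi>(2) half(2)])
      fix t \<omega> assume t: "t \<in> {0..1::real}" and \<omega>: "\<omega> \<in> topspace ?LB"
      have "c (t, g \<omega>) = d (\<phi> t, \<omega>)"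
      proof (cases "t \<le> 1/2")
        case True
        then show ?thesis
          using t by (simp add: \<phi>_le c_def g_def family_def)
      next
        case False
        show ?thesis
        proof (cases "t = 1")
          case True
          then show ?thesis
            using \<omega> by (simp add: \<phi> c_def d_def g_def n1 eF L1)
        next
          case False
          then have "\<not> 3/2 - t \<le> 1/2"
            using t by auto
          then show ?thesis
            using \<open>\<not> t \<le> 1/2\<close> by (simp add: \<phi>_ge c_def d_def g_def algebra_simps)
        qed
      qed
      then show "p (c (fst (t, \<omega>), g (snd (t, \<omega>)))) = p (d (\<phi> t, \<omega>))"
        by simp
      show "snd (t, \<omega>) (fst (t, \<omega>)) = p (d (t/2, \<omega>))"
        using t \<omega> by (simp add: d_def L(3))
    qed (simp_all add: \<phi>)
    then have 1: "homotopic ?LB ?LB (family (\<lambda>z. p (c (fst z, g (snd z))))) (family (\<lambda>z. snd z (fst z)))"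
    proof (rule homotopic_family)
      fix \<omega> assume "\<omega> \<in> topspace ?LB"
      then have "g \<omega> \<in> topspace ?T"
        using continuous_map_image_subset_topspace[OF g] by blast
      then show "p (c (fst (0, \<omega>), g (snd (0, \<omega>)))) = p \<zeta> \<and> p (c (fst (1, \<omega>), g (snd (1, \<omega>)))) = p \<zeta>"
        using F(2) by (auto simp: c_ends)
    qed
    have 2: "family (\<lambda>z. p (c (fst z, g (snd z)))) = loop_product p n \<circ> g"
      unfolding f_eq by (rule ext) (simp add: family_def)
    have 3: "homotopic ?LB ?LB id (family (\<lambda>z. snd z (fst z)))"
    proof (rule homotopic_eq)
      fix \<omega> assume "\<omega> \<in> topspace ?LB"
      then show "id \<omega> = family (\<lambda>z. snd z (fst z)) \<omega>"
        using family_eval[of "\<lambda>y. y" \<omega> B "p \<zeta>"] by simp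
    qed simp
    show ?thesis
      using homotopic_with_trans[OF 1 homotopic_with_symD[OF 3]] unfolding 2 .
  qed
  have gf: "homotopic ?T ?T (g \<circ> loop_product p n) id"
  proof -
    have Lf: "continuous_map (cylinder ?T) E (\<lambda>z. L (fst z, loop_product p n (snd z)))"
      using continuous_map_compose[OF continuous_map_snd f, of I01] unfolding o_def
      by (intro continuous_map_pair_compose[OF L(1)] cm_coords)
    have G: "continuous_map (cylinder (cylinder ?T)) B (\<lambda>z. p (c (fst z, snd (snd z))))"
      using continuous_map_pair_compose[OF pc, of "cylinder (cylinder ?T)" fst "\<lambda>z. snd (snd z)"]
      by (simp add: cm_coords)
    have z0: "continuous_map (cylinder ?T) E (\<lambda>_. \<zeta>)"
      using \<zeta> by simp
    \<comment> \<open>\<open>c (_, x)\<close> and the chosen lift of its projection lie over the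
      same loop and start at \<open>\<zeta>\<close>. In \<open>K\<close> the coordinate
      \<open>s\<close> runs along the paths and \<open>t\<close> leads from \<open>c\<close> to
      \<open>L\<close>; the ends at \<open>s = 1\<close> trace a path \<open>\<epsilon>\<close> in
      the fibre.\<close>
    obtain K where K: "continuous_map (cylinder (cylinder ?T)) E K"
      "\<And>s t x. s \<in> {0..1} \<Longrightarrow> t \<in> {0..1} \<Longrightarrow> x \<in> topspace ?T \<Longrightarrow> p (K (s, (t, x))) = (\<lambda>z. p (c (fst z, snd (snd z)))) (s, (t, x))"
      "\<And>t x. t \<in> {0..1} \<Longrightarrow> x \<in> topspace ?T \<Longrightarrow> K (0, (t, x)) = (\<lambda>_. \<zeta>) (t, x)"
      "\<And>s x. s \<in> {0..1} \<Longrightarrow> x \<in> topspace ?T \<Longrightarrow> K (s, (0, x)) = c (s, x)"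
      "\<And>s x. s \<in> {0..1} \<Longrightarrow> x \<in> topspace ?T \<Longrightarrow> K (s, (1, x)) = (\<lambda>z. L (fst z, loop_product p n (snd z))) (s, x)"
    proof (rule HLP_square[OF lift2 G z0 c Lf])
      fix s x assume s: "s \<in> {0..1::real}" and x: "x \<in> topspace ?T"
      show "p ((\<lambda>z. L (fst z, loop_product p n (snd z))) (s, x)) = p (c (fst (s, (1, x)), snd (snd (s, (1::real, x)))))"
        using L(3)[OF s f_in[OF x]] s by (simp add: f_eq family_def)
    next
      fix x assume x: "x \<in> topspace ?T"
      show "L (fst (0, x), loop_product p n (snd (0, x))) = \<zeta>"
        using L(2)[OF f_in[OF x]] by simp
    qed (auto simp: c_ends)
    define \<epsilon> where "\<epsilon> = (\<lambda>z. K (1, z))"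
    then have K1: "K (1, z) = \<epsilon> z" for z
      by simp
    have "continuous_map (cylinder ?T) E \<epsilon>"
      unfolding \<epsilon>_def by (intro continuous_map_pair_compose[OF K(1)] continuous_map_id[unfolded id_def]) auto
    moreover have "p (\<epsilon> (t, x)) = p \<zeta>" if "t \<in> {0..1}" "x \<in> topspace ?T" for t x
      using K(2)[OF _ that, of 1] that(2) F(2) by (auto simp: \<epsilon>_def c_ends)
    ultimately have \<epsilon>: "continuous_map (cylinder ?T) F \<epsilon>"
      unfolding F_def by (auto simp: continuous_map_in_subtopology)
    have \<epsilon>F: "\<epsilon> z \<in> topspace F" if "z \<in> topspace (cylinder ?T)" for z
      using continuous_map_image_subset_topspace[OF \<epsilon>] that by blast
    \<comment> \<open>Each intermediate path is closed up by \<open>n\<close> reversed, starting at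
      its own end in the fibre, so that the deformation runs through loops.\<close>
    define dd where "dd = (\<lambda>z. if fst z \<le> 1/2 then K (2 * fst z, snd z)
      else (\<lambda>z. n (1 - fst z, \<epsilon> (snd z))) (2 * fst z - 1, snd z))"
    have n\<epsilon>: "continuous_map (cylinder (cylinder ?T)) E (\<lambda>z. n (fst z, \<epsilon> (snd z)))"
      using continuous_map_compose[OF continuous_map_snd \<epsilon>, of I01] unfolding o_def
      by (intro continuous_map_pair_compose[OF n] cm_coords)
    have dd: "continuous_map (cylinder (cylinder ?T)) E dd"
      unfolding dd_def
      by (rule continuous_map_two_pieces[OF K(1) continuous_map_reverse[OF n\<epsilon>, simplified]])
        (use n1 \<epsilon>F in \<open>auto simp: K1\<close>)
    have fdd: "continuous_map (cylinder ?T) ?LE (family dd)"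
    proof (rule continuous_map_family[OF dd])
      fix z assume z: "z \<in> topspace (cylinder ?T)"
      then show "dd (0, z) = \<zeta> \<and> dd (1, z) = \<zeta>"
        using K(3)[of "fst z" "snd z"] n0[OF \<epsilon>F[OF z]] by (auto simp: dd_def)
    qed
    define d0 where "d0 = (\<lambda>z. dd (fst z, (0, snd z)))"
    have "homotopic ?T ?T (\<lambda>x. (fst x, family d0 x)) (g \<circ> loop_product p n)"
    proof (rule homotopicI)
      show "continuous_map (cylinder ?T) ?T (\<lambda>z. (\<epsilon> z, family dd z))"
        by (intro continuous_map_pairedI \<epsilon> fdd)
      fix x assume x: "x \<in> topspace ?T"
      show "(\<epsilon> (0, x), family dd (0, x)) = (fst x, family d0 x)"
        using K(4)[of 1 x] x by (simp add: \<epsilon>_def c_ends family_def d0_def)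
      have "\<epsilon> (1, x) = e (loop_product p n x)"
        using K(5)[of 1 x] x by (simp add: \<epsilon>_def e_def)
      moreover have "dd (t, (1, x)) = d (t, loop_product p n x)" if "t \<in> {0..1}" for t
        using K(5)[of "2 * t" x] x that calculation by (auto simp: dd_def d_def)
      then have "family dd (1, x) = family d (loop_product p n x)"
        by (auto simp: family_def restrict_def)
      ultimately show "(\<epsilon> (1, x), family dd (1, x)) = (g \<circ> loop_product p n) x"
        by (simp add: g_def)
    qed
    moreover have "homotopic ?T ?T (\<lambda>x. (fst x, family d0 x)) (\<lambda>x. (fst x, snd x))"
    proof (rule homotopic_pairing)
      show "homotopic ?T F fst fst"
        by (simp add: continuous_map_fst)
      have "homotopic_rel_ends ?T E d0 (\<lambda>z. snd (snd z) (fst z))"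
      proof (rule homotopic_rel_ends_reparam[OF c \<phi>(1) half(1) \<phi>(2) half(2)])
        fix t x assume t: "t \<in> {0..1::real}" and x: "x \<in> topspace ?T"
        have y: "fst x \<in> topspace F" "snd x 1 = \<zeta>"
          using x by (auto simp: topspace_loop_space)
        have e0: "\<epsilon> (0, x) = fst x"
          using K(4)[of 1 x] x by (simp add: \<epsilon>_def c_ends)
        show "d0 (t, x) = c (\<phi> t, x)"
        proof (cases "t \<le> 1/2")
          case True
          then show ?thesis
            using t x K(4)[of "2 * t" x] by (simp add: d0_def dd_def \<phi>_le)
        next
          case False
          show ?thesis
          proof (cases "t = 1")
            case True
            then show ?thesis
              using y by (simp add: d0_def dd_def \<phi> c_def e0 n0)
          next
            case False
            then have "\<not> 3/2 - t \<le> 1/2"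
              using t by auto
            then show ?thesis
              using \<open>\<not> t \<le> 1/2\<close> by (simp add: \<phi>_ge d0_def dd_def c_def e0 algebra_simps)
          qed
        qed
        show "snd (snd (t, x)) (fst (t, x)) = c (t/2, x)"
          using t by (simp add: c_def)
      qed (simp_all add: \<phi>)
      then have 1: "homotopic ?T ?LE (family d0) (family (\<lambda>z. snd (snd z) (fst z)))"
      proof (rule homotopic_family)
        fix x assume x: "x \<in> topspace ?T"
        have "\<epsilon> (0, x) = fst x" "fst x \<in> topspace F"
          using K(4)[of 1 x] x by (auto simp: \<epsilon>_def c_ends)
        then show "d0 (0, x) = \<zeta> \<and> d0 (1, x) = \<zeta>"
          using K(3)[of 0 x] x by (simp add: d0_def dd_def n0)
      qed
      have "homotopic ?T ?LE snd (family (\<lambda>z. snd (snd z) (fst z)))"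
      proof (rule homotopic_eq)
        fix x assume "x \<in> topspace ?T"
        then show "snd x = family (\<lambda>z. snd (snd z) (fst z)) x"
          using family_eval[of snd x E \<zeta>] by auto
      qed (rule continuous_map_snd)
      from homotopic_with_trans[OF 1 homotopic_with_symD[OF this]]
      show "homotopic ?T ?LE (family d0) snd" .
    qed
    ultimately have "homotopic ?T ?T (g \<circ> loop_product p n) (\<lambda>x. (fst x, snd x))"
      using homotopic_with_trans homotopic_with_symD by blast
    then show ?thesis
      by (simp add: id_def)
  qed
  show ?thesis
    unfolding homotopy_equivalence_map_def using f g fg gf by blast
qed

lemma loop_tower_splitting:
  fixes Z :: "nat \<Rightarrow> 'z topology" and z :: "nat \<Rightarrow> 'z \<Rightarrow> 'z"
  assumes Z: "inverse_sequence_of_fibrations Z z"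
    and CW: "\<And>i. has_CW_homotopy_type TYPE('d) (Z i)"
    and CWlim: "has_CW_homotopy_type TYPE('e) (inverse_limit Z z)"
    and \<zeta>: "\<zeta> \<in> topspace (inverse_limit Z z)"
  shows "\<exists>(k :: nat \<Rightarrow> nat) (R :: nat \<Rightarrow> (nat \<Rightarrow> 'z) topology) r.
           strict_mono k \<and> inverse_sequence R r \<and>
           (\<forall>i. nullhomotopic_map (R (Suc i)) (R i) (r i)) \<and>
           splits_as_product
             (\<lambda>i. loop_space (Z (k i)) (\<zeta> (k i)))
             (\<lambda>i. bonding (\<lambda>j. loop_map (z j)) (k i) (k (Suc i)))
             R r
             (\<lambda>_. loop_space (inverse_limit Z z) \<zeta>) (\<lambda>_. id)"
proof -
  let ?E = "inverse_limit Z z"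
  let ?LE = "loop_space ?E \<zeta>"
  have hE: "Hausdorff_space ?E"
    using Z by (intro Hausdorff_space_inverse_limit) (simp add: inverse_sequence_of_fibrations_def inverse_sequence_def)
  have lift: "homotopy_lifting_property X ?E (Z i) (\<lambda>x. x i)" for X :: "'x topology" and i
    by (rule HLP_inverse_limit_projection[OF Z])
  define F where "F = (\<lambda>i. subtopology ?E {x. x i = \<zeta> i})"
  have topF: "x \<in> topspace (F i) \<longleftrightarrow> x \<in> topspace ?E \<and> x i = \<zeta> i" for x i
    by (auto simp: F_def)
  have F_mono: "x \<in> topspace (F j) \<Longrightarrow> x \<in> topspace (F i)" if "i \<le> j" for x i j
    using bonding_limit[OF _ that, of x Z z] bonding_limit[OF \<zeta> that] unfolding topF by metis
  have \<zeta>F: "\<zeta> \<in> topspace (F i)" for i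
    using \<zeta> by (simp add: topF)
  have F_incl: "continuous_map (F j) (F i) id" if "i \<le> j" for i j
  proof -
    have "continuous_map (F j) ?E id"
      by (simp add: F_def)
    moreover have "id \<in> topspace (F j) \<rightarrow> {x. x i = \<zeta> i}"
      using F_mono[OF that] topF by auto
    ultimately have "continuous_map (F j) (subtopology ?E {x. x i = \<zeta> i}) id"
      by (simp only: continuous_map_in_subtopology)
    then show ?thesis
      by (simp only: F_def)
  qed
  obtain U where U: "openin ?E U" "\<zeta> \<in> U" "homotopic (subtopology ?E U) ?E id (\<lambda>_. \<zeta>)"
    using CW_homotopy_type_semilocally_contractible[OF CWlim \<zeta>] unfolding semilocally_contractible_at_def by blast
  obtain m where m: "\<And>n x. m \<le> n \<Longrightarrow> x \<in> topspace ?E \<Longrightarrow> x n = \<zeta> n \<Longrightarrow> x \<in> U"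
    using fibre_neighbourhood_basis[OF U(2,1)] by blast
  obtain n where n: "continuous_map (cylinder (subtopology ?E U)) ?E n" "\<And>y. n (0, y) = \<zeta>" "\<And>y. n (1, y) = y"
    using homotopicE[OF homotopic_with_symD[OF U(3)]] unfolding id_apply by blast
  have nF: "continuous_map (cylinder (F i)) ?E n" if "m \<le> i" for i
  proof -
    have "continuous_map (F i) (subtopology ?E U) (\<lambda>x. x)"
      using m[OF that] by (auto simp: F_def continuous_map_in_subtopology)
    from continuous_map_pair_compose[OF n(1) cm_coords(1) continuous_map_compose[OF cm_coords(2) this]]
    show ?thesis
      by (simp add: o_def)
  qed
  define f where "f = (\<lambda>i :: nat. loop_product (\<lambda>x. x i) n)"
  have heq: "homotopy_equivalence_map (prod_topology (F i) ?LE) (loop_space (Z i) (\<zeta> i)) (f i)" if "m \<le> i" for i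
    unfolding f_def
    by (rule loop_space_splitting[OF continuous_map_inverse_limit_coordinate \<zeta> F_def[THEN fun_cong] nF[OF that] n(2,3) lift lift])
  have kappa: "restrict (\<lambda>_. \<zeta>) {0..1} \<in> topspace ?LE"
  proof -
    have "continuous_map I01 ?E (restrict (\<lambda>_. \<zeta>) {0..1})"
      by (rule continuous_map_eq[of _ _ "\<lambda>_. \<zeta>"]) (use \<zeta> in auto)
    then show ?thesis
      by (simp add: topspace_loop_space)
  qed
  have slcF: "semilocally_contractible_at (F i) \<zeta>" if i: "m \<le> i" for i
  proof -
    obtain g where f: "continuous_map (prod_topology (F i) ?LE) (loop_space (Z i) (\<zeta> i)) (f i)"
      and g: "continuous_map (loop_space (Z i) (\<zeta> i)) (prod_topology (F i) ?LE) g"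
      and gf: "homotopic (prod_topology (F i) ?LE) (prod_topology (F i) ?LE) (g \<circ> f i) id"
      using heq[OF i] unfolding homotopy_equivalence_map_def by blast
    \<comment> \<open>Pairing with the constant loop is a section of the projection to
      \<open>F i\<close>; it makes the fibre a homotopy retract of the loop space of
      \<open>Z i\<close>.\<close>
    define \<iota> where "\<iota> = (\<lambda>y :: nat \<Rightarrow> 'z. (y, restrict (\<lambda>_. \<zeta>) {0..1::real}))"
    have \<iota>: "continuous_map (F i) (prod_topology (F i) ?LE) \<iota>"
      unfolding \<iota>_def using kappa by (intro continuous_map_pairedI) auto
    have f\<iota>: "continuous_map (F i) (loop_space (Z i) (\<zeta> i)) (f i \<circ> \<iota>)"
      by (rule continuous_map_compose[OF \<iota> f])
    have "homotopic (F i) (F i) (fst \<circ> (g \<circ> f i) \<circ> \<iota>) (fst \<circ> id \<circ> \<iota>)"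
      by (rule homotopic_comp_both[OF gf \<iota> continuous_map_fst])
    then have retract: "homotopic (F i) (F i) (fst \<circ> g \<circ> (f i \<circ> \<iota>)) id"
      by (simp add: o_def \<iota>_def id_def)
    have "(f i \<circ> \<iota>) \<zeta> \<in> topspace (loop_space (Z i) (\<zeta> i))"
      using continuous_map_image_subset_topspace[OF f\<iota>] \<zeta>F by blast
    then show ?thesis
      by (intro semilocally_contractible_at_retract[OF f\<iota> continuous_map_compose[OF g continuous_map_fst] retract \<zeta>F]
          CW_homotopy_type_loop_space_semilocally_contractible[OF CW])
  qed
  have "\<exists>k. \<forall>i. m \<le> k i \<and> (k i < k (Suc i) \<and> nullhomotopic_map (F (k (Suc i))) (F (k i)) id)"
  proof (rule dependent_nat_choice)
    show "\<exists>i. m \<le> i"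
      by blast
    fix i and j :: nat assume i: "m \<le> i"
    obtain V where V: "openin (F i) V" "\<zeta> \<in> V" "homotopic (subtopology (F i) V) (F i) id (\<lambda>_. \<zeta>)"
      using slcF[OF i] unfolding semilocally_contractible_at_def by blast
    obtain V' where V': "openin ?E V'" "V = V' \<inter> {x. x i = \<zeta> i}"
      using V(1) unfolding F_def openin_subtopology by blast
    have "\<zeta> \<in> V'"
      using V(2) V'(2) by blast
    then obtain l where l: "\<And>n x. l \<le> n \<Longrightarrow> x \<in> topspace ?E \<Longrightarrow> x n = \<zeta> n \<Longrightarrow> x \<in> V'"
      using fibre_neighbourhood_basis[OF _ V'(1)] by blast
    \<comment> \<open>\<open>l\<close> brings the fibre into the contractible set \<open>V\<close>,
      and \<open>Suc i\<close> makes the sequence of indices strictly increasing.\<close>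
    define i' where "i' = max l (Suc i)"
    have "x \<in> V" if "x \<in> topspace (F i')" for x
      using l[of i' x] that F_mono[of i i' x] by (auto simp: i'_def topF V'(2))
    then have "continuous_map (F i') (subtopology (F i) V) id"
      using F_incl[of i i'] by (auto simp: i'_def continuous_map_in_subtopology)
    from homotopic_comp_right[OF V(3) this] have "homotopic (F i') (F i) id (\<lambda>_. \<zeta>)"
      by (simp add: o_def id_def)
    then have "nullhomotopic_map (F i') (F i) id"
      using \<zeta>F unfolding nullhomotopic_map_def by blast
    then show "\<exists>i'. m \<le> i' \<and> (i < i' \<and> nullhomotopic_map (F i') (F i) id)"
      using i by (intro exI[of _ i']) (auto simp: i'_def)
  qed
  then obtain k where k: "\<And>i. m \<le> k i" "\<And>i. k i < k (Suc i)" "\<And>i. nullhomotopic_map (F (k (Suc i))) (F (k i)) id"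
    by blast
  have "inverse_sequence (\<lambda>i. F (k i)) (\<lambda>_. id)"
    using F_incl[OF less_imp_le[OF k(2)]] hE by (simp add: inverse_sequence_def F_def Hausdorff_space_subtopology)
  moreover have "splits_as_product
             (\<lambda>i. loop_space (Z (k i)) (\<zeta> (k i)))
             (\<lambda>i. bonding (\<lambda>j. loop_map (z j)) (k i) (k (Suc i)))
             (\<lambda>i. F (k i)) (\<lambda>_. id) (\<lambda>_. ?LE) (\<lambda>_. id)"
    unfolding splits_as_product_def
  proof (intro exI[of _ "\<lambda>i. f (k i)"] allI conjI)
    fix i
    let ?b = "bonding (\<lambda>j. loop_map (z j)) (k i) (k (Suc i))"
    show "homotopy_equivalence_map (prod_topology (F (k i)) ?LE) (loop_space (Z (k i)) (\<zeta> (k i))) (f (k i))"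
      by (rule heq[OF k(1)])
    have le: "k i \<le> k (Suc i)"
      using k(2) by (rule less_imp_le)
    have incl: "continuous_map (prod_topology (F (k (Suc i))) ?LE) (prod_topology (F (k i)) ?LE) (map_prod id id)"
      using continuous_map_pairedI[OF continuous_map_compose[OF continuous_map_fst F_incl[OF le]] continuous_map_snd[of _ ?LE]]
      by (simp add: map_prod.id o_def id_def)
    have "continuous_map (prod_topology (F (k i)) ?LE) (loop_space (Z (k i)) (\<zeta> (k i))) (f (k i))"
      using heq[OF k(1)] unfolding homotopy_equivalence_map_def by blast
    from continuous_map_compose[OF incl this]
    have "homotopic (prod_topology (F (k (Suc i))) ?LE) (loop_space (Z (k i)) (\<zeta> (k i)))
            (f (k i) \<circ> map_prod id id) (?b \<circ> f (k (Suc i)))"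
    proof (rule homotopic_eq)
      fix x assume x: "x \<in> topspace (prod_topology (F (k (Suc i))) ?LE)"
      obtain y \<gamma> where [simp]: "x = (y, \<gamma>)"
        by (cases x)
      have y: "y \<in> topspace (F (k (Suc i)))" and \<gamma>: "\<gamma> \<in> topspace ?LE"
        using x by auto
      \<comment> \<open>This path in the limit is the same for all indices, and \<open>f j x\<close>
        is its coordinate \<open>j\<close>; so the square commutes exactly.\<close>
      define c where "c = (\<lambda>t. if t \<le> 1/2 then \<gamma> (2 * t) else n (2 * t - 1, y))"
      have c: "c t \<in> topspace ?E" if t: "t \<in> {0..1}" for t
      proof (cases "t \<le> 1/2")
        case True
        then show ?thesis
          using \<gamma> t by (auto simp: c_def topspace_loop_space continuous_map_def)
      next
        case False
        have "(2 * t - 1, y) \<in> topspace (cylinder (F (k (Suc i))))"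
          using y t False by auto
        then show ?thesis
          using nF[OF k(1)] False unfolding c_def by (fastforce simp: continuous_map_def)
      qed
      have f_c: "f j x = restrict (\<lambda>t. c t j) {0..1}" for j
        by (simp add: f_def loop_product_def family_def c_def)
      have "?b (f (k (Suc i)) x) = restrict (\<lambda>t. bonding z (k i) (k (Suc i)) (c t (k (Suc i)))) {0..1}"
        unfolding f_c by (rule bonding_loop_map[OF le])
      also have "\<dots> = restrict (\<lambda>t. c t (k i)) {0..1}"
        using bonding_limit[OF c le] by (intro restrict_ext) auto
      finally show "(f (k i) \<circ> map_prod id id) x = (?b \<circ> f (k (Suc i))) x"
        by (simp add: f_c[symmetric])
    qed
    then show "homotopic (prod_topology (F (k (Suc i))) ?LE) (loop_space (Z (k i)) (\<zeta> (k i)))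
            (?b \<circ> f (k (Suc i))) (f (k i) \<circ> map_prod id id)"
      by (rule homotopic_with_symD)
  qed
  ultimately show ?thesis
    using k(2,3) by (intro exI[of _ k] exI[of _ "\<lambda>i. F (k i)"] exI[of _ "\<lambda>_. id"]) (auto simp: strict_mono_Suc_iff)
qed

theorem theorem1p2p6:
  fixes W :: "nat \<Rightarrow> 'w topology" and w :: "nat \<Rightarrow> 'w \<Rightarrow> 'w"
    and P :: "nat \<Rightarrow> 'p topology" and p :: "nat \<Rightarrow> 'p \<Rightarrow> 'p"
    and Q :: "nat \<Rightarrow> 'q topology" and q :: "nat \<Rightarrow> 'q \<Rightarrow> 'q"
    and Z :: "nat \<Rightarrow> 'z topology" and z :: "nat \<Rightarrow> 'z \<Rightarrow> 'z"
  shows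
    "(inverse_sequence_of_fibrations W w \<and> inverse_sequence P p \<and> inverse_sequence Q q \<and>
      splits_as_product W w P p Q q \<and>
      (\<forall>i. nullhomotopic_map (P (Suc i)) (P i) (p i)) \<and>
      (\<forall>i. homotopy_equivalence_map (Q (Suc i)) (Q i) (q i))
      \<longrightarrow>
      inverse_limit W w homotopy_equivalent_space Q 0 \<and>
      (has_CW_homotopy_type TYPE('c) (Q 0) \<longrightarrow>
       has_CW_homotopy_type TYPE('c) (inverse_limit W w)))
     \<and>
     (inverse_sequence_of_fibrations Z z \<and>
      (\<forall>i. has_CW_homotopy_type TYPE('d) (Z i)) \<and>
      has_CW_homotopy_type TYPE('e) (inverse_limit Z z)
      \<longrightarrow>
      (\<forall>\<zeta> \<in> topspace (inverse_limit Z z).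
         \<exists>(k :: nat \<Rightarrow> nat) (R :: nat \<Rightarrow> (nat \<Rightarrow> 'z) topology) r.
           strict_mono k \<and> inverse_sequence R r \<and>
           (\<forall>i. nullhomotopic_map (R (Suc i)) (R i) (r i)) \<and>
           splits_as_product
             (\<lambda>i. loop_space (Z (k i)) (\<zeta> (k i)))
             (\<lambda>i. bonding (\<lambda>j. loop_map (z j)) (k i) (k (Suc i)))
             R r
             (\<lambda>_. loop_space (inverse_limit Z z) \<zeta>) (\<lambda>_. id)))"
proof (intro conjI impI ballI; elim conjE)
  assume *: "inverse_sequence_of_fibrations W w" "inverse_sequence P p" "inverse_sequence Q q"
    "splits_as_product W w P p Q q"
    "\<forall>i. nullhomotopic_map (P (Suc i)) (P i) (p i)"
    "\<forall>i. homotopy_equivalence_map (Q (Suc i)) (Q i) (q i)"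
  show limit: "inverse_limit W w homotopy_equivalent_space Q 0"
    using * by (intro split_tower_limit) auto
  show "has_CW_homotopy_type TYPE('c) (inverse_limit W w)" if "has_CW_homotopy_type TYPE('c) (Q 0)"
    using that homotopy_eqv_trans[OF limit] unfolding has_CW_homotopy_type_def by blast
qed (rule loop_tower_splitting; blast)

end
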